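(* Let $H$ be a Hilbert space, $A:H\to H$ a known linear operator, and $\xi$ a Gaussian random vector in $H$ with $E\xi=0$ and known covariance operator $R:H\to H$; suppose that the kernels of $A$ and $R$ equal zero. One observes $Y=Ax+\epsilon\xi$, $\epsilon>0$, where $x$ belongs to a closed linear subspace $\Theta$ of $H$. Let $\Theta_0,\Theta_1\subset\Theta$ and consider testing $H_0:x\in\Theta_0$ versus $H_1:x\in\Theta_1$. Put $\Lambda_0=R^{-1/2}A\Theta_0$, $\Lambda_1=R^{-1/2}A\Theta_1$, and let $\Lambda$ be the closure of the linear space of all linear combinations of vectors from $\Lambda_0\cup\Lambda_1$. Suppose that $\Lambda_0$ and $\Lambda_1$ are bounded in $H$. Then $H_0$ and $H_1$ are (i) indistinguishable if there does not exist a finite dimensional subspace $\Gamma\subset\Lambda$ such that $\Pi_\Gamma\bar\Lambda_0\cap\Pi_\Gamma\bar\Lambda_1=\emptyset$; (ii) distinguishable if there exists a finite dimensional subspace $\Gamma\subset\Lambda$ such that $\Pi_\Gamma\bar\Lambda_0\cap\Pi_\Gamma\bar\Lambda_1=\emptyset$.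
   Context: $\Pi_\Gamma$ is the projection operator of $H$ onto the linear subspace $\Gamma$. For a set $\Psi\subset H$, $\bar\Psi$ is the closure of $\Psi$ in $H$; thus $\Pi_\Gamma\bar\Lambda_i$ is the projection of the closure of $\Lambda_i$. It is implicit that $R^{-1/2}A$ is defined on $\Theta_0\cup\Theta_1$. If $R$ is not trace class, $\xi$ is understood as a generalized Gaussian vector, i.e. one observes the family $(Y,h)=(Ax,h)+\epsilon\,\xi(h)$, $h\in H$, where $\xi(h)$ is a centered Gaussian family, linear in $h$, with covariance $E[\xi(h)\xi(h')]=(Rh,h')$. A test is a measurable function $K_\epsilon=K_\epsilon(Y)$ with values in $[0,1]$; $\alpha(K_\epsilon)=\sup_{x\in\Theta_0}E_x[K_\epsilon]$ and $\beta(K_\epsilon)=\sup_{x\in\Theta_1}E_x[1-K_\epsilon]$, where $E_x$ is expectation when the unknown vector is $x$. $H_0$ and $H_1$ are distinguishable if for every $0<\alpha<1$ there is a family of tests $K_\epsilon$, $\epsilon>0$, with $\alpha(K_\epsilon)<\alpha$ and $\lim_{\epsilon\to0}\beta(K_\epsilon)=0$. They are indistinguishable if $\alpha(K_\epsilon)+\beta(K_\epsilon)\ge1$ for every $\epsilon>0$ and every test $K_\epsilon$.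
   Formalization: The closures of Λ_0 and Λ_1 are taken in the weak topology of H; with norm closure (ii) is false, e.g. A=R=I on ℓ², Θ_0={0}, Θ_1={e_n+e_1/n : n≥2}. *)

theory Defs
  imports "HOL-Probability.Probability"
begin

section \<open>Operators on a real Hilbert space\<close>

text \<open>A covariance operator is defined on all of the space and satisfies
  (Rh,h') = E[xi(h) xi(h')], hence it is symmetric and nonnegative; boundedness is then
  automatic (Hellinger--Toeplitz) and is only recorded here.\<close>

definition nonneg_operator :: "('a::real_inner \<Rightarrow> 'a) \<Rightarrow> bool" where
  "nonneg_operator R \<longleftrightarrow> bounded_linear R
     \<and> (\<forall>x y. inner (R x) y = inner x (R y)) \<and> (\<forall>x. 0 \<le> inner (R x) x)"

text \<open>On a Hilbert space the nonnegative square root exists and is unique.\<close>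

definition op_sqrt :: "('a::real_inner \<Rightarrow> 'a) \<Rightarrow> 'a \<Rightarrow> 'a" where
  "op_sqrt R = (SOME S. nonneg_operator S \<and> S \<circ> S = R)"

text \<open>When R has zero kernel, so has its square root, and the following is the (possibly
  unbounded) operator \<open>R\<^sup>-\<^sup>1\<^sup>/\<^sup>2\<close>. It is meaningful on the range of
  \<^term>\<open>op_sqrt R\<close> only.\<close>

definition op_inv_sqrt :: "('a::real_inner \<Rightarrow> 'a) \<Rightarrow> 'a \<Rightarrow> 'a" where
  "op_inv_sqrt R = inv (op_sqrt R)"

definition orthonormal_basis :: "'a::real_inner set \<Rightarrow> bool" where
  "orthonormal_basis B \<longleftrightarrow> pairwise orthogonal B \<and> (\<forall>e\<in>B. norm e = 1)
     \<and> closure (span B) = UNIV"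

text \<open>Trace class, for nonnegative operators; the sum does not depend on the basis.\<close>

definition trace_class :: "('a::real_inner \<Rightarrow> 'a) \<Rightarrow> bool" where
  "trace_class R \<longleftrightarrow> (\<exists>B. orthonormal_basis B \<and> (\<lambda>e. inner (R e) e) summable_on B)"

definition finite_dim_subspace :: "'a::real_vector set \<Rightarrow> bool" where
  "finite_dim_subspace G \<longleftrightarrow> (\<exists>B. finite B \<and> span B = G)"

definition orth_proj :: "'a::real_inner set \<Rightarrow> 'a \<Rightarrow> 'a" where
  "orth_proj G x = (THE y. y \<in> G \<and> (\<forall>z\<in>G. inner (x - y) z = 0))"

section \<open>Closure of a set of signals and separation by finite dimensional projections\<close>

text \<open>The coarsest topology making every functional \<open>x \<mapsto> (x,h)\<close> continuous. By the Riesz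
  representation theorem this is the weak topology of a Hilbert space.\<close>

definition weak_topology :: "'a::real_inner topology" where
  "weak_topology = topology_generated_by {(\<lambda>x. inner x h) -` U | h U. open U}"

text \<open>The bar over the sets of signals denotes closure in the weak topology. For bounded S the
  projection of the weak closure onto a finite dimensional subspace G is compact and is the same
  set as \<open>closure (orth_proj G ` S)\<close>. The norm closure would not do: for the identity
  operators on \<open>\<ell>\<^sup>2\<close>, \<open>S\<^sub>0 = {0}\<close> and \<open>S\<^sub>1 = {e\<^sub>n + (1/n) e\<^sub>1 | n \<ge> 2}\<close> are
  bounded and norm closed and have disjoint projections onto a line, but 0 is a weak limit
  of \<open>S\<^sub>1\<close> and the two hypotheses are indistinguishable.\<close>

definition weak_closure :: "'a::real_inner set \<Rightarrow> 'a set" where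
  "weak_closure S = weak_topology closure_of S"

definition separated_by_projection :: "'a::real_inner set \<Rightarrow> 'a set \<Rightarrow> bool" where
  "separated_by_projection S0 S1 \<longleftrightarrow>
     (\<exists>G. finite_dim_subspace G \<and> G \<subseteq> closure (span (S0 \<union> S1))
        \<and> orth_proj G ` weak_closure S0 \<inter> orth_proj G ` weak_closure S1 = {})"

section \<open>Gaussian noise\<close>

text \<open>Point mass at 0 counts as a (degenerate) normal law.\<close>

definition centered_normal :: "'w measure \<Rightarrow> ('w \<Rightarrow> real) \<Rightarrow> bool" where
  "centered_normal M X \<longleftrightarrow> X \<in> borel_measurable M \<and>
     ((AE \<omega> in M. X \<omega> = 0) \<or> (\<exists>\<sigma>>0. distributed M lborel X (normal_density 0 \<sigma>)))"

text \<open>A generalized Gaussian vector: a centered (jointly) Gaussian family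
  indexed by the Hilbert space, linear in the index almost surely, with covariance operator R.\<close>

definition gaussian_family ::
  "'w measure \<Rightarrow> ('a::real_inner \<Rightarrow> 'a) \<Rightarrow> ('a \<Rightarrow> 'w \<Rightarrow> real) \<Rightarrow> bool" where
  "gaussian_family M R \<xi> \<longleftrightarrow> prob_space M
     \<and> (\<forall>F c. finite F \<longrightarrow> centered_normal M (\<lambda>\<omega>. \<Sum>h\<in>F. c h * \<xi> h \<omega>))
     \<and> (\<forall>a b h h'. AE \<omega> in M. \<xi> (a *\<^sub>R h + b *\<^sub>R h') \<omega> = a * \<xi> h \<omega> + b * \<xi> h' \<omega>)
     \<and> (\<forall>h h'. (\<integral>\<omega>. \<xi> h \<omega> * \<xi> h' \<omega> \<partial>M) = inner (R h) h')"

definition gaussian_vector ::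
  "'w measure \<Rightarrow> ('a::real_inner \<Rightarrow> 'a) \<Rightarrow> ('w \<Rightarrow> 'a) \<Rightarrow> bool" where
  "gaussian_vector M R \<xi> \<longleftrightarrow> \<xi> \<in> borel_measurable M \<and> gaussian_family M R (\<lambda>h \<omega>. inner (\<xi> \<omega>) h)"

section \<open>Observations, tests and distinguishability\<close>

text \<open>Laws of the observation \<open>Y = Ax + \<epsilon>\<xi>\<close>: a random element of the Hilbert space,
  respectively the random family \<open>(Ax,h) + \<epsilon> \<xi>(h)\<close> in the product space over all h.\<close>

definition vector_law ::
  "('a::real_inner \<Rightarrow> 'a) \<Rightarrow> 'w measure \<Rightarrow> ('w \<Rightarrow> 'a) \<Rightarrow> real \<Rightarrow> 'a \<Rightarrow> 'a measure" where
  "vector_law A M \<xi> \<epsilon> x = distr M borel (\<lambda>\<omega>. A x + \<epsilon> *\<^sub>R \<xi> \<omega>)"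

definition family_law ::
  "('a::real_inner \<Rightarrow> 'a) \<Rightarrow> 'w measure \<Rightarrow> ('a \<Rightarrow> 'w \<Rightarrow> real) \<Rightarrow> real \<Rightarrow> 'a \<Rightarrow> ('a \<Rightarrow> real) measure" where
  "family_law A M \<xi> \<epsilon> x =
     distr M (Pi\<^sub>M UNIV (\<lambda>_. borel)) (\<lambda>\<omega> h. inner (A x) h + \<epsilon> * \<xi> h \<omega>)"

definition is_test :: "'y measure \<Rightarrow> ('y \<Rightarrow> real) \<Rightarrow> bool" where
  "is_test N K \<longleftrightarrow> K \<in> borel_measurable N \<and> (\<forall>y\<in>space N. 0 \<le> K y \<and> K y \<le> 1)"

text \<open>The suprema are taken in \<^typ>\<open>ennreal\<close>, so that the supremum over an empty set of
  signals is 0.\<close>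

definition type_I_error :: "('x \<Rightarrow> 'y measure) \<Rightarrow> 'x set \<Rightarrow> ('y \<Rightarrow> real) \<Rightarrow> ennreal" where
  "type_I_error P X0 K = (SUP x\<in>X0. \<integral>\<^sup>+ y. ennreal (K y) \<partial>P x)"

definition type_II_error :: "('x \<Rightarrow> 'y measure) \<Rightarrow> 'x set \<Rightarrow> ('y \<Rightarrow> real) \<Rightarrow> ennreal" where
  "type_II_error P X1 K = (SUP x\<in>X1. \<integral>\<^sup>+ y. ennreal (1 - K y) \<partial>P x)"

text \<open>Below, N carries the sigma-algebra of the observation space and
  \<open>P \<epsilon> x\<close> is the law of the observation at noise level \<open>\<epsilon>\<close> when the unknown vector is x.\<close>

definition distinguishable ::
  "'y measure \<Rightarrow> (real \<Rightarrow> 'x \<Rightarrow> 'y measure) \<Rightarrow> 'x set \<Rightarrow> 'x set \<Rightarrow> bool" where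
  "distinguishable N P X0 X1 \<longleftrightarrow>
     (\<forall>\<alpha>::real. 0 < \<alpha> \<and> \<alpha> < 1 \<longrightarrow>
        (\<exists>K. (\<forall>\<epsilon>>0. is_test N (K \<epsilon>) \<and> type_I_error (P \<epsilon>) X0 (K \<epsilon>) < ennreal \<alpha>)
           \<and> ((\<lambda>\<epsilon>. type_II_error (P \<epsilon>) X1 (K \<epsilon>)) \<longlongrightarrow> 0) (at_right 0)))"

definition indistinguishable ::
  "'y measure \<Rightarrow> (real \<Rightarrow> 'x \<Rightarrow> 'y measure) \<Rightarrow> 'x set \<Rightarrow> 'x set \<Rightarrow> bool" where
  "indistinguishable N P X0 X1 \<longleftrightarrow>
     (\<forall>\<epsilon>>0. \<forall>K. is_test N K \<longrightarrow> 1 \<le> type_I_error (P \<epsilon>) X0 K + type_II_error (P \<epsilon>) X1 K)"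

end

theory Submission
  imports Defs
begin

text \<open>Let \<open>S\<close> be the positive square root of \<open>R\<close>, and write \<open>\<lambda> = S\<^sup>-\<^sup>1Ax\<close> for the rescaled signal. The
  noise can be written as \<open>\<xi>(h) = W(Sh)\<close>, where \<open>W\<close> is an isonormal process: a centred Gaussian
  family, linear in its index, with \<open>E[W(g)W(h)] = (g,h)\<close>. The observation becomes
  \<open>Y(h) = (\<lambda>,Sh) + \<epsilon>W(Sh)\<close>, so the hypotheses concern the shift \<open>\<lambda>\<close> of a white noise, with
  \<open>\<lambda>\<close> in \<open>\<Lambda>\<^sub>0\<close> or in \<open>\<Lambda>\<^sub>1\<close>.

  \<^emph>\<open>Indistinguishability.\<close> By the Cameron--Martin theorem (\<open>law_eq_density\<close>) the law with shift \<open>\<lambda>\<close>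
  has the density \<open>L(\<lambda>/\<epsilon>)\<close>, \<open>L(g) = exp(W(g) - |g|\<^sup>2/2)\<close>, with respect to the law with shift 0. A
  test \<open>K\<close> therefore has expectation \<open>\<phi>(\<lambda>) = E[K L(\<lambda>/\<epsilon>)]\<close>. Replace \<open>K\<close> by a nearly best
  approximation in \<open>L\<^sup>2\<close> from the span of the functions \<open>L(\<mu>/\<epsilon>)\<close>, \<open>\<mu> \<in> \<Lambda>\<^sub>0 \<union> \<Lambda>\<^sub>1\<close>; the
  remainder is nearly orthogonal to all of them, and since the norms of the \<open>L(\<mu>/\<epsilon>)\<close> are bounded,
  \<open>\<phi>\<close> changes by little, uniformly on \<open>\<Lambda>\<^sub>0 \<union> \<Lambda>\<^sub>1\<close> (\<open>L2_span_approximation\<close>). Because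
  \<open>E[L(g)L(h)] = exp (g,h)\<close>, \<open>\<phi>\<close> is uniformly close to a finite sum
  \<open>\<Sum> c\<^sub>j exp((\<lambda>,\<mu>\<^sub>j)/\<epsilon>\<^sup>2)\<close>, and such a sum depends only on the projection of \<open>\<lambda>\<close> onto the
  finite dimensional span of the \<open>\<mu>\<^sub>j\<close>. If the projections of the weak closures meet in every such
  space, then \<open>\<phi>\<close> takes almost equal values at some point of \<open>\<Lambda>\<^sub>0\<close> and some point of \<open>\<Lambda>\<^sub>1\<close>,
  and the two error probabilities add up to almost 1.

  \<^emph>\<open>Distinguishability.\<close> The weak closures of bounded sets are weakly compact, so disjoint
  projections onto a finite dimensional space lie at a positive distance
  (\<open>separated_by_projection_gap\<close>). The range of \<open>S\<close> is dense, so the gap survives when the finitely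
  many directions are replaced by observable ones \<open>Sh\<close> (\<open>gap_in_dense_range\<close>). The test that asks
  whether the corresponding observed coordinates lie near a point of a finite net of \<open>\<Lambda>\<^sub>1\<close> errs only
  if some coordinate of the noise is large, which has probability at most of order \<open>\<epsilon>\<close>.

  Both versions of the observation are covered by one abstract experiment
  (\<open>gaussian_experiment\<close>): what matters is that the sigma-algebra of the observation space is
  generated by the coordinates \<open>Y(h)\<close>. For a Gaussian family this is the definition of the product
  sigma-algebra. For a Gaussian vector it holds because an injective nonnegative trace class operator only exists
  on a separable space, where the inner products generate the Borel sets.\<close>

section \<open>Hilbert space: projections, square roots and weak compactness\<close>

lemma linear_coefficient_zero_of_quadratic_nonneg:
  fixes a b :: real
  assumes b: "0 \<le> b" and q: "\<And>t. 0 \<le> 2 * t * a + t\<^sup>2 * b"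
  shows "a = 0"
proof (rule ccontr)
  assume "a \<noteq> 0"
  define s where "s = b + 1"
  have s: "0 < s" "b - 2 * s < 0" using b by (auto simp: s_def)
  have "0 \<le> 2 * (- a / s) * a + (- a / s)\<^sup>2 * b" by (rule q)
  also have "\<dots> = a\<^sup>2 * (b - 2 * s) / s\<^sup>2"
    using s by (simp add: field_simps power2_eq_square)
  also have "\<dots> < 0"
    using s \<open>a \<noteq> 0\<close> by (intro divide_neg_pos mult_pos_neg) auto
  finally show False by simp
qed

text \<open>The functional is represented by the minimiser of \<open>J(x) = |x|\<^sup>2 - 2f(x)\<close>: the parallelogram law
  makes every minimising sequence a Cauchy sequence, and the first variation of \<open>J\<close> at the limit is
  the claimed identity. On the whole space this is the Riesz representation theorem; for
  \<open>f = inner x\<close> it yields the orthogonal projection of \<open>x\<close> onto the closed subspace \<open>V\<close>.\<close>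

lemma riesz_on_closed_subspace:
  fixes V :: "'a::{real_inner,complete_space} set" and f :: "'a \<Rightarrow> real"
  assumes V: "subspace V" "closed V"
    and add: "\<And>x y. x \<in> V \<Longrightarrow> y \<in> V \<Longrightarrow> f (x + y) = f x + f y"
    and scale: "\<And>c x. x \<in> V \<Longrightarrow> f (c *\<^sub>R x) = c * f x"
    and bound: "\<And>x. x \<in> V \<Longrightarrow> \<bar>f x\<bar> \<le> C * norm x"
  obtains u where "u \<in> V" "\<And>z. z \<in> V \<Longrightarrow> inner u z = f z"
proof -
  define J where "J x = inner x x - 2 * f x" for x
  define m where "m = Inf (J ` V)"
  have lower: "- C\<^sup>2 \<le> J x" if "x \<in> V" for x
  proof -
    have "0 \<le> (norm x - C)\<^sup>2" by simp
    moreover have "f x \<le> C * norm x" using bound[OF that] by simp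
    ultimately show ?thesis
      by (simp add: J_def dot_square_norm power2_diff algebra_simps)
  qed
  have bdd: "bdd_below (J ` V)" using lower by (auto intro!: bdd_belowI)
  have ne: "J ` V \<noteq> {}" using subspace_0[OF V(1)] by auto
  have m_le: "m \<le> J x" if "x \<in> V" for x
    unfolding m_def using that bdd by (simp add: cInf_lower)
  have "\<exists>x\<in>V. J x < m + 1 / (real n + 1)" for n
    using cInf_lessD[OF ne, of "m + 1 / (real n + 1)"] by (auto simp: m_def)
  then obtain x where xV: "\<And>n. x n \<in> V" and xJ: "\<And>n. J (x n) < m + 1 / (real n + 1)"
    by metis
  \<comment> \<open>Parallelogram law, applied to the midpoint of two almost minimisers.\<close>
  have dist_x: "inner (x n - x k) (x n - x k) \<le> 2 * (1 / (real n + 1) + 1 / (real k + 1))" for n k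
  proof -
    have "m \<le> J ((1/2) *\<^sub>R (x n + x k))"
      by (intro m_le subspace_scale subspace_add V xV)
    moreover have "f ((1/2) *\<^sub>R (x n + x k)) = (f (x n) + f (x k)) / 2"
      using add[OF xV xV, of n k] scale[of "x n + x k" "1/2"] subspace_add[OF V(1) xV xV, of n k]
      by simp
    ultimately show ?thesis
      using xJ[of n] xJ[of k] unfolding J_def inner_scaleR_left inner_scaleR_right
        inner_add_left inner_add_right inner_diff_left inner_diff_right inner_commute[of "x k" "x n"]
      by argo
  qed
  have "Cauchy x"
  proof (rule metric_CauchyI)
    fix e :: real assume e: "0 < e"
    obtain N where N: "4 / e\<^sup>2 < real N" using reals_Archimedean2 by blast
    have "dist (x n) (x k) < e" if "n \<ge> N" "k \<ge> N" for n k
    proof -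
      have "1 / (real n + 1) \<le> 1 / (real N + 1)" "1 / (real k + 1) \<le> 1 / (real N + 1)"
        using that by (auto intro!: divide_left_mono)
      then have "(dist (x n) (x k))\<^sup>2 \<le> 4 / (real N + 1)"
        using dist_x[of n k] by (simp add: dist_norm dot_square_norm)
      also have "\<dots> < e\<^sup>2"
        using N e by (simp add: field_simps) (smt (verit) zero_less_power)
      finally show ?thesis using e by (simp add: power_less_imp_less_base)
    qed
    then show "\<exists>M. \<forall>m\<ge>M. \<forall>n\<ge>M. dist (x m) (x n) < e" by blast
  qed
  then obtain u where u: "x \<longlonglongrightarrow> u" using Cauchy_convergent convergent_def by blast
  have uV: "u \<in> V" using closed_sequentially[OF V(2)] xV u by blast
  have "inner u z = f z" if z: "z \<in> V" for z
  proof -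
    \<comment> \<open>The variation is estimated along the minimising sequence and passed to the limit.\<close>
    have "0 \<le> 2 * t * (inner u z - f z) + t\<^sup>2 * inner z z" for t
    proof -
      have lim: "(\<lambda>n. 2 * t * (inner (x n) z - f z) + t\<^sup>2 * inner z z + 1 / (real n + 1))
          \<longlonglongrightarrow> 2 * t * (inner u z - f z) + t\<^sup>2 * inner z z + 0"
        by (intro tendsto_intros u) (use LIMSEQ_inverse_real_of_nat in \<open>simp add: inverse_eq_divide add.commute\<close>)
      have "0 \<le> 2 * t * (inner (x n) z - f z) + t\<^sup>2 * inner z z + 1 / (real n + 1)" for n
      proof -
        have tz: "t *\<^sub>R z \<in> V" using z V(1) by (simp add: subspace_scale)
        have "m \<le> J (x n + t *\<^sub>R z)" by (intro m_le subspace_add V xV tz)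
        moreover have "f (x n + t *\<^sub>R z) = f (x n) + t * f z"
          using add[OF xV tz] scale[OF z] by simp
        ultimately show ?thesis
          using xJ[of n] unfolding J_def
          by (simp add: inner_add_left inner_add_right inner_commute[of z "x n"] power2_eq_square algebra_simps)
      qed
      then show ?thesis using tendsto_lowerbound[OF lim, of 0] by simp
    qed
    then have "inner u z - f z = 0"
      by (rule linear_coefficient_zero_of_quadratic_nonneg[rotated]) simp
    then show ?thesis by simp
  qed
  with uV that show ?thesis by blast
qed

text \<open>One Gram--Schmidt step per generator: the part of the new generator orthogonal to the old span gives
  the correction term.\<close>

lemma orth_proj_finite_span_exists:
  assumes "finite B"
  shows "\<exists>y\<in>span B. \<forall>z\<in>span B. inner (x - y) z = (0::real)"
  using assms
proof (induction B arbitrary: x)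
  case empty
  then show ?case by simp
next
  case (insert b B)
  obtain p where p: "p \<in> span B" "\<And>z. z \<in> span B \<Longrightarrow> inner (b - p) z = 0"
    using insert.IH by blast
  obtain y where y: "y \<in> span B" "\<And>z. z \<in> span B \<Longrightarrow> inner (x - y) z = 0"
    using insert.IH by blast
  define r where "r = b - p"
  define c where "c = inner (x - y) r / inner r r"
  have sub: "span B \<subseteq> span (insert b B)" by (simp add: span_mono subset_insertI)
  have r_in: "r \<in> span (insert b B)"
    unfolding r_def using p sub by (intro span_diff) (auto intro: span_base)
  have "inner (x - (y + c *\<^sub>R r)) z = 0" if z_in: "z \<in> span (insert b B)" for z
  proof -
    obtain k where k: "z - k *\<^sub>R b \<in> span B" using z_in by (auto simp: span_breakdown_eq)
    define w where "w = z - k *\<^sub>R r"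
    have w: "w \<in> span B"
    proof -
      have "w = (z - k *\<^sub>R b) + k *\<^sub>R p" by (simp add: w_def r_def algebra_simps)
      then show ?thesis using k p(1) by (simp add: span_add span_scale)
    qed
    have "z = w + k *\<^sub>R r" by (simp add: w_def)
    moreover have "inner (x - y) w = 0" "inner r w = 0"
      using y(2) p(2) w by (auto simp: r_def)
    moreover have "inner (x - y) r = c * inner r r" by (auto simp: c_def)
    ultimately show ?thesis
      by (simp add: inner_add_left inner_add_right inner_diff_left algebra_simps)
  qed
  moreover have "y + c *\<^sub>R r \<in> span (insert b B)"
    using y sub r_in by (intro span_add span_scale) auto
  ultimately show ?case by blast
qed

lemma orth_proj_span:
  assumes "finite B"
  shows "orth_proj (span B) x \<in> span B" "z \<in> span B \<Longrightarrow> inner (x - orth_proj (span B) x) z = 0"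
proof -
  have "\<exists>!y. y \<in> span B \<and> (\<forall>z\<in>span B. inner (x - y) z = 0)"
  proof (rule ex_ex1I)
    show "\<exists>y. y \<in> span B \<and> (\<forall>z\<in>span B. inner (x - y) z = 0)"
      using orth_proj_finite_span_exists[OF assms] by blast
  next
    fix y y'
    assume y: "y \<in> span B \<and> (\<forall>z\<in>span B. inner (x - y) z = 0)"
      and y': "y' \<in> span B \<and> (\<forall>z\<in>span B. inner (x - y') z = 0)"
    then have "inner (x - y) (y - y') = 0" "inner (x - y') (y - y') = 0"
      by (auto simp: span_diff)
    then have "inner (y - y') (y - y') = 0" by (simp add: inner_diff_left)
    then show "y = y'" by simp
  qed
  from theI'[OF this] show "orth_proj (span B) x \<in> span B"
    "z \<in> span B \<Longrightarrow> inner (x - orth_proj (span B) x) z = 0"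
    unfolding orth_proj_def by blast+
qed

text \<open>Equality of projections onto a finite dimensional space is a statement about finitely many
  coordinates. In this form the separation condition enters both halves of the main result.\<close>

lemma orth_proj_span_eq_iff:
  assumes "finite B"
  shows "orth_proj (span B) x = orth_proj (span B) y \<longleftrightarrow> (\<forall>b\<in>B. inner x b = inner y b)"
proof
  assume eq: "orth_proj (span B) x = orth_proj (span B) y"
  show "\<forall>b\<in>B. inner x b = inner y b"
  proof
    fix b assume "b \<in> B"
    then have "b \<in> span B" by (rule span_base)
    from orth_proj_span(2)[OF assms this, of x] orth_proj_span(2)[OF assms this, of y] eq
    show "inner x b = inner y b" by (simp add: inner_diff_left)
  qed
next
  assume eq: "\<forall>b\<in>B. inner x b = inner y b"
  define p where "p = orth_proj (span B) x - orth_proj (span B) y"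
  have p: "p \<in> span B" unfolding p_def using orth_proj_span(1)[OF assms] by (intro span_diff) auto
  have "inner (x - y) z = 0" if "z \<in> span B" for z
    using that
  proof (induction rule: span_induct_alt)
    case base
    show ?case by simp
  next
    case (step c b z)
    then show ?case using eq by (simp add: inner_add_right inner_diff_left)
  qed
  then have "inner (x - y) p = 0" using p by blast
  moreover have "inner (x - orth_proj (span B) x) p = 0" "inner (y - orth_proj (span B) y) p = 0"
    using orth_proj_span(2)[OF assms p] by auto
  ultimately have "inner p p = 0" unfolding p_def by (simp add: inner_diff_left)
  then show "orth_proj (span B) x = orth_proj (span B) y" by (simp add: p_def)
qed

text \<open>With \<open>T = I - R/c\<close> a contraction, a square root of \<open>R/c = I - T\<close> is \<open>I - Q\<close> for a solution of
  \<open>2Q = T + Q\<^sup>2\<close>. The iteration \<open>Z\<^sub>n\<^sub>+\<^sub>1 = (T + Z\<^sub>n\<^sup>2)/2\<close> from \<open>Z\<^sub>0 = 0\<close> converges because it is dominated by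
  the scalar iteration \<open>z\<^sub>n\<^sub>+\<^sub>1 = (1 + z\<^sub>n\<^sup>2)/2\<close>, which increases and is bounded by 1: the identity
  \<open>U\<^sup>2 - V\<^sup>2 = (U - V)U + V(U - V)\<close>, valid for operators that need not commute, gives
  \<open>|Z\<^sub>n\<^sub>+\<^sub>1 - Z\<^sub>n| \<le> z\<^sub>n\<^sub>+\<^sub>1 - z\<^sub>n\<close> by induction.\<close>

lemma nonneg_operator_exists_sqrt:
  fixes R :: "'a::{real_inner,complete_space} \<Rightarrow> 'a"
  assumes "nonneg_operator R"
  shows "\<exists>S. nonneg_operator S \<and> S \<circ> S = R"
proof -
  have Rlin: "bounded_linear R" and Rsym: "\<And>x y. inner (R x) y = inner x (R y)"
    and Rpos: "\<And>x. 0 \<le> inner (R x) x"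
    using assms by (auto simp: nonneg_operator_def)
  interpret R: bounded_linear R by (rule Rlin)
  obtain c where c: "c > 0" "\<And>x. norm (R x) \<le> norm x * c"
    using R.pos_bounded by blast
  define T where "T x = x - (1/c) *\<^sub>R R x" for x
  have Tlin: "linear T"
    unfolding T_def by (intro linearI) (auto simp: R.add R.scaleR algebra_simps)
  have Tsym: "inner (T x) y = inner x (T y)" for x y
    by (simp add: T_def inner_diff_left inner_diff_right Rsym)
  have Tnorm: "norm (T x) \<le> norm x" for x
  proof -
    define r where "r = inner (R x) (R x)"
    \<comment> \<open>Nonnegativity of the form at \<open>x - Rx/c\<close> gives \<open>|Rx|\<^sup>2 \<le> c (Rx,x)\<close>, which makes \<open>T\<close> a contraction.\<close>
    have "0 \<le> inner (R (x - (1/c) *\<^sub>R R x)) (x - (1/c) *\<^sub>R R x)" by (rule Rpos)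
    also have "\<dots> = inner (R x) x - 2 / c * r + inner (R (R x)) (R x) / c\<^sup>2"
      using c(1) by (simp add: R.diff R.scaleR inner_diff_left inner_diff_right Rsym[of "R x" x] r_def power2_eq_square field_simps)
    also have "inner (R (R x)) (R x) \<le> c * r"
    proof -
      have "inner (R (R x)) (R x) \<le> norm (R (R x)) * norm (R x)" by (rule norm_cauchy_schwarz)
      also have "\<dots> \<le> (norm (R x) * c) * norm (R x)" by (intro mult_right_mono c) simp
      finally show ?thesis by (simp add: r_def dot_square_norm power2_eq_square mult_ac)
    qed
    then have "inner (R x) x - 2 / c * r + inner (R (R x)) (R x) / c\<^sup>2 \<le> inner (R x) x - 2 / c * r + c * r / c\<^sup>2"
      by (simp add: divide_right_mono)
    finally have "r / c \<le> inner (R x) x"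
      using c(1) by (simp add: power2_eq_square field_simps)
    then have "r / c / c \<le> inner (R x) x / c" using c(1) by (intro divide_right_mono) auto
    moreover have "0 \<le> inner (R x) x / c" using c(1) Rpos[of x] by simp
    ultimately have "r / c\<^sup>2 \<le> 2 * (inner (R x) x / c)"
      by (simp add: power2_eq_square)
    then have "inner (T x) (T x) \<le> inner x x"
      by (simp add: T_def inner_diff_left inner_diff_right inner_commute[of x "R x"] r_def power2_eq_square diff_divide_distrib)
    then show ?thesis by (simp add: norm_le)
  qed
  define Z where "Z n = ((\<lambda>U x. (1/2) *\<^sub>R (T x + U (U x))) ^^ n) (\<lambda>x. 0)" for n
  define z where "z n = ((\<lambda>u::real. (1 + u * u) / 2) ^^ n) 0" for n
  have Z0: "Z 0 x = 0" and ZSuc: "Z (Suc n) x = (1/2) *\<^sub>R (T x + Z n (Z n x))" for n x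
    by (auto simp: Z_def)
  have z0: "z 0 = 0" and zSuc: "z (Suc n) = (1 + z n * z n) / 2" for n
    by (auto simp: z_def)
  have z01: "0 \<le> z n \<and> z n \<le> 1" for n
    by (induction n) (auto simp: z0 zSuc mult_le_one)
  have z_mono: "z n \<le> z (Suc n)" for n
  proof -
    have "0 \<le> (1 - z n)\<^sup>2" by simp
    then show ?thesis by (simp add: zSuc power2_eq_square algebra_simps)
  qed
  have Zlin: "linear (Z n)" for n
  proof (induction n)
    case 0
    then show ?case by (intro linearI) (auto simp: Z0)
  next
    case (Suc n)
    show ?case
      by (intro linearI)
        (auto simp: ZSuc linear_add[OF Suc] linear_add[OF Tlin] linear_scale[OF Suc] linear_scale[OF Tlin] algebra_simps)
  qed
  have Zsym: "inner (Z n x) y = inner x (Z n y)" for n x y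
    by (induction n arbitrary: x y) (auto simp: Z0 ZSuc inner_add_left inner_add_right Tsym)
  have Znorm: "norm (Z n x) \<le> z n * norm x" for n x
  proof (induction n arbitrary: x)
    case 0
    then show ?case by (simp add: Z0 z0)
  next
    case (Suc n)
    have "norm (Z n (Z n x)) \<le> z n * (z n * norm x)"
      using Suc[of "Z n x"] mult_left_mono[OF Suc[of x], of "z n"] z01[of n] by linarith
    then have "norm (T x + Z n (Z n x)) \<le> norm x + z n * (z n * norm x)"
      using norm_triangle_ineq[of "T x" "Z n (Z n x)"] Tnorm[of x] by linarith
    then show ?case unfolding ZSuc zSuc norm_scaleR by (simp add: field_simps)
  qed
  \<comment> \<open>Domination of the increments by those of the scalar iteration.\<close>
  have Zdiff: "norm (Z (Suc n) x - Z n x) \<le> (z (Suc n) - z n) * norm x" for n x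
  proof (induction n arbitrary: x)
    case 0
    then show ?case using Tnorm[of x] by (simp add: Z0 ZSuc z0 zSuc)
  next
    case (Suc n)
    define d where "d = z (Suc n) - z n"
    have d: "0 \<le> d" using z_mono[of n] by (simp add: d_def)
    have half: "p - q = (1/2) *\<^sub>R (a - b)"
      if "p = (1/2) *\<^sub>R (t + a)" "q = (1/2) *\<^sub>R (t + b)" for p q t a b :: 'a
      using that by (simp add: algebra_simps)
    have eq: "Z (Suc (Suc n)) x - Z (Suc n) x
      = (1/2) *\<^sub>R ((Z (Suc n) (Z (Suc n) x) - Z n (Z (Suc n) x)) + Z n (Z (Suc n) x - Z n x))"
      using half[OF ZSuc[of "Suc n" x] ZSuc[of n x]] by (simp add: linear_diff[OF Zlin])
    have a: "norm (Z (Suc n) (Z (Suc n) x) - Z n (Z (Suc n) x)) \<le> d * (z (Suc n) * norm x)"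
      using Suc[of "Z (Suc n) x"] mult_left_mono[OF Znorm[of "Suc n" x] d] by (simp add: d_def)
    have b: "norm (Z n (Z (Suc n) x - Z n x)) \<le> z n * (d * norm x)"
      using Znorm[of n "Z (Suc n) x - Z n x"] mult_left_mono[OF Suc[of x], of "z n"] z01[of n]
      by (simp add: d_def)
    have "norm (Z (Suc (Suc n)) x - Z (Suc n) x) \<le> (d * (z (Suc n) * norm x) + z n * (d * norm x)) / 2"
      unfolding eq using a b
        norm_triangle_ineq[of "Z (Suc n) (Z (Suc n) x) - Z n (Z (Suc n) x)" "Z n (Z (Suc n) x - Z n x)"]
      by simp
    also have "\<dots> = (z (Suc (Suc n)) - z (Suc n)) * norm x"
    proof -
      have "z (Suc (Suc n)) - z (Suc n) = (z (Suc n) * z (Suc n) - z n * z n) / 2"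
        using zSuc[of "Suc n"] zSuc[of n] by argo
      then have "(z (Suc (Suc n)) - z (Suc n)) * norm x = (z (Suc n) * z (Suc n) - z n * z n) / 2 * norm x"
        by simp
      also have "\<dots> = (d * (z (Suc n) * norm x) + z n * (d * norm x)) / 2"
        by (simp add: d_def algebra_simps)
      finally show ?thesis by simp
    qed
    finally show ?case .
  qed
  have Zdiff_add: "norm (Z (n + k) x - Z n x) \<le> (z (n + k) - z n) * norm x" for n k x
  proof (induction k)
    case 0
    then show ?case by simp
  next
    case (Suc k)
    have "norm (Z (n + Suc k) x - Z n x) \<le> norm (Z (Suc (n + k)) x - Z (n + k) x) + norm (Z (n + k) x - Z n x)"
      using norm_triangle_ineq[of "Z (Suc (n + k)) x - Z (n + k) x" "Z (n + k) x - Z n x"] by simp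
    then show ?case using Zdiff[of "n + k" x] Suc by (simp add: algebra_simps)
  qed
  have "Cauchy z"
  proof -
    have "convergent z"
      by (rule Bseq_monoseq_convergent)
        (use z01 z_mono in \<open>auto intro!: BseqI'[where K=1] simp: monoseq_Suc\<close>)
    then show ?thesis by (rule convergent_Cauchy)
  qed
  have "convergent (\<lambda>n. Z n x)" for x
  proof -
    have "Cauchy (\<lambda>n. Z n x)"
    proof (rule metric_CauchyI)
      fix e :: real assume e: "0 < e"
      define e' where "e' = e / (norm x + 1)"
      have e': "0 < e'" "e' * norm x < e"
        using e norm_ge_zero[of x] add_nonneg_pos[OF norm_ge_zero[of x] zero_less_one]
        by (auto simp: e'_def pos_divide_less_eq algebra_simps)
      obtain N where N: "\<And>m n. m \<ge> N \<Longrightarrow> n \<ge> N \<Longrightarrow> dist (z m) (z n) < e'"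
        using metric_CauchyD[OF \<open>Cauchy z\<close> e'(1)] by blast
      have *: "dist (Z m x) (Z n x) < e" if mn: "m \<ge> N" "n \<ge> m" for m n
      proof -
        obtain k where k: "n = m + k" using mn(2) le_Suc_ex by blast
        have "norm (Z n x - Z m x) \<le> (z n - z m) * norm x"
          using Zdiff_add[of m k x] k by simp
        also have "\<dots> \<le> e' * norm x"
          using N[of n m] mn by (intro mult_right_mono) (auto simp: dist_real_def)
        finally show ?thesis using e'(2) by (simp add: dist_norm norm_minus_commute)
      qed
      have "dist (Z m x) (Z n x) < e" if "m \<ge> N" "n \<ge> N" for m n
        using *[of m n] *[of n m] that by (cases "m \<le> n") (auto simp: dist_commute)
      then show "\<exists>M. \<forall>m\<ge>M. \<forall>n\<ge>M. dist (Z m x) (Z n x) < e" by blast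
    qed
    then show ?thesis using Cauchy_convergent by blast
  qed
  then obtain Q where Q: "\<And>x. (\<lambda>n. Z n x) \<longlonglongrightarrow> Q x"
    unfolding convergent_def by metis
  have Qlin: "linear Q"
  proof (rule linearI)
    fix x y :: 'a and k :: real
    have "(\<lambda>n. Z n (x + y)) \<longlonglongrightarrow> Q x + Q y"
      unfolding linear_add[OF Zlin] by (intro tendsto_intros Q)
    then show "Q (x + y) = Q x + Q y" using Q LIMSEQ_unique by blast
    have "(\<lambda>n. Z n (k *\<^sub>R x)) \<longlonglongrightarrow> k *\<^sub>R Q x"
      unfolding linear_scale[OF Zlin] by (intro tendsto_intros Q)
    then show "Q (k *\<^sub>R x) = k *\<^sub>R Q x" using Q LIMSEQ_unique by blast
  qed
  have Qsym: "inner (Q x) y = inner x (Q y)" for x y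
  proof -
    have "(\<lambda>n. inner (Z n x) y) \<longlonglongrightarrow> inner (Q x) y" by (intro tendsto_intros Q)
    moreover have "(\<lambda>n. inner (Z n x) y) \<longlonglongrightarrow> inner x (Q y)"
      unfolding Zsym by (intro tendsto_intros Q)
    ultimately show ?thesis by (rule LIMSEQ_unique)
  qed
  have Znorm1: "norm (Z n x) \<le> norm x" for n x
    using Znorm[of n x] z01[of n] mult_right_mono[of "z n" 1 "norm x"] by simp
  have Qnorm: "norm (Q x) \<le> norm x" for x
    by (rule tendsto_upperbound[OF tendsto_norm[OF Q]]) (auto simp: Znorm1)
  have ZZ: "(\<lambda>n. Z n (Z n x)) \<longlonglongrightarrow> Q (Q x)" for x
  proof -
    have "(\<lambda>n. Z n (Z n x - Q x)) \<longlonglongrightarrow> 0"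
    proof (rule Lim_null_comparison)
      show "\<forall>\<^sub>F n in sequentially. norm (Z n (Z n x - Q x)) \<le> norm (Z n x - Q x)"
        by (simp add: Znorm1)
      show "(\<lambda>n. norm (Z n x - Q x)) \<longlonglongrightarrow> 0"
        using Q LIM_zero tendsto_norm_zero by blast
    qed
    from tendsto_add[OF this Q[of "Q x"]] show ?thesis
      by (simp add: linear_diff[OF Zlin])
  qed
  have Qeq: "2 *\<^sub>R Q x = T x + Q (Q x)" for x
  proof -
    have "(\<lambda>n. Z (Suc n) x) \<longlonglongrightarrow> (1/2) *\<^sub>R (T x + Q (Q x))"
      unfolding ZSuc by (intro tendsto_intros ZZ)
    moreover have "(\<lambda>n. Z (Suc n) x) \<longlonglongrightarrow> Q x" using Q LIMSEQ_Suc by blast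
    ultimately have "Q x = (1/2) *\<^sub>R (T x + Q (Q x))" using LIMSEQ_unique by blast
    then have "2 *\<^sub>R Q x = 2 *\<^sub>R ((1/2) *\<^sub>R (T x + Q (Q x)))" by simp
    then show ?thesis by simp
  qed
  define S where "S x = sqrt c *\<^sub>R (x - Q x)" for x
  have "nonneg_operator S"
    unfolding nonneg_operator_def
  proof (intro conjI allI)
    show "bounded_linear S"
    proof (rule bounded_linear_intro)
      fix x y :: 'a and k :: real
      show "S (x + y) = S x + S y" "S (k *\<^sub>R x) = k *\<^sub>R S x"
        by (auto simp: S_def linear_add[OF Qlin] linear_scale[OF Qlin] algebra_simps)
      have "norm (x - Q x) \<le> norm x * 2" using norm_triangle_ineq4[of x "Q x"] Qnorm[of x] by simp
      then have "sqrt c * norm (x - Q x) \<le> sqrt c * (norm x * 2)" using c(1) by (intro mult_left_mono) auto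
      then show "norm (S x) \<le> norm x * (2 * sqrt c)"
        using c(1) by (simp add: S_def mult_ac)
    qed
    fix x y
    show "inner (S x) y = inner x (S y)"
      by (simp add: S_def inner_diff_left inner_diff_right Qsym)
    have "inner (Q x) x \<le> norm (Q x) * norm x" by (rule norm_cauchy_schwarz)
    also have "\<dots> \<le> norm x * norm x" by (intro mult_right_mono Qnorm) simp
    finally show "0 \<le> inner (S x) x"
      using c(1) by (simp add: S_def inner_diff_left dot_square_norm power2_eq_square)
  qed
  moreover have "S (S x) = R x" for x
  proof -
    have "S (S x) = c *\<^sub>R (x - 2 *\<^sub>R Q x + Q (Q x))"
      using c(1) by (simp add: S_def linear_diff[OF Qlin] linear_scale[OF Qlin] scaleR_2 algebra_simps)
    also have "\<dots> = c *\<^sub>R (x - T x)" by (simp add: Qeq)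
    also have "\<dots> = R x" using c(1) by (simp add: T_def)
    finally show ?thesis .
  qed
  ultimately show ?thesis by (intro exI[of _ S]) (auto simp: fun_eq_iff)
qed

lemma op_sqrt_properties:
  fixes R :: "'a::{real_inner,complete_space} \<Rightarrow> 'a"
  assumes "nonneg_operator R"
  shows "nonneg_operator (op_sqrt R)" "op_sqrt R (op_sqrt R x) = R x"
proof -
  have "nonneg_operator (op_sqrt R) \<and> op_sqrt R \<circ> op_sqrt R = R"
    unfolding op_sqrt_def using nonneg_operator_exists_sqrt[OF assms] by (rule someI_ex)
  then show "nonneg_operator (op_sqrt R)" "op_sqrt R (op_sqrt R x) = R x"
    by (auto simp: fun_eq_iff)
qed

lemma subspace_closure:
  fixes V :: "'a::real_normed_vector set"
  assumes V: "subspace V"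
  shows "subspace (closure V)"
proof (rule subspaceI)
  show "0 \<in> closure V" using subspace_0[OF V] closure_subset by blast
next
  fix x y assume "x \<in> closure V" "y \<in> closure V"
  then obtain p q where "\<forall>n. p n \<in> V" "p \<longlonglongrightarrow> x" "\<forall>n. q n \<in> V" "q \<longlonglongrightarrow> y"
    unfolding closure_sequential by blast
  then have "(\<forall>n. p n + q n \<in> V) \<and> (\<lambda>n. p n + q n) \<longlonglongrightarrow> x + y"
    using V by (auto intro: subspace_add tendsto_add)
  then show "x + y \<in> closure V" unfolding closure_sequential by (intro exI)
next
  fix c x assume "x \<in> closure V"
  then obtain p where "\<forall>n. p n \<in> V" "p \<longlonglongrightarrow> x"
    unfolding closure_sequential by blast
  then have "(\<forall>n. c *\<^sub>R p n \<in> V) \<and> (\<lambda>n. c *\<^sub>R p n) \<longlonglongrightarrow> c *\<^sub>R x"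
    using V by (auto intro: subspace_scale tendsto_scaleR)
  then show "c *\<^sub>R x \<in> closure V" unfolding closure_sequential by (intro exI)
qed

text \<open>The orthogonal complement of the range of a symmetric operator is its kernel.\<close>

lemma symmetric_injective_dense_range:
  fixes S :: "'a::{real_inner,complete_space} \<Rightarrow> 'a"
  assumes S: "nonneg_operator S" and inj: "\<And>x. S x = 0 \<Longrightarrow> x = 0"
  shows "closure (range S) = UNIV"
proof -
  interpret S: bounded_linear S using S by (simp add: nonneg_operator_def)
  have sub: "subspace (closure (range S))"
    using S.linear_axioms by (intro subspace_closure linear_subspace_image) auto
  have "x \<in> closure (range S)" for x
  proof -
    obtain u where u: "u \<in> closure (range S)" "\<And>z. z \<in> closure (range S) \<Longrightarrow> inner u z = inner x z"
      by (rule riesz_on_closed_subspace[OF sub closed_closure, of "inner x" "norm x"])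
        (auto simp: inner_add_right Cauchy_Schwarz_ineq2)
    have "inner (S (x - u)) y = 0" for y
    proof -
      have "inner u (S y) = inner x (S y)" by (intro u(2) subsetD[OF closure_subset] rangeI)
      then have "inner (x - u) (S y) = 0" by (simp add: inner_diff_left)
      then show ?thesis using S by (simp add: nonneg_operator_def)
    qed
    then have "S (x - u) = 0" using inner_eq_zero_iff by blast
    then show ?thesis using inj[of "x - u"] u(1) by simp
  qed
  then show ?thesis by blast
qed

text \<open>The sets on which finitely many functionals are close to their values at \<open>u\<close> form a neighbourhood
  base of \<open>u\<close> in the weak topology.\<close>

lemma weak_closure_iff:
  fixes S :: "'a::real_inner set"
  shows "u \<in> weak_closure S \<longleftrightarrow>
    (\<forall>F \<delta>. finite F \<longrightarrow> 0 < \<delta> \<longrightarrow> (\<exists>s\<in>S. \<forall>h\<in>F. \<bar>inner s h - inner u h\<bar> < \<delta>))"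
    (is "_ \<longleftrightarrow> ?R")
proof
  assume u: "u \<in> weak_closure S"
  show ?R
  proof (intro allI impI)
    fix F :: "'a set" and \<delta> :: real
    assume F: "finite F" and \<delta>: "0 < \<delta>"
    let ?N = "\<lambda>h. (\<lambda>x. inner x h) -` ball (inner u h) \<delta>"
    have "openin weak_topology (\<Inter>h\<in>F. ?N h)" if "F \<noteq> {}"
      using F that
      by (intro openin_Inter) (auto simp: weak_topology_def intro!: topology_generated_by_Basis)
    moreover have "openin weak_topology UNIV"
      unfolding weak_topology_def by (rule topology_generated_by_Basis) (force intro!: exI[of _ UNIV])
    ultimately have "openin weak_topology (\<Inter>h\<in>F. ?N h)" by (cases "F = {}") auto
    moreover have "u \<in> (\<Inter>h\<in>F. ?N h)" using \<delta> by simp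
    ultimately obtain s where "s \<in> S" "s \<in> (\<Inter>h\<in>F. ?N h)"
      using u unfolding weak_closure_def in_closure_of by blast
    then show "\<exists>s\<in>S. \<forall>h\<in>F. \<bar>inner s h - inner u h\<bar> < \<delta>"
      by (auto simp: dist_real_def abs_minus_commute intro!: bexI[of _ s])
  qed
next
  assume R: ?R
  have nbhd: "\<exists>F \<delta>. finite F \<and> 0 < \<delta> \<and> (\<forall>s. (\<forall>h\<in>F. \<bar>inner s h - inner u h\<bar> < \<delta>) \<longrightarrow> s \<in> T)"
    if "generate_topology_on {(\<lambda>x. inner x h) -` U | h U. open U} T" "u \<in> T" for T
    using that
  proof (induction rule: generate_topology_on.induct)
    case Empty
    then show ?case by simp
  next
    case (Int a b)
    from Int.IH(1) Int.prems obtain F \<delta> where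
      "finite F" "0 < \<delta>" "\<And>s. \<forall>h\<in>F. \<bar>inner s h - inner u h\<bar> < \<delta> \<Longrightarrow> s \<in> a"
      by auto
    moreover from Int.IH(2) Int.prems obtain F' \<delta>' where
      "finite F'" "0 < \<delta>'" "\<And>s. \<forall>h\<in>F'. \<bar>inner s h - inner u h\<bar> < \<delta>' \<Longrightarrow> s \<in> b"
      by auto
    ultimately show ?case by (intro exI[of _ "F \<union> F'"] exI[of _ "min \<delta> \<delta>'"]) auto
  next
    case (UN K)
    then obtain k where "k \<in> K" "u \<in> k" by blast
    with UN.IH[of k] show ?case by (meson UnionI)
  next
    case (Basis s)
    then obtain h U where U: "s = (\<lambda>x. inner x h) -` U" "open U" by blast
    with Basis.prems obtain \<delta> where "0 < \<delta>" "\<And>y. dist y (inner u h) < \<delta> \<Longrightarrow> y \<in> U"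
      using open_dist by (metis vimageD)
    then show ?case using U by (intro exI[of _ "{h}"] exI[of _ \<delta>]) (auto simp: dist_real_def)
  qed
  show "u \<in> weak_closure S"
    unfolding weak_closure_def in_closure_of
  proof (intro conjI allI impI)
    have "openin weak_topology (UNIV :: 'a set)"
      unfolding weak_topology_def by (rule topology_generated_by_Basis) (force intro!: exI[of _ UNIV])
    then show "u \<in> topspace weak_topology" using openin_subset by blast
    fix T assume T: "u \<in> T \<and> openin weak_topology T"
    then have "generate_topology_on {(\<lambda>x. inner x h) -` U | h U. open U} T"
      by (simp add: weak_topology_def openin_topology_generated_by_iff)
    from nbhd[OF this] T R show "\<exists>y. y \<in> S \<and> y \<in> T" by meson
  qed
qed

text \<open>The weak topology is studied inside the product space of all real functions on \<open>H\<close>, where a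
  vector \<open>x\<close> becomes the function \<open>inner x\<close>. Pointwise limits of functionals bounded by \<open>r\<close> are
  again linear and bounded by \<open>r\<close>, and so come from vectors, by the Riesz representation theorem.\<close>

lemma closure_of_functionals:
  fixes S :: "'a::{real_inner,complete_space} set"
  assumes r: "\<And>x. x \<in> S \<Longrightarrow> norm x \<le> r"
    and f: "f \<in> closure ((\<lambda>x. inner x) ` S)"
  shows "\<exists>u\<in>weak_closure S. f = inner u"
proof -
  have cont: "continuous_on UNIV (\<lambda>g. g h :: real)" for h :: 'a by simp
  have mem: "P f" if "closed {g. P g}" "\<And>x. x \<in> S \<Longrightarrow> P (inner x)" for P :: "('a \<Rightarrow> real) \<Rightarrow> bool"
    using closure_minimal[of "(\<lambda>x. inner x) ` S" "{g. P g}"] that f by blast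
  have add: "f (x + y) = f x + f y" for x y
    by (rule mem) (auto simp: inner_add_right intro!: closed_Collect_eq continuous_intros cont)
  have scale: "f (c *\<^sub>R x) = c * f x" for c x
    by (rule mem) (auto intro!: closed_Collect_eq continuous_intros cont)
  have bound: "\<bar>f x\<bar> \<le> r * norm x" for x
  proof (rule mem)
    show "closed {g :: 'a \<Rightarrow> real. \<bar>g x\<bar> \<le> r * norm x}"
      by (intro closed_Collect_le continuous_intros cont)
    fix s assume "s \<in> S"
    then show "\<bar>inner s x\<bar> \<le> r * norm x"
      using Cauchy_Schwarz_ineq2[of s x] mult_right_mono[OF r, of s "norm x"] by simp
  qed
  obtain u where u: "\<And>z. inner u z = f z"
    by (rule riesz_on_closed_subspace[of UNIV f r]) (auto simp: add scale bound)
  have "u \<in> weak_closure S"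
    unfolding weak_closure_iff
  proof (intro allI impI)
    fix F :: "'a set" and \<delta> :: real
    assume F: "finite F" and \<delta>: "0 < \<delta>"
    let ?N = "{g. \<forall>h\<in>F. \<bar>g h - f h\<bar> < \<delta>}"
    have "?N = (\<Inter>h\<in>F. {g. \<bar>g h - f h\<bar> < \<delta>})" by auto
    moreover have "open (\<Inter>h\<in>F. {g :: 'a \<Rightarrow> real. \<bar>g h - f h\<bar> < \<delta>})"
      using F by (intro open_INT ballI open_Collect_less continuous_intros cont)
    ultimately have "open ?N" by simp
    moreover have "f \<in> ?N" using \<delta> by simp
    ultimately have "(\<lambda>x. inner x) ` S \<inter> ?N \<noteq> {}"
      using f open_Int_closure_eq_empty[of ?N "(\<lambda>x. inner x) ` S"] by blast
    then show "\<exists>s\<in>S. \<forall>h\<in>F. \<bar>inner s h - inner u h\<bar> < \<delta>" by (auto simp: u)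
  qed
  moreover have "f = inner u" by (auto simp: u)
  ultimately show ?thesis by blast
qed

text \<open>Tychonoff's theorem for the product of the intervals \<open>[-r|h|, r|h|]\<close>. With the preceding lemma this
  is the weak compactness of the weak closure of a bounded set.\<close>

lemma compact_closure_of_functionals:
  fixes S :: "'a::real_inner set"
  assumes r: "\<And>x. x \<in> S \<Longrightarrow> norm x \<le> r"
  shows "compact (closure ((\<lambda>x. inner x) ` S))"
proof -
  let ?K = "Pi\<^sub>E UNIV (\<lambda>h::'a. {- (r * norm h) .. r * norm h})"
  have "compactin (product_topology (\<lambda>_. euclidean) UNIV) ?K"
    by (subst compactin_PiE) auto
  then have K: "compact ?K"
    by (simp add: euclidean_product_topology)
  have "inner x h \<in> {- (r * norm h) .. r * norm h}" if "x \<in> S" for x h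
    using Cauchy_Schwarz_ineq2[of x h] mult_right_mono[OF r[OF that], of "norm h"] by auto
  then have "(\<lambda>x. inner x) ` S \<subseteq> ?K" by (auto simp: PiE_def Pi_def)
  moreover have "closed ?K"
  proof -
    have "?K = {f. \<forall>h. - (r * norm h) \<le> f h \<and> f h \<le> r * norm h}" by (auto simp: PiE_def Pi_def)
    then show ?thesis
      by (auto intro!: closed_Collect_all closed_Collect_conj closed_Collect_le continuous_intros)
  qed
  ultimately have "closure ((\<lambda>x. inner x) ` S) \<subseteq> ?K" by (simp add: closure_minimal)
  then show ?thesis
    using compact_Int_closed[OF K closed_closure[of "(\<lambda>x. inner x) ` S"]] by (simp add: inf.absorb2)
qed

text \<open>The distance of the two coordinate tuples is a continuous function on the product of the two compact
  closures, and so attains its minimum; a zero there would be a common point of the two projections.\<close>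

lemma separated_by_projection_gap:
  fixes S0 S1 :: "'a::{real_inner,complete_space} set"
  assumes sep: "separated_by_projection S0 S1" and b: "bounded S0" "bounded S1"
  obtains B \<delta> where "finite B" "0 < \<delta>"
    "\<And>x y. x \<in> S0 \<Longrightarrow> y \<in> S1 \<Longrightarrow> \<delta> \<le> (\<Sum>e\<in>B. \<bar>inner x e - inner y e\<bar>)"
proof -
  obtain B where B: "finite B"
    "orth_proj (span B) ` weak_closure S0 \<inter> orth_proj (span B) ` weak_closure S1 = {}"
    using sep unfolding separated_by_projection_def finite_dim_subspace_def by blast
  obtain r0 r1 where r0: "\<And>x. x \<in> S0 \<Longrightarrow> norm x \<le> r0" and r1: "\<And>x. x \<in> S1 \<Longrightarrow> norm x \<le> r1"
    using b by (auto simp: bounded_iff)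
  let ?C0 = "closure ((\<lambda>x. inner x) ` S0)" and ?C1 = "closure ((\<lambda>x. inner x) ` S1)"
  let ?g = "\<lambda>p. \<Sum>e\<in>B. \<bar>fst p e - snd p e\<bar> :: real"
  show thesis
  proof (cases "S0 = {} \<or> S1 = {}")
    case True
    then show thesis using B(1) by (intro that[of B 1]) auto
  next
    case False
    have K: "compact (?C0 \<times> ?C1)"
      by (intro compact_Times compact_closure_of_functionals[OF r0] compact_closure_of_functionals[OF r1])
    have ne: "?C0 \<times> ?C1 \<noteq> {}" using False by simp
    have coord: "continuous_on X (\<lambda>p. k p e)" if "continuous_on X k" for X e and k :: "_ \<Rightarrow> 'a \<Rightarrow> real"
      using continuous_on_product_then_coordinatewise[of X k e] that by simp
    have cont: "continuous_on (?C0 \<times> ?C1) ?g"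
      by (intro continuous_intros coord)
    obtain p where p: "p \<in> ?C0 \<times> ?C1" "\<And>q. q \<in> ?C0 \<times> ?C1 \<Longrightarrow> ?g p \<le> ?g q"
      using continuous_attains_inf[OF K ne cont] by blast
    obtain u where u: "u \<in> weak_closure S0" "fst p = inner u"
      using closure_of_functionals[of S0 r0 "fst p"] r0 p(1) by auto
    obtain v where v: "v \<in> weak_closure S1" "snd p = inner v"
      using closure_of_functionals[of S1 r1 "snd p"] r1 p(1) by auto
    have "orth_proj (span B) u \<noteq> orth_proj (span B) v" using B(2) u(1) v(1) by blast
    then obtain e where e: "e \<in> B" "inner u e \<noteq> inner v e"
      using orth_proj_span_eq_iff[OF B(1)] by blast
    have pos: "0 < ?g p"
      using B(1) e by (intro sum_pos2[of B e]) (auto simp: u v)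
    show thesis
    proof (rule that[OF B(1) pos])
      fix x y assume "x \<in> S0" "y \<in> S1"
      then have "(inner x, inner y) \<in> ?C0 \<times> ?C1"
        by (auto intro: subsetD[OF closure_subset])
      from p(2)[OF this] show "?g p \<le> (\<Sum>e\<in>B. \<bar>inner x e - inner y e\<bar>)" by simp
    qed
  qed
qed

text \<open>Meant for the range of the square root as \<open>D\<close>: the coordinates in these directions are the observable
  ones. On bounded sets a small change of the finitely many directions changes all coordinates by a small amount, uniformly.\<close>

lemma gap_in_dense_range:
  fixes S0 S1 :: "'a::real_inner set"
  assumes b: "bounded S0" "bounded S1" and dense: "closure D = UNIV"
    and B: "finite B" "0 < \<delta>"
    and gap: "\<And>x y. x \<in> S0 \<Longrightarrow> y \<in> S1 \<Longrightarrow> \<delta> \<le> (\<Sum>e\<in>B. \<bar>inner x e - inner y e\<bar>)"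
  obtains F \<eta> where "finite F" "F \<subseteq> D" "0 < \<eta>"
    "\<And>x y. x \<in> S0 \<Longrightarrow> y \<in> S1 \<Longrightarrow> \<exists>g\<in>F. \<eta> \<le> \<bar>inner x g - inner y g\<bar>"
proof -
  obtain r where r: "0 < r" "\<And>x. x \<in> S0 \<union> S1 \<Longrightarrow> norm x \<le> r"
    using bounded_Un b bounded_pos by metis
  define n where "n = real (card B) + 1"
  have n: "0 < n" by (simp add: n_def)
  \<comment> \<open>If all new coordinates differed by less than \<open>\<eta>\<close>, each old one would differ by at most \<open>2\<eta>\<close>, and the sum by less than \<open>2n\<eta> = \<delta>\<close>.\<close>
  define \<eta> where "\<eta> = \<delta> / (2 * n)"
  have \<eta>: "0 < \<eta>" using B n by (simp add: \<eta>_def)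
  have "\<exists>d\<in>D. norm (d - e) < \<eta> / (2 * r)" for e
    using dense closure_approachable[of e D] \<eta> r(1) by (auto simp: dist_norm)
  then obtain k where k: "\<And>e. k e \<in> D" "\<And>e. norm (k e - e) < \<eta> / (2 * r)" by metis
  have "\<exists>g\<in>k ` B. \<eta> \<le> \<bar>inner x g - inner y g\<bar>" if x: "x \<in> S0" and y: "y \<in> S1" for x y
  proof (rule ccontr)
    assume "\<not> ?thesis"
    then have small: "\<bar>inner x (k e) - inner y (k e)\<bar> < \<eta>" if "e \<in> B" for e using that by force
    have "\<bar>inner x e - inner y e\<bar> \<le> 2 * \<eta>" if "e \<in> B" for e
    proof -
      have "\<bar>inner (x - y) (k e - e)\<bar> \<le> norm (x - y) * norm (k e - e)"
        by (rule Cauchy_Schwarz_ineq2)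
      also have "\<dots> \<le> (2 * r) * (\<eta> / (2 * r))"
        using r(2)[of x] r(2)[of y] x y k(2)[of e] norm_triangle_ineq4[of x y] r(1) by (intro mult_mono) auto
      also have "\<dots> = \<eta>" using r(1) by simp
      finally show ?thesis using small[OF that] by (simp add: inner_diff_left inner_diff_right)
    qed
    then have "(\<Sum>e\<in>B. \<bar>inner x e - inner y e\<bar>) \<le> real (card B) * (2 * \<eta>)"
      by (rule sum_bounded_above)
    also have "\<dots> < n * (2 * \<eta>)" using \<eta> by (intro mult_strict_right_mono) (auto simp: n_def)
    also have "\<dots> = \<delta>" using n by (simp add: \<eta>_def)
    finally show False using gap[OF x y] by simp
  qed
  then show thesis using B(1) k(1) \<eta> by (intro that[of "k ` B" \<eta>]) auto
qed

section \<open>Finite dimensional laws and their cosine transforms\<close>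

lemma iexp_eq_cos_sin: "iexp s = complex_of_real (cos s) + \<i> * complex_of_real (sin s)"
  by (simp add: cis_conv_exp[symmetric] complex_eq_iff)

text \<open>The weights \<open>1 + cos\<close> are nonnegative, so they define measures, and by this identity the cosine
  transform of a law weighted in this way is again a combination of cosine transforms.\<close>

lemma one_plus_cos_times_cos:
  fixes s a t x b :: real
  shows "(1 + cos (s + a)) * cos (t * x + b)
    = cos (t * x + b) + (1/2) * cos (s + t * x + (a + b)) + (1/2) * cos (s + - t * x + (a - b))"
proof -
  have "cos (s + a) * cos (t * x + b) = (cos ((s + a) - (t * x + b)) + cos ((s + a) + (t * x + b))) / 2"
    by (rule cos_times_cos)
  moreover have "(s + a) - (t * x + b) = s + - t * x + (a - b)" "(s + a) + (t * x + b) = s + t * x + (a + b)"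
    by simp_all
  ultimately show ?thesis by (simp add: field_simps)
qed

text \<open>A real form of the uniqueness theorem for characteristic functions: the phase \<open>a\<close> provides both the
  real part (\<open>a = 0\<close>) and the imaginary part (\<open>a = -\<pi>/2\<close>). Finite measures are normalised first.\<close>

lemma finite_measure_eq_of_cos_transforms:
  fixes P Q :: "real measure"
  assumes fin: "finite_measure P" "finite_measure Q"
    and sets: "sets P = sets borel" "sets Q = sets borel"
    and eq: "\<And>t a. (\<integral>x. cos (t * x + a) \<partial>P) = (\<integral>x. cos (t * x + a) \<partial>Q)"
  shows "P = Q"
proof -
  interpret P: finite_measure P by fact
  interpret Q: finite_measure Q by fact
  note [measurable_cong] = sets
  have sp: "space P = UNIV" "space Q = UNIV"
    using sets by (auto dest: sets_eq_imp_space_eq)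
  define m where "m = measure P UNIV"
  have m: "measure Q UNIV = m"
    using eq[of 0 0] sp by (simp add: m_def)
  have iexp_split: "(CLINT x|\<mu>. iexp (t * x)) =
      complex_of_real (\<integral>x. cos (t * x + 0) \<partial>\<mu>) + \<i> * complex_of_real (\<integral>x. cos (t * x + - (pi / 2)) \<partial>\<mu>)"
    if \<mu>: "finite_measure \<mu>" "sets \<mu> = sets borel" for \<mu> t
  proof -
    interpret finite_measure \<mu> by fact
    note [measurable_cong] = \<mu>(2)
    have int: "integrable \<mu> (\<lambda>x. cos (t * x))" "integrable \<mu> (\<lambda>x. sin (t * x))"
      by (intro integrable_const_bound[of _ 1]; simp)+
    have shift: "cos (t * x + - (pi / 2)) = sin (t * x)" for x
      by (simp add: cos_diff flip: diff_conv_add_uminus)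
    have "(CLINT x|\<mu>. iexp (t * x))
        = (CLINT x|\<mu>. complex_of_real (cos (t * x)) + \<i> * complex_of_real (sin (t * x)))"
      unfolding iexp_eq_cos_sin ..
    also have "\<dots> = complex_of_real (\<integral>x. cos (t * x) \<partial>\<mu>) + \<i> * complex_of_real (\<integral>x. sin (t * x) \<partial>\<mu>)"
      using int by simp
    finally show ?thesis unfolding shift by simp
  qed
  show ?thesis
  proof (cases "m = 0")
    case True
    have "emeasure P A = 0" "emeasure Q A = 0" for A
    proof -
      have "emeasure P A \<le> emeasure P UNIV" "emeasure Q A \<le> emeasure Q UNIV"
        using emeasure_space[of P A] emeasure_space[of Q A] sp by auto
      then show "emeasure P A = 0" "emeasure Q A = 0"
        using True m
        by (auto simp: m_def P.emeasure_eq_measure Q.emeasure_eq_measure intro: antisym)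
    qed
    then show ?thesis using sets by (intro measure_eqI) auto
  next
    case False
    then have mpos: "0 < m" by (simp add: m_def zero_less_measure_iff)
    define P' where "P' = density P (\<lambda>_. ennreal (1 / m))"
    define Q' where "Q' = density Q (\<lambda>_. ennreal (1 / m))"
    have real_dist: "real_distribution (density \<mu> (\<lambda>_. ennreal (1 / m)))"
      if "finite_measure \<mu>" "sets \<mu> = sets borel" "measure \<mu> UNIV = m" for \<mu>
    proof -
      interpret finite_measure \<mu> by fact
      have "space \<mu> = UNIV" using that(2) by (auto dest: sets_eq_imp_space_eq)
      then show ?thesis
        using mpos that(2,3)
        by (intro real_distribution.intro real_distribution_axioms.intro prob_spaceI)
          (auto simp: emeasure_density emeasure_eq_measure ennreal_mult[symmetric] nn_integral_cmult)
    qed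
    have char_eq: "char (density \<mu> (\<lambda>_. ennreal (1 / m))) t = (1 / m) * (CLINT x|\<mu>. iexp (t * x))"
      if "sets \<mu> = sets borel" for \<mu> t
    proof -
      note [measurable_cong] = that
      have "char (density \<mu> (\<lambda>_. ennreal (1 / m))) t = (CLINT x|\<mu>. (1 / m) *\<^sub>R iexp (t * x))"
        unfolding char_def using mpos by (subst integral_density) auto
      also have "\<dots> = (1 / m) *\<^sub>R (CLINT x|\<mu>. iexp (t * x))"
        by (rule integral_scaleR_right)
      finally show ?thesis by (simp add: scaleR_conv_of_real)
    qed
    have "P' = Q'"
    proof (rule Levy_uniqueness)
      show "real_distribution P'" "real_distribution Q'"
        unfolding P'_def Q'_def using real_dist fin sets m by (auto simp: m_def)
      show "char P' = char Q'"
      proof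
        fix t
        show "char P' t = char Q' t"
          unfolding P'_def Q'_def char_eq[OF sets(1)] char_eq[OF sets(2)]
            iexp_split[OF fin(1) sets(1)] iexp_split[OF fin(2) sets(2)] eq ..
      qed
    qed
    have rescale: "emeasure \<mu> A = ennreal m * emeasure (density \<mu> (\<lambda>_. ennreal (1 / m))) A"
      if "sets \<mu> = sets borel" "A \<in> sets borel" for \<mu> A
    proof -
      have "emeasure (density \<mu> (\<lambda>_. ennreal (1 / m))) A = ennreal (1 / m) * emeasure \<mu> A"
        using that by (simp add: emeasure_density nn_integral_cmult)
      moreover have "ennreal m * ennreal (1 / m) = 1"
        using mpos by (simp add: ennreal_mult[symmetric])
      ultimately show ?thesis by (simp add: mult.assoc[symmetric])
    qed
    show ?thesis
    proof (rule measure_eqI)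
      show "sets P = sets Q" using sets by simp
      fix A assume "A \<in> sets P"
      then show "emeasure P A = emeasure Q A"
        using rescale[OF sets(1)] rescale[OF sets(2)] sets \<open>P' = Q'\<close> by (simp add: P'_def Q'_def)
    qed
  qed
qed

text \<open>The weights turn the two measures into finite measures under which \<open>X\<close> and \<open>Y\<close> have the same law.\<close>

lemma weighted_integral_eq:
  fixes w X :: "'a \<Rightarrow> real" and v Y :: "'b \<Rightarrow> real" and g :: "real \<Rightarrow> real"
  assumes w: "integrable M w" "\<And>x. 0 \<le> w x" and v: "integrable N v" "\<And>x. 0 \<le> v x"
    and X[measurable]: "X \<in> borel_measurable M" and Y[measurable]: "Y \<in> borel_measurable N"
    and eq: "\<And>t a. (\<integral>\<omega>. w \<omega> * cos (t * X \<omega> + a) \<partial>M) = (\<integral>\<omega>. v \<omega> * cos (t * Y \<omega> + a) \<partial>N)"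
    and g[measurable]: "g \<in> borel_measurable borel"
  shows "(\<integral>\<omega>. w \<omega> * g (X \<omega>) \<partial>M) = (\<integral>\<omega>. v \<omega> * g (Y \<omega>) \<partial>N)"
proof -
  have [measurable]: "w \<in> borel_measurable M" "v \<in> borel_measurable N"
    using w(1) v(1) by auto
  have conv: "(\<integral>x. f x \<partial>distr (density \<mu> (\<lambda>\<omega>. ennreal (u \<omega>))) borel Z) = (\<integral>\<omega>. u \<omega> * f (Z \<omega>) \<partial>\<mu>)"
    if [measurable]: "u \<in> borel_measurable \<mu>" "Z \<in> borel_measurable \<mu>" "f \<in> borel_measurable borel"
      and "\<And>x. 0 \<le> u x" for \<mu> :: "'c measure" and u Z and f :: "real \<Rightarrow> real"
    using that(4) by (simp add: integral_distr integral_density)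
  have fin: "finite_measure (distr (density \<mu> (\<lambda>\<omega>. ennreal (u \<omega>))) borel Z)"
    if "integrable \<mu> u" "Z \<in> borel_measurable \<mu>" "\<And>x. 0 \<le> u x"
    for \<mu> :: "'c measure" and u and Z :: "'c \<Rightarrow> real"
  proof -
    have "finite_measure (density \<mu> (\<lambda>\<omega>. ennreal (u \<omega>)))"
      using that by (intro finite_measureI)
        (simp add: emeasure_density nn_integral_eq_integral cong: nn_integral_cong)
    then show ?thesis using that by (intro finite_measure.finite_measure_distr) auto
  qed
  have "distr (density M (\<lambda>\<omega>. ennreal (w \<omega>))) borel X = distr (density N (\<lambda>\<omega>. ennreal (v \<omega>))) borel Y"
    by (rule finite_measure_eq_of_cos_transforms)
      (use w v eq in \<open>auto simp: fin conv\<close>)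
  then show ?thesis
    using conv[of w M X g] conv[of v N Y g] w v by simp
qed

text \<open>Multidimensional uniqueness reduced to dimension one, by induction on the number of coordinates.
  Weighting with \<open>1 + cos(S + a)\<close>, where \<open>S\<close> is a linear combination of the other coordinates, shows
  that the restrictions of the two measures to \<open>X\<^sub>k \<in> B\<^sub>k\<close> and \<open>Y\<^sub>k \<in> B\<^sub>k\<close> have equal
  transforms in the remaining coordinates, so the induction hypothesis applies to them.\<close>

lemma measure_boxes_eq_of_cos_transforms:
  fixes X :: "'i \<Rightarrow> 'a \<Rightarrow> real" and Y :: "'i \<Rightarrow> 'b \<Rightarrow> real"
  assumes "finite I" and "finite_measure M" "finite_measure N"
    and "\<And>i. i \<in> I \<Longrightarrow> X i \<in> borel_measurable M" "\<And>i. i \<in> I \<Longrightarrow> Y i \<in> borel_measurable N"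
    and "\<And>c a. (\<integral>\<omega>. cos ((\<Sum>i\<in>I. c i * X i \<omega>) + a) \<partial>M) = (\<integral>\<omega>. cos ((\<Sum>i\<in>I. c i * Y i \<omega>) + a) \<partial>N)"
    and "\<And>i. i \<in> I \<Longrightarrow> B i \<in> sets borel"
  shows "measure M {\<omega>\<in>space M. \<forall>i\<in>I. X i \<omega> \<in> B i} = measure N {\<omega>\<in>space N. \<forall>i\<in>I. Y i \<omega> \<in> B i}"
  using assms
proof (induction I arbitrary: M N rule: finite_induct)
  case empty
  show ?case using empty.prems(5)[of "\<lambda>_. 0" 0] by simp
next
  case (insert k I)
  interpret M: finite_measure M by fact
  interpret N: finite_measure N by fact
  note X = insert.prems(3) and Y = insert.prems(4)
  have [measurable]: "X k \<in> borel_measurable M" "Y k \<in> borel_measurable N" "B k \<in> sets borel"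
    using X Y insert.prems(6) by auto
  define S where "S c \<omega> = (\<Sum>i\<in>I. c i * X i \<omega>)" for c \<omega>
  define T where "T c \<omega> = (\<Sum>i\<in>I. c i * Y i \<omega>)" for c \<omega>
  have [measurable]: "S c \<in> borel_measurable M" "T c \<in> borel_measurable N" for c
    unfolding S_def T_def using X Y by (auto intro!: borel_measurable_sum)
  have eq: "(\<integral>\<omega>. cos (S c \<omega> + t * X k \<omega> + a) \<partial>M) = (\<integral>\<omega>. cos (T c \<omega> + t * Y k \<omega> + a) \<partial>N)" for c t a
  proof -
    have "(\<Sum>i\<in>I. (c(k := t)) i * Z i) = (\<Sum>i\<in>I. c i * Z i)" for Z :: "'i \<Rightarrow> real"
      using insert.hyps by (intro sum.cong) auto
    then show ?thesis
      using insert.prems(5)[of "c(k := t)" a] insert.hyps by (simp add: S_def T_def add_ac)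
  qed
  have weight: "(\<integral>\<omega>. (1 + cos (S c \<omega> + a)) * cos (t * X k \<omega> + b) \<partial>M)
      = (\<integral>\<omega>. (1 + cos (T c \<omega> + a)) * cos (t * Y k \<omega> + b) \<partial>N)" for c a t b
  proof -
    have iM: "integrable M (\<lambda>\<omega>. cos (f \<omega>))" if "f \<in> borel_measurable M" for f :: "'a \<Rightarrow> real"
      using that by (intro M.integrable_const_bound[of _ 1]) auto
    have iN: "integrable N (\<lambda>\<omega>. cos (f \<omega>))" if "f \<in> borel_measurable N" for f :: "'b \<Rightarrow> real"
      using that by (intro N.integrable_const_bound[of _ 1]) auto
    have "S (\<lambda>_. 0) \<omega> = 0" "T (\<lambda>_. 0) \<omega>' = 0" for \<omega> \<omega>' by (auto simp: S_def T_def)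
    then show ?thesis
      unfolding one_plus_cos_times_cos using eq[of "\<lambda>_. 0" t b] eq[of c t "a + b"] eq[of c "- t" "a - b"]
      by (simp add: iM iN del: mult_minus_left)
  qed
  have ind: "(\<integral>\<omega>. (1 + cos (S c \<omega> + a)) * indicator (B k) (X k \<omega>) \<partial>M)
      = (\<integral>\<omega>. (1 + cos (T c \<omega> + a)) * indicator (B k) (Y k \<omega>) \<partial>N)" for c a
  proof (rule weighted_integral_eq[OF _ _ _ _ _ _ weight])
    show "integrable M (\<lambda>\<omega>. 1 + cos (S c \<omega> + a))" "integrable N (\<lambda>\<omega>. 1 + cos (T c \<omega> + a))"
      by (intro Bochner_Integration.integrable_add M.integrable_const N.integrable_const
          M.integrable_const_bound[of _ 1] N.integrable_const_bound[of _ 1]; simp)+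
    have "0 \<le> 1 + cos x" for x :: real using cos_ge_minus_one[of x] by linarith
    then show "0 \<le> 1 + cos (S c x + a)" "0 \<le> 1 + cos (T c y + a)" for x y by blast+
  qed auto
  let ?A = "{\<omega>\<in>space M. X k \<omega> \<in> B k}" and ?A' = "{\<omega>\<in>space N. Y k \<omega> \<in> B k}"
  let ?M = "density M (indicator ?A)" and ?N = "density N (indicator ?A')"
  have [measurable]: "?A \<in> sets M" "?A' \<in> sets N" by measurable
  have fin: "finite_measure ?M" "finite_measure ?N"
    by (auto intro!: finite_measureI simp: emeasure_restricted)
  have dM: "(\<integral>\<omega>. f \<omega> \<partial>?M) = (\<integral>\<omega>. f \<omega> * indicator (B k) (X k \<omega>) \<partial>M)" if "f \<in> borel_measurable M" for f :: "'a \<Rightarrow> real"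
  proof -
    have "?M = density M (\<lambda>\<omega>. ennreal (indicator ?A \<omega>))"
      by (auto intro!: density_cong simp: ennreal_indicator)
    then have "(\<integral>\<omega>. f \<omega> \<partial>?M) = (\<integral>\<omega>. indicator ?A \<omega> * f \<omega> \<partial>M)"
      using that by (simp add: integral_density)
    then show ?thesis by (auto intro!: Bochner_Integration.integral_cong simp: indicator_def)
  qed
  have dN: "(\<integral>\<omega>. f \<omega> \<partial>?N) = (\<integral>\<omega>. f \<omega> * indicator (B k) (Y k \<omega>) \<partial>N)" if "f \<in> borel_measurable N" for f :: "'b \<Rightarrow> real"
  proof -
    have "?N = density N (\<lambda>\<omega>. ennreal (indicator ?A' \<omega>))"
      by (auto intro!: density_cong simp: ennreal_indicator)
    then have "(\<integral>\<omega>. f \<omega> \<partial>?N) = (\<integral>\<omega>. indicator ?A' \<omega> * f \<omega> \<partial>N)"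
      using that by (simp add: integral_density)
    then show ?thesis by (auto intro!: Bochner_Integration.integral_cong simp: indicator_def)
  qed
  have restr: "(\<integral>\<omega>. cos (S c \<omega> + a) \<partial>?M) = (\<integral>\<omega>. cos (T c \<omega> + a) \<partial>?N)" for c a
  proof -
    have iM: "integrable M (\<lambda>\<omega>. f \<omega> * indicator (B k) (X k \<omega>))"
      if "f \<in> borel_measurable M" "\<And>\<omega>. \<bar>f \<omega>\<bar> \<le> 1" for f :: "'a \<Rightarrow> real"
      using that by (intro M.integrable_const_bound[of _ 1]) (auto simp: indicator_def)
    have iN: "integrable N (\<lambda>\<omega>. f \<omega> * indicator (B k) (Y k \<omega>))"
      if "f \<in> borel_measurable N" "\<And>\<omega>. \<bar>f \<omega>\<bar> \<le> 1" for f :: "'b \<Rightarrow> real"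
      using that by (intro N.integrable_const_bound[of _ 1]) (auto simp: indicator_def)
    have one: "(\<integral>\<omega>. (1::real) * indicator (B k) (X k \<omega>) \<partial>M) = (\<integral>\<omega>. (1::real) * indicator (B k) (Y k \<omega>) \<partial>N)"
      using ind[of "\<lambda>_. 0" "pi / 2"] by (simp add: S_def T_def)
    have "(\<integral>\<omega>. cos (S c \<omega> + a) * indicator (B k) (X k \<omega>) \<partial>M) = (\<integral>\<omega>. cos (T c \<omega> + a) * indicator (B k) (Y k \<omega>) \<partial>N)"
      using ind[of c a] one iM[of "\<lambda>_. 1"] iN[of "\<lambda>_. 1"] iM[of "\<lambda>\<omega>. cos (S c \<omega> + a)"] iN[of "\<lambda>\<omega>. cos (T c \<omega> + a)"]
      by (simp add: distrib_right)
    then show ?thesis by (simp add: dM dN)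
  qed
  have IH: "measure ?M {\<omega>\<in>space ?M. \<forall>i\<in>I. X i \<omega> \<in> B i} = measure ?N {\<omega>\<in>space ?N. \<forall>i\<in>I. Y i \<omega> \<in> B i}"
    by (rule insert.IH[OF fin]) (use X Y restr insert.prems(6) in \<open>auto simp: S_def T_def\<close>)
  have meas: "{\<omega>\<in>space M. \<forall>i\<in>I. X i \<omega> \<in> B i} \<in> sets M" "{\<omega>\<in>space N. \<forall>i\<in>I. Y i \<omega> \<in> B i} \<in> sets N"
    using X Y insert.hyps(1) insert.prems(6) by (auto intro!: sets.sets_Collect_finite_All measurable_sets_borel
        measurable_sets_Collect[of "X _" M borel] simp: pred_def)
  have "measure ?M {\<omega>\<in>space M. \<forall>i\<in>I. X i \<omega> \<in> B i} = measure M {\<omega>\<in>space M. \<forall>i\<in>insert k I. X i \<omega> \<in> B i}"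
    using meas(1) by (subst measure_restricted) (auto intro!: arg_cong[where f="measure M"])
  moreover have "measure ?N {\<omega>\<in>space N. \<forall>i\<in>I. Y i \<omega> \<in> B i} = measure N {\<omega>\<in>space N. \<forall>i\<in>insert k I. Y i \<omega> \<in> B i}"
    using meas(2) by (subst measure_restricted) (auto intro!: arg_cong[where f="measure N"])
  ultimately show ?case using IH by simp
qed

section \<open>White noise and the Cameron--Martin formula\<close>

text \<open>Completing the square: \<open>exp(sz)\<close> times the standard normal density is a constant multiple of the
  density translated by \<open>s\<close>.\<close>

lemma std_normal_tilted_cos:
  fixes s c a :: real
  shows "integrable lborel (\<lambda>z. std_normal_density z * (exp (s * z) * cos (c * z + a)))"
    and "(\<integral>z. std_normal_density z * (exp (s * z) * cos (c * z + a)) \<partial>lborel)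
      = exp (s\<^sup>2 / 2) * cos (c * s + a) * exp (- c\<^sup>2 / 2)"
proof -
  have int: "integrable lborel (\<lambda>z. std_normal_density z * f z)"
    if "f \<in> borel_measurable borel" "\<And>z. \<bar>f z\<bar> \<le> 1" for f :: "real \<Rightarrow> real"
    by (rule Bochner_Integration.integrable_bound[OF integrable_normal_density[of 1 0]])
      (use that in \<open>auto simp: abs_mult mult_left_le intro!: mult_left_le\<close>)
  have "(CLINT z|lborel. complex_of_real (std_normal_density z * cos (c * z)) + \<i> * complex_of_real (std_normal_density z * sin (c * z)))
      = (CLINT z|lborel. std_normal_density z *\<^sub>R iexp (c * z))"
    unfolding iexp_eq_cos_sin by (simp add: scaleR_conv_of_real algebra_simps)
  also have "\<dots> = char std_normal_distribution c"
    unfolding char_def by (subst integral_density) auto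
  also have "\<dots> = complex_of_real (exp (- c\<^sup>2 / 2))"
    by (simp add: char_std_normal_distribution)
  also have "(CLINT z|lborel. complex_of_real (std_normal_density z * cos (c * z)) + \<i> * complex_of_real (std_normal_density z * sin (c * z)))
      = complex_of_real (\<integral>z. std_normal_density z * cos (c * z) \<partial>lborel) + \<i> * complex_of_real (\<integral>z. std_normal_density z * sin (c * z) \<partial>lborel)"
    using int[of "\<lambda>z. cos (c * z)"] int[of "\<lambda>z. sin (c * z)"]
    by (subst Bochner_Integration.integral_add) (auto simp del: of_real_mult)
  finally have cs: "(\<integral>z. std_normal_density z * cos (c * z) \<partial>lborel) = exp (- c\<^sup>2 / 2)"
    "(\<integral>z. std_normal_density z * sin (c * z) \<partial>lborel) = 0"
    by (auto simp: complex_eq_iff)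
  define f where "f z = std_normal_density z * cos (c * z + (c * s + a))" for z
  have f_int: "integrable lborel f" unfolding f_def by (rule int) auto
  have f_eq: "f = (\<lambda>z. cos (c * s + a) * (std_normal_density z * cos (c * z))
      - sin (c * s + a) * (std_normal_density z * sin (c * z)))"
    unfolding f_def cos_add[of "c * z" "c * s + a" for z] by (simp add: right_diff_distrib mult_ac)
  have f_val: "integral\<^sup>L lborel f = cos (c * s + a) * exp (- c\<^sup>2 / 2)"
    unfolding f_eq using int[of "\<lambda>z. cos (c * z)"] int[of "\<lambda>z. sin (c * z)"] cs
    by (simp add: Bochner_Integration.integral_diff)
  have shift: "std_normal_density z * (exp (s * z) * cos (c * z + a)) = exp (s\<^sup>2 / 2) * f (- s + 1 * z)" for z
  proof -
    have e1: "std_normal_density z * exp (s * z) = exp (s\<^sup>2 / 2) * std_normal_density (z - s)"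
      by (simp add: std_normal_density_def mult_exp_exp power2_eq_square field_simps)
    have e2: "- s + 1 * z = z - s" "c * (z - s) + (c * s + a) = c * z + a"
      by (simp_all add: algebra_simps)
    show ?thesis unfolding f_def e2 by (simp only: mult.assoc[symmetric] e1)
  qed
  have "integrable lborel (\<lambda>z. f (- s + 1 * z))"
    using lborel_integrable_real_affine[OF f_int, of 1 "- s"] by simp
  then show "integrable lborel (\<lambda>z. std_normal_density z * (exp (s * z) * cos (c * z + a)))"
    unfolding shift by simp
  have "integral\<^sup>L lborel f = (\<integral>z. f (- s + 1 * z) \<partial>lborel)"
    using lborel_integral_real_affine[of 1 f "- s"] by simp
  then show "(\<integral>z. std_normal_density z * (exp (s * z) * cos (c * z + a)) \<partial>lborel)
      = exp (s\<^sup>2 / 2) * cos (c * s + a) * exp (- c\<^sup>2 / 2)"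
    unfolding shift using f_val by simp
qed

text \<open>White noise indexed by a real inner product space. That the noise is centred Gaussian with covariance
  given by the inner product is expressed by the cosine transform; linearity holds almost surely, with
  an exceptional set that depends on the vectors.\<close>

locale isonormal = prob_space M for M :: "'w measure" +
  fixes W :: "'a::real_inner \<Rightarrow> 'w \<Rightarrow> real"
  assumes measurable_W[measurable]: "W x \<in> borel_measurable M"
    and cos_W: "(\<integral>\<omega>. cos (W x \<omega> + a) \<partial>M) = cos a * exp (- (norm x)\<^sup>2 / 2)"
    and linear_W: "AE \<omega> in M. W (b *\<^sub>R x + c *\<^sub>R y) \<omega> = b * W x \<omega> + c * W y \<omega>"
begin

lemma W_scale: "AE \<omega> in M. W (t *\<^sub>R x) \<omega> = t * W x \<omega>"
  using linear_W[of t x 0 0] by simp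

lemma W_sum:
  assumes "finite I"
  shows "AE \<omega> in M. W (\<Sum>i\<in>I. c i *\<^sub>R u i) \<omega> = (\<Sum>i\<in>I. c i * W (u i) \<omega>)"
  using assms
proof (induction I rule: finite_induct)
  case empty
  show ?case using W_scale[of 0 0] by simp
next
  case (insert k I)
  have "AE \<omega> in M. W (c k *\<^sub>R u k + 1 *\<^sub>R (\<Sum>i\<in>I. c i *\<^sub>R u i)) \<omega>
      = c k * W (u k) \<omega> + 1 * W (\<Sum>i\<in>I. c i *\<^sub>R u i) \<omega>"
    by (rule linear_W)
  then show ?case
    using insert.IH by eventually_elim (use insert.hyps in simp)
qed

lemma cos_W_scaled: "(\<integral>\<omega>. cos (t * W x \<omega> + a) \<partial>M) = cos a * exp (- (t * norm x)\<^sup>2 / 2)"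
proof -
  have "(\<integral>\<omega>. cos (t * W x \<omega> + a) \<partial>M) = (\<integral>\<omega>. cos (W (t *\<^sub>R x) \<omega> + a) \<partial>M)"
  proof (rule integral_cong_AE)
    show "AE \<omega> in M. cos (t * W x \<omega> + a) = cos (W (t *\<^sub>R x) \<omega> + a)"
      using W_scale[of t x] by eventually_elim simp
  qed auto
  then show ?thesis by (simp add: cos_W power_mult_distrib)
qed

lemma distr_W_unit:
  assumes "norm x = 1"
  shows "distr M borel (W x) = std_normal_distribution"
proof (rule finite_measure_eq_of_cos_transforms)
  show "finite_measure (distr M borel (W x))" by (intro finite_measure_distr) simp
  show "finite_measure std_normal_distribution"
    using real_dist_normal_dist by (simp add: real_distribution_def prob_space_def)
  fix t a
  have "(\<integral>z. cos (t * z + a) \<partial>std_normal_distribution) = cos a * exp (- t\<^sup>2 / 2)"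
    using std_normal_tilted_cos(2)[of 0 t a] by (simp add: integral_density)
  then show "(\<integral>z. cos (t * z + a) \<partial>distr M borel (W x)) = (\<integral>z. cos (t * z + a) \<partial>std_normal_distribution)"
    by (simp add: integral_distr cos_W_scaled assms)
qed auto

lemma tilted_cos_same:
  shows "integrable M (\<lambda>\<omega>. exp (W x \<omega>) * cos (c * W x \<omega> + a))"
    and "(\<integral>\<omega>. exp (W x \<omega>) * cos (c * W x \<omega> + a) \<partial>M)
      = exp ((norm x)\<^sup>2 / 2) * cos (c * (norm x)\<^sup>2 + a) * exp (- (c * norm x)\<^sup>2 / 2)"
proof -
  define n where "n = norm x"
  let ?f = "\<lambda>z. exp (n * z) * cos ((c * n) * z + a)"
  have "integrable M (\<lambda>\<omega>. exp (W x \<omega>) * cos (c * W x \<omega> + a)) \<and>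
    (\<integral>\<omega>. exp (W x \<omega>) * cos (c * W x \<omega> + a) \<partial>M) = exp (n\<^sup>2 / 2) * cos (c * n\<^sup>2 + a) * exp (- (c * n)\<^sup>2 / 2)"
  proof (cases "n = 0")
    case True
    then have x: "x = 0" by (simp add: n_def)
    have AE0: "AE \<omega> in M. exp (W x \<omega>) * cos (c * W x \<omega> + a) = cos a"
      using W_scale[of 0 0] unfolding x by eventually_elim simp
    have "integrable M (\<lambda>\<omega>. exp (W x \<omega>) * cos (c * W x \<omega> + a)) = integrable M (\<lambda>_. cos a)"
      by (rule integrable_cong_AE[OF _ _ AE0]) auto
    moreover have "(\<integral>\<omega>. exp (W x \<omega>) * cos (c * W x \<omega> + a) \<partial>M) = (\<integral>\<omega>. cos a \<partial>M)"
      by (rule integral_cong_AE[OF _ _ AE0]) auto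
    ultimately show ?thesis using True by (simp add: prob_space)
  next
    case False
    define e where "e = (1 / n) *\<^sub>R x"
    have e: "norm e = 1" "x = n *\<^sub>R e" using False by (auto simp: e_def n_def)
    have AE: "AE \<omega> in M. exp (W x \<omega>) * cos (c * W x \<omega> + a) = ?f (W e \<omega>)"
      using W_scale[of n e] unfolding e(2)[symmetric] by eventually_elim (simp add: mult_ac)
    have int: "integrable (distr M borel (W e)) ?f"
      unfolding distr_W_unit[OF e(1)] using std_normal_tilted_cos(1)[of n "c * n" a]
      by (simp add: integrable_density)
    then have int': "integrable M (\<lambda>\<omega>. ?f (W e \<omega>))"
      by (simp add: integrable_distr_eq)
    have "(\<integral>\<omega>. ?f (W e \<omega>) \<partial>M) = (\<integral>z. ?f z \<partial>distr M borel (W e))"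
      by (simp add: integral_distr)
    also have "\<dots> = exp (n\<^sup>2 / 2) * cos (c * n * n + a) * exp (- (c * n)\<^sup>2 / 2)"
      unfolding distr_W_unit[OF e(1)] using std_normal_tilted_cos(2)[of n "c * n" a]
      by (simp add: integral_density)
    finally have val: "(\<integral>\<omega>. ?f (W e \<omega>) \<partial>M) = exp (n\<^sup>2 / 2) * cos (c * n\<^sup>2 + a) * exp (- (c * n)\<^sup>2 / 2)"
      by (simp add: power2_eq_square mult_ac)
    have "integrable M (\<lambda>\<omega>. exp (W x \<omega>) * cos (c * W x \<omega> + a)) = integrable M (\<lambda>\<omega>. ?f (W e \<omega>))"
      by (rule integrable_cong_AE[OF _ _ AE]) auto
    moreover have "(\<integral>\<omega>. exp (W x \<omega>) * cos (c * W x \<omega> + a) \<partial>M) = (\<integral>\<omega>. ?f (W e \<omega>) \<partial>M)"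
      by (rule integral_cong_AE[OF _ _ AE]) auto
    ultimately show ?thesis using int' val by simp
  qed
  then show "integrable M (\<lambda>\<omega>. exp (W x \<omega>) * cos (c * W x \<omega> + a))"
    and "(\<integral>\<omega>. exp (W x \<omega>) * cos (c * W x \<omega> + a) \<partial>M)
      = exp ((norm x)\<^sup>2 / 2) * cos (c * (norm x)\<^sup>2 + a) * exp (- (c * norm x)\<^sup>2 / 2)"
    by (auto simp: n_def)
qed

lemma integrable_exp_W: "integrable M (\<lambda>\<omega>. exp (W x \<omega>))"
  using tilted_cos_same(1)[of x 0 0] by simp

lemma integral_exp_W: "(\<integral>\<omega>. exp (W x \<omega>) \<partial>M) = exp ((norm x)\<^sup>2 / 2)"
  using tilted_cos_same(2)[of x 0 0] by simp

text \<open>Independence of \<open>W x\<close> and \<open>W k\<close>, for orthogonal \<open>x\<close> and \<open>k\<close>, in the form in which it will be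
  applied. The joint cosine transform factors by Pythagoras, so \<open>W x\<close> weighted by
  \<open>1 + cos(W k + b)\<close> has the transform of its own law times a constant.\<close>

lemma orthogonal_factorization:
  assumes orth: "inner x k = 0" and g[measurable]: "g \<in> borel_measurable borel"
    and int: "integrable M (\<lambda>\<omega>. g (W x \<omega>))"
  shows "(\<integral>\<omega>. cos (W k \<omega> + b) * g (W x \<omega>) \<partial>M) = cos b * exp (- (norm k)\<^sup>2 / 2) * (\<integral>\<omega>. g (W x \<omega>) \<partial>M)"
proof -
  let ?m = "cos b * exp (- (norm k)\<^sup>2 / 2)"
  have ic: "integrable M (\<lambda>\<omega>. cos (f \<omega>))" if "f \<in> borel_measurable M" for f :: "'w \<Rightarrow> real"
    using that by (intro integrable_const_bound[of _ 1]) auto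
  have pyth: "(norm (k + t *\<^sub>R x))\<^sup>2 = (norm k)\<^sup>2 + (t * norm x)\<^sup>2" for t
    using norm_add_Pythagorean[of k "t *\<^sub>R x"] orth
    by (simp add: orthogonal_def inner_commute[of k x] power_mult_distrib)
  have joint: "(\<integral>\<omega>. cos (W k \<omega> + t * W x \<omega> + a) \<partial>M) = cos a * exp (- (norm k)\<^sup>2 / 2) * exp (- (t * norm x)\<^sup>2 / 2)" for t a
  proof -
    have "(\<integral>\<omega>. cos (W k \<omega> + t * W x \<omega> + a) \<partial>M) = (\<integral>\<omega>. cos (W (k + t *\<^sub>R x) \<omega> + a) \<partial>M)"
    proof (rule integral_cong_AE)
      show "AE \<omega> in M. cos (W k \<omega> + t * W x \<omega> + a) = cos (W (k + t *\<^sub>R x) \<omega> + a)"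
        using linear_W[of 1 k t x] by eventually_elim simp
    qed auto
    then show ?thesis by (simp add: cos_W pyth exp_add[symmetric] add_divide_distrib diff_divide_distrib)
  qed
  have weight: "(\<integral>\<omega>. (1 + cos (W k \<omega> + b)) * cos (t * W x \<omega> + a) \<partial>M) = (\<integral>\<omega>. (1 + ?m) * cos (t * W x \<omega> + a) \<partial>M)" for t a
  proof -
    have "(\<integral>\<omega>. (1 + cos (W k \<omega> + b)) * cos (t * W x \<omega> + a) \<partial>M)
       = (\<integral>\<omega>. cos (t * W x \<omega> + a) \<partial>M) + (1/2) * (\<integral>\<omega>. cos (W k \<omega> + t * W x \<omega> + (b + a)) \<partial>M)
         + (1/2) * (\<integral>\<omega>. cos (W k \<omega> + - t * W x \<omega> + (b - a)) \<partial>M)"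
      unfolding one_plus_cos_times_cos by (simp add: ic del: mult_minus_left)
    also have "\<dots> = cos a * exp (- (t * norm x)\<^sup>2 / 2) + ((cos (b + a) + cos (b - a)) / 2) * exp (- (norm k)\<^sup>2 / 2) * exp (- (t * norm x)\<^sup>2 / 2)"
      unfolding joint cos_W_scaled by (simp add: field_simps)
    also have "(cos (b + a) + cos (b - a)) / 2 = cos b * cos a"
      by (simp add: cos_add cos_diff)
    finally have lhs: "(\<integral>\<omega>. (1 + cos (W k \<omega> + b)) * cos (t * W x \<omega> + a) \<partial>M)
        = (1 + ?m) * (cos a * exp (- (t * norm x)\<^sup>2 / 2))"
      by (simp add: algebra_simps)
    show ?thesis
      unfolding lhs cos_W_scaled[symmetric] by (rule integral_mult_right_zero[symmetric])
  qed
  have ge: "0 \<le> 1 + cos y" for y :: real using cos_ge_minus_one[of y] by linarith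
  have "0 \<le> 1 + ?m"
  proof -
    have "\<bar>?m\<bar> \<le> 1" unfolding abs_mult by (intro mult_le_one) auto
    then show ?thesis by simp
  qed
  then have eq: "(\<integral>\<omega>. (1 + cos (W k \<omega> + b)) * g (W x \<omega>) \<partial>M) = (\<integral>\<omega>. (1 + ?m) * g (W x \<omega>) \<partial>M)"
    by (intro weighted_integral_eq[OF _ _ _ _ _ _ weight g]) (simp_all add: ic ge)
  have int2: "integrable M (\<lambda>\<omega>. cos (W k \<omega> + b) * g (W x \<omega>))"
    by (rule Bochner_Integration.integrable_bound[OF int]) (auto simp: abs_mult mult_left_le_one_le)
  show ?thesis using eq int int2 by (simp add: distrib_right)
qed

text \<open>The Cameron--Martin theorem for one cosine: multiplying by \<open>exp(W x)\<close> shifts \<open>W g\<close> by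
  \<open>inner x g\<close>. Split \<open>g\<close> into its component along \<open>x\<close>, where the one-dimensional computation
  applies, and an orthogonal part, which factors out.\<close>

lemma tilted_cos:
  "(\<integral>\<omega>. exp (W x \<omega>) * cos (W g \<omega> + a) \<partial>M) = exp ((norm x)\<^sup>2 / 2) * cos (inner x g + a) * exp (- (norm g)\<^sup>2 / 2)"
proof -
  define c where "c = inner x g / (norm x)\<^sup>2"
  define k where "k = g - c *\<^sub>R x"
  have c: "c * (norm x)\<^sup>2 = inner x g" by (cases "x = 0") (auto simp: c_def)
  have orth: "inner x k = 0"
    using c by (simp add: k_def inner_diff_right power2_norm_eq_inner)
  have pyth: "(norm g)\<^sup>2 = (norm k)\<^sup>2 + (c * norm x)\<^sup>2"
  proof -
    have "g = k + c *\<^sub>R x" by (simp add: k_def)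
    then show ?thesis
      using norm_add_Pythagorean[of k "c *\<^sub>R x"] orth
      by (simp add: orthogonal_def inner_commute[of k x] power_mult_distrib)
  qed
  \<comment> \<open>The addition theorem for the cosine, with the sine written as a shifted cosine so that the factorization applies.\<close>
  let ?C = "\<lambda>z. exp z * cos (c * z + a)" and ?D = "\<lambda>z. exp z * cos (c * z + (a - pi / 2))"
  have expand: "exp z * cos (u + c * z + a) = cos (u + 0) * ?C z + cos (u + pi / 2) * ?D z" for u z
  proof -
    have "cos (c * z + (a - pi / 2)) = sin (c * z + a)"
      using cos_diff[of "c * z + a" "pi / 2"] by (simp add: add_diff_eq)
    moreover have "cos (u + pi / 2) = - sin u" by (simp add: cos_add)
    moreover have "cos (u + c * z + a) = cos u * cos (c * z + a) - sin u * sin (c * z + a)"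
      using cos_add[of u "c * z + a"] by (simp add: add.assoc)
    ultimately show ?thesis by (simp add: right_diff_distrib)
  qed
  have int: "integrable M (\<lambda>\<omega>. ?C (W x \<omega>))" "integrable M (\<lambda>\<omega>. ?D (W x \<omega>))"
    by (rule tilted_cos_same(1))+
  have int': "integrable M (\<lambda>\<omega>. cos (W k \<omega> + b) * f \<omega>)" if "integrable M f" for f b
    by (rule Bochner_Integration.integrable_bound[OF that]) (use that in \<open>auto simp: abs_mult mult_left_le_one_le\<close>)
  have "(\<integral>\<omega>. exp (W x \<omega>) * cos (W g \<omega> + a) \<partial>M)
      = (\<integral>\<omega>. cos (W k \<omega> + 0) * ?C (W x \<omega>) + cos (W k \<omega> + pi / 2) * ?D (W x \<omega>) \<partial>M)"
  proof (rule integral_cong_AE)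
    have "g = 1 *\<^sub>R k + c *\<^sub>R x" by (simp add: k_def)
    then have "AE \<omega> in M. W g \<omega> = 1 * W k \<omega> + c * W x \<omega>"
      using linear_W[of 1 k c x] by simp
    then show "AE \<omega> in M. exp (W x \<omega>) * cos (W g \<omega> + a)
        = cos (W k \<omega> + 0) * ?C (W x \<omega>) + cos (W k \<omega> + pi / 2) * ?D (W x \<omega>)"
      by eventually_elim (simp only: expand[symmetric] mult_1)
  qed auto
  also have "\<dots> = (\<integral>\<omega>. cos (W k \<omega> + 0) * ?C (W x \<omega>) \<partial>M) + (\<integral>\<omega>. cos (W k \<omega> + pi / 2) * ?D (W x \<omega>) \<partial>M)"
    by (intro Bochner_Integration.integral_add int' int)
  also have "\<dots> = exp (- (norm k)\<^sup>2 / 2) * (\<integral>\<omega>. ?C (W x \<omega>) \<partial>M)"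
    using orthogonal_factorization[OF orth _ int(1), of 0] orthogonal_factorization[OF orth _ int(2), of "pi / 2"]
    by simp
  also have "\<dots> = exp (- (norm k)\<^sup>2 / 2) * (exp ((norm x)\<^sup>2 / 2) * cos (inner x g + a) * exp (- (c * norm x)\<^sup>2 / 2))"
    by (simp add: tilted_cos_same(2) c)
  also have "\<dots> = exp ((norm x)\<^sup>2 / 2) * cos (inner x g + a) * exp (- (norm g)\<^sup>2 / 2)"
    by (simp add: pyth exp_add[symmetric] add_divide_distrib diff_divide_distrib mult_ac)
  finally show ?thesis .
qed

definition likelihood :: "'a \<Rightarrow> 'w \<Rightarrow> real" where
  "likelihood x \<omega> = exp (W x \<omega> - (norm x)\<^sup>2 / 2)"

lemma measurable_likelihood[measurable]: "likelihood x \<in> borel_measurable M"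
  unfolding likelihood_def by measurable

lemma likelihood_pos: "0 < likelihood x \<omega>"
  by (simp add: likelihood_def)

lemma likelihood_eq: "likelihood x \<omega> = exp (- (norm x)\<^sup>2 / 2) * exp (W x \<omega>)"
  by (simp add: likelihood_def mult_exp_exp)

lemma integrable_likelihood: "integrable M (likelihood x)"
  using integrable_exp_W[of x] by (simp add: likelihood_def[abs_def] exp_diff)

lemma finite_measure_likelihood: "finite_measure (density M (\<lambda>\<omega>. ennreal (likelihood x \<omega>)))"
  by (intro finite_measureI)
    (simp add: emeasure_density nn_integral_eq_integral integrable_likelihood likelihood_pos less_imp_le cong: nn_integral_cong)

text \<open>The likelihoods have inner products \<open>exp (x,y)\<close> in \<open>L\<^sup>2\<close>. Hence the inner product of
  \<open>likelihood x\<close> with a linear combination of the \<open>likelihood y\<close> depends only on the finitely many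
  coordinates \<open>inner x y\<close> of the shift.\<close>

lemma likelihood_product:
  shows "integrable M (\<lambda>\<omega>. likelihood x \<omega> * likelihood y \<omega>)" "(\<integral>\<omega>. likelihood x \<omega> * likelihood y \<omega> \<partial>M) = exp (inner x y)"
proof -
  let ?k = "exp (- ((norm x)\<^sup>2 + (norm y)\<^sup>2) / 2)"
  have AE: "AE \<omega> in M. likelihood x \<omega> * likelihood y \<omega> = ?k * exp (W (x + y) \<omega>)"
    using linear_W[of 1 x 1 y]
    by eventually_elim (simp add: likelihood_def exp_add[symmetric] field_simps)
  have "integrable M (\<lambda>\<omega>. likelihood x \<omega> * likelihood y \<omega>) = integrable M (\<lambda>\<omega>. ?k * exp (W (x + y) \<omega>))"
    by (rule integrable_cong_AE[OF _ _ AE]) auto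
  then show "integrable M (\<lambda>\<omega>. likelihood x \<omega> * likelihood y \<omega>)" using integrable_exp_W[of "x + y"] by simp
  have "(\<integral>\<omega>. likelihood x \<omega> * likelihood y \<omega> \<partial>M) = (\<integral>\<omega>. ?k * exp (W (x + y) \<omega>) \<partial>M)"
    by (rule integral_cong_AE[OF _ _ AE]) auto
  also have "\<dots> = ?k * exp ((norm (x + y))\<^sup>2 / 2)" by (simp add: integral_exp_W)
  also have "\<dots> = exp (inner x y)"
    by (simp add: exp_add[symmetric] power2_norm_eq_inner inner_add_left inner_add_right
        inner_commute[of y x] field_simps)
  finally show "(\<integral>\<omega>. likelihood x \<omega> * likelihood y \<omega> \<partial>M) = exp (inner x y)" .
qed

text \<open>Under the density \<open>likelihood x\<close> the noise is distributed like the noise shifted by \<open>x\<close>. It suffices to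
  compare the cosine transforms of linear combinations, which are single variables \<open>W g\<close>.\<close>

lemma cameron_martin_boxes:
  assumes I: "finite I" and B: "\<And>i. i \<in> I \<Longrightarrow> B i \<in> sets borel"
  shows "measure (density M (\<lambda>\<omega>. ennreal (likelihood x \<omega>))) {\<omega>\<in>space M. \<forall>i\<in>I. W (u i) \<omega> \<in> B i}
    = measure M {\<omega>\<in>space M. \<forall>i\<in>I. inner x (u i) + W (u i) \<omega> \<in> B i}"
proof -
  let ?D = "density M (\<lambda>\<omega>. ennreal (likelihood x \<omega>))"
  have "finite_measure ?D"
    by (rule finite_measure_likelihood)
  then have "measure ?D {\<omega>\<in>space ?D. \<forall>i\<in>I. W (u i) \<omega> \<in> B i}
      = measure M {\<omega>\<in>space M. \<forall>i\<in>I. inner x (u i) + W (u i) \<omega> \<in> B i}"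
  proof (rule measure_boxes_eq_of_cos_transforms[OF I])
    fix c :: "_ \<Rightarrow> real" and a
    define g where "g = (\<Sum>i\<in>I. c i *\<^sub>R u i)"
    have AE: "AE \<omega> in M. W g \<omega> = (\<Sum>i\<in>I. c i * W (u i) \<omega>)" unfolding g_def by (rule W_sum[OF I])
    have "(\<integral>\<omega>. cos ((\<Sum>i\<in>I. c i * W (u i) \<omega>) + a) \<partial>?D) = (\<integral>\<omega>. likelihood x \<omega> * cos ((\<Sum>i\<in>I. c i * W (u i) \<omega>) + a) \<partial>M)"
      by (simp add: integral_density likelihood_pos less_imp_le)
    also have "\<dots> = (\<integral>\<omega>. exp (- (norm x)\<^sup>2 / 2) * (exp (W x \<omega>) * cos (W g \<omega> + a)) \<partial>M)"
    proof (rule integral_cong_AE)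
      show "AE \<omega> in M. likelihood x \<omega> * cos ((\<Sum>i\<in>I. c i * W (u i) \<omega>) + a)
          = exp (- (norm x)\<^sup>2 / 2) * (exp (W x \<omega>) * cos (W g \<omega> + a))"
        using AE by eventually_elim (simp add: likelihood_eq)
    qed auto
    also have "\<dots> = exp (- (norm x)\<^sup>2 / 2) * (exp ((norm x)\<^sup>2 / 2) * cos (inner x g + a) * exp (- (norm g)\<^sup>2 / 2))"
      by (simp add: tilted_cos)
    also have "\<dots> = cos (inner x g + a) * exp (- (norm g)\<^sup>2 / 2)"
      by (simp add: exp_minus)
    also have "\<dots> = (\<integral>\<omega>. cos (W g \<omega> + (inner x g + a)) \<partial>M)" by (simp add: cos_W)
    also have "\<dots> = (\<integral>\<omega>. cos ((\<Sum>i\<in>I. c i * (inner x (u i) + W (u i) \<omega>)) + a) \<partial>M)"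
    proof (rule integral_cong_AE)
      have shift: "(\<Sum>i\<in>I. c i * (inner x (u i) + W (u i) \<omega>)) = (\<Sum>i\<in>I. c i * W (u i) \<omega>) + inner x g" for \<omega>
        by (simp add: g_def inner_sum_right distrib_left sum.distrib)
      show "AE \<omega> in M. cos (W g \<omega> + (inner x g + a)) = cos ((\<Sum>i\<in>I. c i * (inner x (u i) + W (u i) \<omega>)) + a)"
        using AE by eventually_elim (simp add: shift add_ac)
    qed auto
    finally show "(\<integral>\<omega>. cos ((\<Sum>i\<in>I. c i * W (u i) \<omega>) + a) \<partial>?D)
      = (\<integral>\<omega>. cos ((\<Sum>i\<in>I. c i * (inner x (u i) + W (u i) \<omega>)) + a) \<partial>M)" .
  qed (use B finite_measure_axioms in auto)
  then show ?thesis by simp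
qed

end

lemma centered_normal_facts:
  assumes "prob_space M" and X: "centered_normal M X"
  shows "X \<in> borel_measurable M" "integrable M (\<lambda>\<omega>. (X \<omega>)\<^sup>2)"
    "(\<integral>\<omega>. cos (X \<omega> + a) \<partial>M) = cos a * exp (- (\<integral>\<omega>. (X \<omega>)\<^sup>2 \<partial>M) / 2)"
proof -
  interpret prob_space M by fact
  show [measurable]: "X \<in> borel_measurable M" using X by (simp add: centered_normal_def)
  have "integrable M (\<lambda>\<omega>. (X \<omega>)\<^sup>2) \<and>
    (\<integral>\<omega>. cos (X \<omega> + a) \<partial>M) = cos a * exp (- (\<integral>\<omega>. (X \<omega>)\<^sup>2 \<partial>M) / 2)"
  proof (cases "AE \<omega> in M. X \<omega> = 0")
    case True
    have "integrable M (\<lambda>\<omega>. (X \<omega>)\<^sup>2) = integrable M (\<lambda>\<omega>. 0::real)"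
      by (rule integrable_cong_AE) (use True in auto)
    moreover have "(\<integral>\<omega>. (X \<omega>)\<^sup>2 \<partial>M) = (\<integral>\<omega>. 0 \<partial>M)"
      by (rule integral_cong_AE) (use True in auto)
    moreover have "(\<integral>\<omega>. cos (X \<omega> + a) \<partial>M) = (\<integral>\<omega>. cos a \<partial>M)"
      by (rule integral_cong_AE) (use True in auto)
    ultimately show ?thesis by (simp add: prob_space)
  next
    case False
    then obtain \<sigma> where \<sigma>: "0 < \<sigma>" and D: "distributed M lborel X (normal_density 0 \<sigma>)"
      using X by (auto simp: centered_normal_def)
    have var: "(\<integral>\<omega>. (X \<omega>)\<^sup>2 \<partial>M) = \<sigma>\<^sup>2"
      using normal_distributed_variance[OF \<sigma> D] normal_distributed_expectation[OF \<sigma> D] by simp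
    then have int: "integrable M (\<lambda>\<omega>. (X \<omega>)\<^sup>2)"
      using \<sigma> not_integrable_integral_eq[of M "\<lambda>\<omega>. (X \<omega>)\<^sup>2"] by fastforce
    have "distributed M lborel (\<lambda>\<omega>. (X \<omega> - 0) / \<sigma>) std_normal_density"
      using normal_standard_normal_convert[OF \<sigma>, of X 0] D by simp
    then have Z: "distributed M lborel (\<lambda>\<omega>. X \<omega> / \<sigma>) std_normal_density" by simp
    have cos_X: "(\<integral>\<omega>. cos (X \<omega> + a) \<partial>M) = cos a * exp (- \<sigma>\<^sup>2 / 2)"
    proof -
      have "(\<integral>\<omega>. cos (X \<omega> + a) \<partial>M) = (\<integral>\<omega>. cos (\<sigma> * (X \<omega> / \<sigma>) + a) \<partial>M)"
        using \<sigma> by simp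
      also have "\<dots> = (\<integral>z. std_normal_density z * cos (\<sigma> * z + a) \<partial>lborel)"
        using distributed_integral[OF Z, of "\<lambda>z. cos (\<sigma> * z + a)"] by simp
      also have "\<dots> = cos a * exp (- \<sigma>\<^sup>2 / 2)"
        using std_normal_tilted_cos(2)[of 0 \<sigma> a] by simp
      finally show ?thesis .
    qed
    then show ?thesis using int var by simp
  qed
  then show "integrable M (\<lambda>\<omega>. (X \<omega>)\<^sup>2)"
    "(\<integral>\<omega>. cos (X \<omega> + a) \<partial>M) = cos a * exp (- (\<integral>\<omega>. (X \<omega>)\<^sup>2 \<partial>M) / 2)" by auto
qed

text \<open>The law of \<open>Z\<close> has the transform of the point mass at 0.\<close>

lemma AE_zero_of_cos_transform_one:
  assumes "prob_space M" and [measurable]: "Z \<in> borel_measurable M"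
    and cos: "\<And>t a. (\<integral>\<omega>. cos (t * Z \<omega> + a) \<partial>M) = cos a"
  shows "AE \<omega> in M. Z \<omega> = (0::real)"
proof -
  interpret prob_space M by fact
  have eq: "distr M borel Z = return borel 0"
  proof (rule finite_measure_eq_of_cos_transforms)
    show "finite_measure (distr M borel Z)" by (intro finite_measure_distr) simp
    show "finite_measure (return borel (0::real))"
      using prob_space_return[of "0::real" borel] by (simp add: prob_space_def)
  qed (simp_all add: integral_distr integral_return cos)
  have "emeasure M {\<omega>\<in>space M. Z \<omega> \<noteq> 0} = emeasure (distr M borel Z) (- {0})"
    by (subst emeasure_distr) (auto intro!: arg_cong[where f = "emeasure M"])
  also have "\<dots> = 0" unfolding eq by simp
  finally show ?thesis by (subst AE_iff_measurable[OF _ refl]) auto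
qed

lemma AE_convergent_of_summable_increments:
  fixes X :: "nat \<Rightarrow> 'w \<Rightarrow> real"
  assumes [measurable]: "\<And>n. X n \<in> borel_measurable M"
    and b: "\<And>n. (\<integral>\<^sup>+\<omega>. ennreal \<bar>X (Suc n) \<omega> - X n \<omega>\<bar> \<partial>M) \<le> ennreal (b n)"
    and sb: "summable b" "\<And>n. 0 \<le> b n"
  shows "AE \<omega> in M. convergent (\<lambda>n. X n \<omega>)"
proof -
  have "(\<integral>\<^sup>+\<omega>. (\<Sum>n. ennreal \<bar>X (Suc n) \<omega> - X n \<omega>\<bar>) \<partial>M)
      = (\<Sum>n. \<integral>\<^sup>+\<omega>. ennreal \<bar>X (Suc n) \<omega> - X n \<omega>\<bar> \<partial>M)"
    by (rule nn_integral_suminf) simp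
  also have "\<dots> \<le> (\<Sum>n. ennreal (b n))" by (intro suminf_le b) auto
  also have "\<dots> = ennreal (\<Sum>n. b n)" using sb by (intro suminf_ennreal2) auto
  finally have "(\<integral>\<^sup>+\<omega>. (\<Sum>n. ennreal \<bar>X (Suc n) \<omega> - X n \<omega>\<bar>) \<partial>M) \<noteq> \<infinity>"
    by (auto simp: top_unique)
  then have "AE \<omega> in M. (\<Sum>n. ennreal \<bar>X (Suc n) \<omega> - X n \<omega>\<bar>) \<noteq> \<infinity>"
    by (intro nn_integral_noteq_infinite) auto
  then show ?thesis
  proof eventually_elim
    case (elim \<omega>)
    then have "summable (\<lambda>n. \<bar>X (Suc n) \<omega> - X n \<omega>\<bar>)"
      by (intro summable_suminf_not_top) auto
    then have "summable (\<lambda>n. X (Suc n) \<omega> - X n \<omega>)" by (rule summable_rabs_cancel)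
    then have "convergent (\<lambda>n. (\<Sum>i<n. X (Suc i) \<omega> - X i \<omega>))"
      by (simp add: summable_iff_convergent)
    then have "convergent (\<lambda>n. X n \<omega> - X 0 \<omega>)"
      by (simp only: sum_lessThan_telescope[of "\<lambda>i. X i \<omega>"])
    then have "convergent (\<lambda>n. (X n \<omega> - X 0 \<omega>) + X 0 \<omega>)"
      by (intro convergent_add) (auto intro: convergent_const)
    then show ?case by simp
  qed
qed

text \<open>On the range of \<open>S\<close> put \<open>W(Sh) = \<xi>(h)\<close>; there the covariance is \<open>(Rh,h') = (Sh,Sh')\<close>. Elsewhere
  take limits along \<open>Sh\<^sub>n \<rightarrow> x\<close>. The approximation is chosen so fast that the increments
  \<open>\<xi>(h\<^sub>n\<^sub>+\<^sub>1) - \<xi>(h\<^sub>n)\<close> are summable in \<open>L\<^sup>1\<close>, so the limit exists almost surely, and cosine transforms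
  pass to the limit by dominated convergence.\<close>

lemma isonormal_of_gaussian_family:
  fixes S R :: "'a::real_inner \<Rightarrow> 'a" and \<xi> :: "'a \<Rightarrow> 'w \<Rightarrow> real"
  assumes G: "gaussian_family M R \<xi>" and S: "nonneg_operator S"
    and SS: "\<And>x. S (S x) = R x" and inj: "inj S" and dense: "closure (range S) = UNIV"
  obtains W where "isonormal M W" "\<And>h. W (S h) = \<xi> h"
proof -
  interpret prob_space M using G by (simp add: gaussian_family_def)
  interpret S: bounded_linear S using S by (simp add: nonneg_operator_def)
  have normal: "centered_normal M (\<xi> h)" for h
  proof -
    have "\<forall>F c. finite F \<longrightarrow> centered_normal M (\<lambda>\<omega>. \<Sum>h\<in>F. c h * \<xi> h \<omega>)"
      using G by (simp add: gaussian_family_def)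
    from this[rule_format, of "{h}" "\<lambda>_. 1"] show ?thesis by simp
  qed
  have meas[measurable]: "\<xi> h \<in> borel_measurable M" for h
    using centered_normal_facts(1)[OF prob_space_axioms normal] .
  have lin: "AE \<omega> in M. \<xi> (a *\<^sub>R h + b *\<^sub>R h') \<omega> = a * \<xi> h \<omega> + b * \<xi> h' \<omega>" for a b h h'
    using G by (simp add: gaussian_family_def)
  have var: "(\<integral>\<omega>. (\<xi> h \<omega>)\<^sup>2 \<partial>M) = (norm (S h))\<^sup>2" for h
  proof -
    have "(\<integral>\<omega>. (\<xi> h \<omega>)\<^sup>2 \<partial>M) = inner (S (S h)) h"
      using G by (simp add: gaussian_family_def power2_eq_square SS)
    also have "\<dots> = inner (S h) (S h)" using S by (simp add: nonneg_operator_def)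
    finally show ?thesis by (simp add: dot_square_norm)
  qed
  have cos_\<xi>: "(\<integral>\<omega>. cos (\<xi> h \<omega> + a) \<partial>M) = cos a * exp (- (norm (S h))\<^sup>2 / 2)" for h a
    using centered_normal_facts(3)[OF prob_space_axioms normal] by (simp add: var)
  have abs_\<xi>: "(\<integral>\<^sup>+\<omega>. ennreal \<bar>\<xi> h \<omega>\<bar> \<partial>M) \<le> ennreal b" if b: "norm (S h) \<le> b" "0 < b" for h b
  proof -
    have int: "integrable M (\<lambda>\<omega>. (\<xi> h \<omega>)\<^sup>2)" by (rule centered_normal_facts(2)[OF prob_space_axioms normal])
    have amgm: "\<bar>x\<bar> \<le> b / 2 + (1 / (2 * b)) * x\<^sup>2" for x
    proof -
      have "0 \<le> (\<bar>x\<bar> - b)\<^sup>2" by simp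
      then show ?thesis using b(2) by (simp add: power2_diff field_simps power2_eq_square)
    qed
    have "(\<integral>\<^sup>+\<omega>. ennreal \<bar>\<xi> h \<omega>\<bar> \<partial>M) \<le> (\<integral>\<^sup>+\<omega>. ennreal (b / 2 + (1 / (2 * b)) * (\<xi> h \<omega>)\<^sup>2) \<partial>M)"
      by (intro nn_integral_mono ennreal_leI amgm)
    also have "\<dots> = ennreal (\<integral>\<omega>. b / 2 + (1 / (2 * b)) * (\<xi> h \<omega>)\<^sup>2 \<partial>M)"
      using int b by (intro nn_integral_eq_integral) auto
    also have "(\<integral>\<omega>. b / 2 + (1 / (2 * b)) * (\<xi> h \<omega>)\<^sup>2 \<partial>M) = b / 2 + (1 / (2 * b)) * (norm (S h))\<^sup>2"
      using int by (simp add: prob_space flip: var)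
    also have "\<dots> \<le> b / 2 + (1 / (2 * b)) * b\<^sup>2"
      using b by (intro add_left_mono mult_left_mono power_mono) auto
    also have "\<dots> = b" using b by (simp add: power2_eq_square)
    finally show ?thesis using b by (simp add: ennreal_leI)
  qed
  \<comment> \<open>On the range of \<open>S\<close> the approximating sequence is constant, so that \<open>W (S h)\<close> and \<open>\<xi> h\<close> agree at every point and not only almost surely.\<close>
  have "\<exists>k. (\<forall>n. norm (S (k n) - x) \<le> (1/2) ^ n) \<and> (\<forall>h. x = S h \<longrightarrow> k = (\<lambda>_. h))" for x
  proof (cases "x \<in> range S")
    case True
    then obtain h where "x = S h" by blast
    then show ?thesis using inj by (intro exI[of _ "\<lambda>_. h"]) (auto dest: injD)
  next
    case False
    have "\<exists>h. norm (S h - x) \<le> (1/2) ^ n" for n :: nat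
    proof -
      have "x \<in> closure (range S)" using dense by simp
      then obtain y where "y \<in> range S" "dist y x < (1/2) ^ n"
        unfolding closure_approachable by (metis zero_less_divide_1_iff zero_less_numeral zero_less_power)
      then show ?thesis by (auto simp: dist_norm intro: less_imp_le)
    qed
    then obtain k where "\<And>n. norm (S (k n) - x) \<le> (1/2) ^ n" by metis
    then show ?thesis using False by (intro exI[of _ k]) auto
  qed
  then obtain k where k: "\<And>x n. norm (S (k x n) - x) \<le> (1/2) ^ n"
    and k_const: "\<And>h. k (S h) = (\<lambda>_. h)"
    by metis
  have Sk: "(\<lambda>n. S (k x n)) \<longlonglongrightarrow> x" for x
  proof -
    have "(\<lambda>n. S (k x n) - x) \<longlonglongrightarrow> 0"
      by (rule Lim_null_comparison[of _ "\<lambda>n. (1/2) ^ n"]) (auto simp: k LIMSEQ_realpow_zero)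
    then show ?thesis by (rule LIM_zero_cancel)
  qed
  define W where "W x \<omega> = lim (\<lambda>n. \<xi> (k x n) \<omega>)" for x \<omega>
  have [measurable]: "W x \<in> borel_measurable M" for x
    unfolding W_def[abs_def] by (intro borel_measurable_lim_metric) simp
  have W_lim: "AE \<omega> in M. (\<lambda>n. \<xi> (k x n) \<omega>) \<longlonglongrightarrow> W x \<omega>" for x
  proof -
    have "AE \<omega> in M. convergent (\<lambda>n. \<xi> (k x n) \<omega>)"
    proof (rule AE_convergent_of_summable_increments)
      fix n
      have "(\<integral>\<^sup>+\<omega>. ennreal \<bar>\<xi> (k x (Suc n)) \<omega> - \<xi> (k x n) \<omega>\<bar> \<partial>M)
          = (\<integral>\<^sup>+\<omega>. ennreal \<bar>\<xi> (1 *\<^sub>R k x (Suc n) + (- 1) *\<^sub>R k x n) \<omega>\<bar> \<partial>M)"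
        using lin[of 1 "k x (Suc n)" "- 1" "k x n"] by (intro nn_integral_cong_AE) auto
      also have "\<dots> \<le> ennreal (2 * (1/2) ^ n)"
      proof (rule abs_\<xi>)
        have "norm (S (k x (Suc n)) - S (k x n)) \<le> norm (S (k x (Suc n)) - x) + norm (S (k x n) - x)"
          using norm_triangle_ineq4[of "S (k x (Suc n)) - x" "S (k x n) - x"] by simp
        also have "\<dots> \<le> (1/2) ^ Suc n + (1/2) ^ n" by (intro add_mono k)
        also have "\<dots> \<le> 2 * (1/2) ^ n" by simp
        finally show "norm (S (1 *\<^sub>R k x (Suc n) + (- 1) *\<^sub>R k x n)) \<le> 2 * (1/2) ^ n"
          by (simp add: S.diff)
      qed simp
      finally show "(\<integral>\<^sup>+\<omega>. ennreal \<bar>\<xi> (k x (Suc n)) \<omega> - \<xi> (k x n) \<omega>\<bar> \<partial>M) \<le> ennreal (2 * (1/2) ^ n)" .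
    qed (auto intro!: summable_mult summable_geometric)
    then show ?thesis unfolding W_def by (simp add: convergent_LIMSEQ_iff)
  qed
  have cos_lim: "(\<integral>\<omega>. cos (Z \<omega> + a) \<partial>M) = cos a * exp (- (norm y)\<^sup>2 / 2)"
    if Z[measurable]: "Z \<in> borel_measurable M" and lim: "AE \<omega> in M. (\<lambda>n. \<xi> (u n) \<omega>) \<longlonglongrightarrow> Z \<omega>"
      and y: "(\<lambda>n. S (u n)) \<longlonglongrightarrow> y" for Z u y a
  proof (rule LIMSEQ_unique)
    show "(\<lambda>n. \<integral>\<omega>. cos (\<xi> (u n) \<omega> + a) \<partial>M) \<longlonglongrightarrow> (\<integral>\<omega>. cos (Z \<omega> + a) \<partial>M)"
    proof (rule integral_dominated_convergence[where w = "\<lambda>_. 1"])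
      show "AE \<omega> in M. (\<lambda>n. cos (\<xi> (u n) \<omega> + a)) \<longlonglongrightarrow> cos (Z \<omega> + a)"
        using lim by eventually_elim (intro tendsto_intros)
    qed auto
    show "(\<lambda>n. \<integral>\<omega>. cos (\<xi> (u n) \<omega> + a) \<partial>M) \<longlonglongrightarrow> cos a * exp (- (norm y)\<^sup>2 / 2)"
      unfolding cos_\<xi> by (intro tendsto_intros y) simp
  qed
  have linear: "AE \<omega> in M. W (b *\<^sub>R x + c *\<^sub>R y) \<omega> = b * W x \<omega> + c * W y \<omega>" for b c x y
  proof -
    let ?z = "b *\<^sub>R x + c *\<^sub>R y"
    \<comment> \<open>The linearity defect is a limit of noise variables whose variances tend to 0.\<close>
    define Z where "Z \<omega> = W ?z \<omega> - (b * W x \<omega> + c * W y \<omega>)" for \<omega>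
    have [measurable]: "Z \<in> borel_measurable M" unfolding Z_def by measurable
    define d where "d n = k ?z n - (b *\<^sub>R k x n + c *\<^sub>R k y n)" for n
    have d: "AE \<omega> in M. \<forall>n. \<xi> (d n) \<omega> = \<xi> (k ?z n) \<omega> - (b * \<xi> (k x n) \<omega> + c * \<xi> (k y n) \<omega>)"
    proof (subst AE_all_countable, intro allI)
      fix n
      show "AE \<omega> in M. \<xi> (d n) \<omega> = \<xi> (k ?z n) \<omega> - (b * \<xi> (k x n) \<omega> + c * \<xi> (k y n) \<omega>)"
        using lin[of 1 "k ?z n" "- 1" "b *\<^sub>R k x n + c *\<^sub>R k y n"] lin[of b "k x n" c "k y n"]
        unfolding d_def scaleR_one scaleR_minus1_left add_uminus_conv_diff
        by eventually_elim simp
    qed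
    have "AE \<omega> in M. Z \<omega> = 0"
    proof (rule AE_zero_of_cos_transform_one[OF prob_space_axioms])
      fix t a
      have scale: "AE \<omega> in M. \<forall>n. \<xi> (t *\<^sub>R d n) \<omega> = t * \<xi> (d n) \<omega>"
        using lin[of t "d _" 0 0] by (subst AE_all_countable) simp
      have "(\<integral>\<omega>. cos (t * Z \<omega> + a) \<partial>M) = cos a * exp (- (norm (0::'a))\<^sup>2 / 2)"
      proof (rule cos_lim[of "\<lambda>\<omega>. t * Z \<omega>" "\<lambda>n. t *\<^sub>R d n" 0])
        show "AE \<omega> in M. (\<lambda>n. \<xi> (t *\<^sub>R d n) \<omega>) \<longlonglongrightarrow> t * Z \<omega>"
          using d scale W_lim[of ?z] W_lim[of x] W_lim[of y]
          by eventually_elim (auto simp: Z_def intro!: tendsto_intros)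
        have "(\<lambda>n. t *\<^sub>R (S (k ?z n) - (b *\<^sub>R S (k x n) + c *\<^sub>R S (k y n)))) \<longlonglongrightarrow> t *\<^sub>R (?z - ?z)"
          by (intro tendsto_intros Sk)
        then show "(\<lambda>n. S (t *\<^sub>R d n)) \<longlonglongrightarrow> 0"
          by (simp add: d_def S.scaleR S.diff S.add)
      qed simp
      then show "(\<integral>\<omega>. cos (t * Z \<omega> + a) \<partial>M) = cos a" by simp
    qed simp
    then show ?thesis by eventually_elim (simp add: Z_def)
  qed
  have "isonormal M W"
  proof
    show "W x \<in> borel_measurable M" for x by simp
    show "(\<integral>\<omega>. cos (W x \<omega> + a) \<partial>M) = cos a * exp (- (norm x)\<^sup>2 / 2)" for x a
      by (rule cos_lim[OF _ W_lim Sk]) simp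
  qed (rule linear)
  moreover have "W (S h) = \<xi> h" for h
    by (simp add: W_def[abs_def] k_const limI)
  ultimately show thesis by (rule that)
qed

section \<open>Testing the shift of a white noise\<close>

lemma integrable_product_of_squares:
  fixes f g :: "'w \<Rightarrow> real"
  assumes [measurable]: "f \<in> borel_measurable M" "g \<in> borel_measurable M"
    and int: "integrable M (\<lambda>\<omega>. (f \<omega>)\<^sup>2)" "integrable M (\<lambda>\<omega>. (g \<omega>)\<^sup>2)"
  shows "integrable M (\<lambda>\<omega>. f \<omega> * g \<omega>)"
proof (rule Bochner_Integration.integrable_bound)
  show "integrable M (\<lambda>\<omega>. (f \<omega>)\<^sup>2 + (g \<omega>)\<^sup>2)" using int by simp
  have "\<bar>x * y\<bar> \<le> x\<^sup>2 + y\<^sup>2" for x y :: real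
  proof -
    have "2 * (\<bar>x\<bar> * \<bar>y\<bar>) \<le> x\<^sup>2 + y\<^sup>2" using sum_squares_bound[of "\<bar>x\<bar>" "\<bar>y\<bar>"] by simp
    moreover have "0 \<le> \<bar>x\<bar> * \<bar>y\<bar>" by simp
    ultimately show ?thesis unfolding abs_mult by linarith
  qed
  then show "AE \<omega> in M. norm (f \<omega> * g \<omega>) \<le> norm ((f \<omega>)\<^sup>2 + (g \<omega>)\<^sup>2)" by simp
qed simp

text \<open>Take a linear combination whose squared distance to \<open>K\<close> exceeds the infimum by less than
  \<open>\<delta>\<^sup>2/C\<close>. Adding a multiple of any \<open>L i\<close> cannot go below the infimum, and this bounds the inner
  product of the remainder with \<open>L i\<close> by \<open>\<delta>\<close>. The bound is uniform in \<open>i\<close> because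
  the norms of the \<open>L i\<close> are.\<close>

lemma L2_span_approximation:
  fixes L :: "'i \<Rightarrow> 'w \<Rightarrow> real" and K :: "'w \<Rightarrow> real"
  assumes K[measurable]: "K \<in> borel_measurable M" and K2: "integrable M (\<lambda>\<omega>. (K \<omega>)\<^sup>2)"
    and L[measurable]: "\<And>i. L i \<in> borel_measurable M" and L2: "\<And>i. integrable M (\<lambda>\<omega>. (L i \<omega>)\<^sup>2)"
    and C: "\<And>i. i \<in> I \<Longrightarrow> (\<integral>\<omega>. (L i \<omega>)\<^sup>2 \<partial>M) \<le> C" "0 < C" and \<delta>: "0 < \<delta>"
  obtains F c where "finite F" "F \<subseteq> I"
    "\<And>i. i \<in> I \<Longrightarrow> \<bar>(\<integral>\<omega>. K \<omega> * L i \<omega> \<partial>M) - (\<Sum>j\<in>F. c j * (\<integral>\<omega>. L j \<omega> * L i \<omega> \<partial>M))\<bar> \<le> \<delta>"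
proof -
  define e where "e F c \<omega> = K \<omega> - (\<Sum>j\<in>F. c j * L j \<omega>)" for F c \<omega>
  define E where "E = {\<integral>\<omega>. (e F c \<omega>)\<^sup>2 \<partial>M | F c. finite F \<and> F \<subseteq> I}"
  have [measurable]: "e F c \<in> borel_measurable M" for F c unfolding e_def by measurable
  have KL: "integrable M (\<lambda>\<omega>. K \<omega> * L i \<omega>)" and LL: "integrable M (\<lambda>\<omega>. L j \<omega> * L i \<omega>)" for i j
    by (auto intro!: integrable_product_of_squares K2 L2)
  have eL_eq: "e F c \<omega> * L i \<omega> = K \<omega> * L i \<omega> - (\<Sum>j\<in>F. c j * (L j \<omega> * L i \<omega>))" for F c i \<omega>
    by (simp add: e_def left_diff_distrib sum_distrib_right mult.assoc)
  have eL: "integrable M (\<lambda>\<omega>. e F c \<omega> * L i \<omega>)"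
    "(\<integral>\<omega>. e F c \<omega> * L i \<omega> \<partial>M) = (\<integral>\<omega>. K \<omega> * L i \<omega> \<partial>M) - (\<Sum>j\<in>F. c j * (\<integral>\<omega>. L j \<omega> * L i \<omega> \<partial>M))" for F c i
    unfolding eL_eq by (auto simp: KL LL)
  have e2: "integrable M (\<lambda>\<omega>. (e F c \<omega>)\<^sup>2)" if "finite F" for F c
  proof -
    have "(e F c \<omega>)\<^sup>2 = e F c \<omega> * K \<omega> - (\<Sum>j\<in>F. c j * (e F c \<omega> * L j \<omega>))" for \<omega>
    proof -
      have "(\<Sum>j\<in>F. c j * (e F c \<omega> * L j \<omega>)) = e F c \<omega> * (\<Sum>j\<in>F. c j * L j \<omega>)"
        by (simp add: sum_distrib_left mult_ac)
      then show ?thesis by (simp add: e_def power2_eq_square algebra_simps)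
    qed
    moreover have "e F c \<omega> * K \<omega> = (K \<omega>)\<^sup>2 - (\<Sum>j\<in>F. c j * (K \<omega> * L j \<omega>))" for \<omega>
    proof -
      have "(\<Sum>j\<in>F. c j * (K \<omega> * L j \<omega>)) = K \<omega> * (\<Sum>j\<in>F. c j * L j \<omega>)"
        by (simp add: sum_distrib_left mult_ac)
      then show ?thesis by (simp add: e_def power2_eq_square algebra_simps)
    qed
    ultimately show ?thesis using K2 KL eL(1) by simp
  qed
  have "bdd_below E" by (auto simp: E_def intro!: bdd_belowI[of _ 0])
  then have inf_le: "Inf E \<le> (\<integral>\<omega>. (e F c \<omega>)\<^sup>2 \<partial>M)" if "finite F" "F \<subseteq> I" for F c
    using that by (intro cInf_lower) (auto simp: E_def)
  have "E \<noteq> {}" by (auto simp: E_def)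
  then obtain F c where F: "finite F" "F \<subseteq> I" and near: "(\<integral>\<omega>. (e F c \<omega>)\<^sup>2 \<partial>M) < Inf E + \<delta>\<^sup>2 / C"
    using cInf_lessD[of E "Inf E + \<delta>\<^sup>2 / C"] \<delta> C(2) by (auto simp: E_def)
  show thesis
  proof (rule that[OF F])
    fix i assume i: "i \<in> I"
    define a where "a = (\<integral>\<omega>. e F c \<omega> * L i \<omega> \<partial>M)"
    \<comment> \<open>This \<open>t\<close> minimises \<open>- 2 t a + t\<^sup>2 C\<close>, the bound for the change of the squared distance.\<close>
    define t where "t = a / C"
    define c' where "c' j = (if j \<in> F then c j else 0) + (if j = i then t else 0)" for j
    have step: "e (insert i F) c' \<omega> = e F c \<omega> - t * L i \<omega>" for \<omega>
    proof -
      have "(\<Sum>j\<in>insert i F. c' j * L j \<omega>)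
          = (\<Sum>j\<in>insert i F. (if j \<in> F then c j else 0) * L j \<omega>) + (\<Sum>j\<in>insert i F. (if j = i then t else 0) * L j \<omega>)"
        by (simp add: c'_def distrib_right sum.distrib)
      also have "(\<Sum>j\<in>insert i F. (if j \<in> F then c j else 0) * L j \<omega>) = (\<Sum>j\<in>F. c j * L j \<omega>)"
        using F(1) by (intro sum.mono_neutral_cong_right) auto
      also have "(\<Sum>j\<in>insert i F. (if j = i then t else 0) * L j \<omega>) = t * L i \<omega>"
        using F(1) by (subst sum.mono_neutral_cong_right[of _ "{i}" _ "\<lambda>j. t * L j \<omega>"]) auto
      finally show ?thesis by (simp add: e_def)
    qed
    have "Inf E \<le> (\<integral>\<omega>. (e (insert i F) c' \<omega>)\<^sup>2 \<partial>M)" using F i by (intro inf_le) auto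
    also have "\<dots> = (\<integral>\<omega>. (e F c \<omega>)\<^sup>2 - 2 * t * (e F c \<omega> * L i \<omega>) + t\<^sup>2 * (L i \<omega>)\<^sup>2 \<partial>M)"
      unfolding step by (simp add: power2_diff power_mult_distrib algebra_simps)
    also have "\<dots> = (\<integral>\<omega>. (e F c \<omega>)\<^sup>2 \<partial>M) - 2 * t * a + t\<^sup>2 * (\<integral>\<omega>. (L i \<omega>)\<^sup>2 \<partial>M)"
      using e2[OF F(1)] eL(1) L2 by (simp add: a_def)
    also have "\<dots> \<le> (\<integral>\<omega>. (e F c \<omega>)\<^sup>2 \<partial>M) - 2 * t * a + t\<^sup>2 * C"
      using C(1)[OF i] by (intro add_left_mono mult_left_mono) auto
    also have "\<dots> = (\<integral>\<omega>. (e F c \<omega>)\<^sup>2 \<partial>M) - a\<^sup>2 / C"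
      using C(2) by (simp add: t_def power2_eq_square field_simps)
    finally have "a\<^sup>2 / C < \<delta>\<^sup>2 / C" using near by linarith
    then have "\<bar>a\<bar>\<^sup>2 < \<delta>\<^sup>2" using C(2) by (simp add: divide_less_cancel)
    then have "\<bar>a\<bar> \<le> \<delta>" using \<delta> by (meson less_imp_le power_less_imp_less_base)
    then show "\<bar>(\<integral>\<omega>. K \<omega> * L i \<omega> \<partial>M) - (\<Sum>j\<in>F. c j * (\<integral>\<omega>. L j \<omega> * L i \<omega> \<partial>M))\<bar> \<le> \<delta>"
      by (simp add: a_def eL(2))
  qed
qed

lemma exp_sum_continuous:
  fixes t :: "'i \<Rightarrow> real"
  assumes "finite F" "0 < \<delta>"
  shows "\<exists>\<eta>>0. \<forall>s. (\<forall>j\<in>F. \<bar>s j - t j\<bar> < \<eta>) \<longrightarrow>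
    \<bar>(\<Sum>j\<in>F. c j * exp (s j)) - (\<Sum>j\<in>F. c j * exp (t j))\<bar> < \<delta>"
  using assms
proof (induction F arbitrary: \<delta> rule: finite_induct)
  case empty
  then show ?case by (intro exI[of _ 1]) simp
next
  case (insert k F)
  obtain \<eta>1 where \<eta>1: "0 < \<eta>1" "\<And>s. \<forall>j\<in>F. \<bar>s j - t j\<bar> < \<eta>1 \<Longrightarrow>
      \<bar>(\<Sum>j\<in>F. c j * exp (s j)) - (\<Sum>j\<in>F. c j * exp (t j))\<bar> < \<delta> / 2"
    using insert.IH[of "\<delta> / 2"] insert.prems by auto
  have "isCont (\<lambda>x. c k * exp x) (t k)" by simp
  then obtain \<eta>2 where \<eta>2: "0 < \<eta>2" "\<And>x. \<bar>x - t k\<bar> < \<eta>2 \<Longrightarrow> \<bar>c k * exp x - c k * exp (t k)\<bar> < \<delta> / 2"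
    using insert.prems unfolding continuous_at_eps_delta dist_real_def by (metis half_gt_zero)
  have "\<bar>(\<Sum>j\<in>insert k F. c j * exp (s j)) - (\<Sum>j\<in>insert k F. c j * exp (t j))\<bar> < \<delta>"
    if "\<forall>j\<in>insert k F. \<bar>s j - t j\<bar> < min \<eta>1 \<eta>2" for s
  proof -
    have "\<bar>(\<Sum>j\<in>F. c j * exp (s j)) - (\<Sum>j\<in>F. c j * exp (t j))\<bar> < \<delta> / 2"
      "\<bar>c k * exp (s k) - c k * exp (t k)\<bar> < \<delta> / 2"
      using \<eta>1(2)[of s] \<eta>2(2)[of "s k"] that by auto
    then show ?thesis unfolding sum.insert[OF insert.hyps] by argo
  qed
  then show ?case using \<eta>1(1) \<eta>2(1) by (intro exI[of _ "min \<eta>1 \<eta>2"]) auto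
qed

text \<open>An observation \<open>Y \<epsilon> x\<close> in an arbitrary space \<open>N\<close> whose sigma-algebra is generated by coordinates
  \<open>ev h\<close>, observed with noise level \<open>\<epsilon>\<close>; \<open>signal x\<close> is the shift \<open>R\<^sup>-\<^sup>1\<^sup>/\<^sup>2Ax\<close>. It is only
  meaningful for \<open>x\<close> in \<open>X\<close>. The point \<open>z\<close> with zero signal supplies the reference law, with
  respect to which all the others have densities.\<close>

locale gaussian_experiment = isonormal M W
  for M :: "'w measure" and W :: "'a::{real_inner,complete_space} \<Rightarrow> 'w \<Rightarrow> real" +
  fixes N :: "'y measure" and ev :: "'a \<Rightarrow> 'y \<Rightarrow> real" and S :: "'a \<Rightarrow> 'a"
    and X :: "'x set" and signal :: "'x \<Rightarrow> 'a" and z :: 'x and Y :: "real \<Rightarrow> 'x \<Rightarrow> 'w \<Rightarrow> 'y"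
  assumes sets_N: "sets N = sigma_sets (space N) {ev h -` B \<inter> space N | h B. B \<in> sets borel}"
    and measurable_Y[measurable]: "Y \<epsilon> x \<in> measurable M N"
    and ev_Y: "x \<in> X \<Longrightarrow> \<omega> \<in> space M \<Longrightarrow> ev h (Y \<epsilon> x \<omega>) = inner (signal x) (S h) + \<epsilon> * W (S h) \<omega>"
    and z: "z \<in> X" "signal z = 0"
begin

lemma measurable_ev[measurable]: "ev h \<in> borel_measurable N"
proof (rule measurableI)
  fix B :: "real set" assume "B \<in> sets borel"
  then show "ev h -` B \<inter> space N \<in> sets N"
    unfolding sets_N by (intro sigma_sets.Basic) blast
qed simp

abbreviation law :: "real \<Rightarrow> 'x \<Rightarrow> 'y measure" where
  "law \<epsilon> x \<equiv> distr M N (Y \<epsilon> x)"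

lemma measure_eq_of_cylinders:
  assumes fin: "finite_measure P" "finite_measure Q" and sets: "sets P = sets N" "sets Q = sets N"
    and eq: "\<And>F B. finite F \<Longrightarrow> (\<And>h. B h \<in> sets borel) \<Longrightarrow>
      measure P {y\<in>space N. \<forall>h\<in>F. ev h y \<in> B h} = measure Q {y\<in>space N. \<forall>h\<in>F. ev h y \<in> B h}"
  shows "P = Q"
proof -
  interpret P: finite_measure P by fact
  interpret Q: finite_measure Q by fact
  define E where "E = {{y\<in>space N. \<forall>h\<in>F. ev h y \<in> B h} | F B. finite F \<and> (\<forall>h. B h \<in> sets (borel :: real measure))}"
  have E_sets: "E \<subseteq> sets N"
  proof
    fix A assume "A \<in> E"
    then obtain F B where FB: "A = {y\<in>space N. \<forall>h\<in>F. ev h y \<in> B h}" "finite F"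
      and [measurable]: "\<And>h. B h \<in> sets (borel :: real measure)" by (auto simp: E_def)
    show "A \<in> sets N" unfolding FB(1) using FB(2) by measurable
  qed
  have gen: "sets N = sigma_sets (space N) E"
  proof
    show "sets N \<subseteq> sigma_sets (space N) E"
      unfolding sets_N
    proof (rule sigma_sets_mono', safe)
      fix h and B :: "real set" assume "B \<in> sets borel"
      then show "ev h -` B \<inter> space N \<in> E"
        unfolding E_def mem_Collect_eq by (intro exI[of _ "{h}"] exI[of _ "\<lambda>_. B"]) auto
    qed
    show "sigma_sets (space N) E \<subseteq> sets N"
      using E_sets by (rule sets.sigma_sets_subset)
  qed
  show ?thesis
  proof (rule measure_eqI_generator_eq[where E = E and \<Omega> = "space N" and A = "\<lambda>_. space N"])
    show "Int_stable E"
    proof (rule Int_stableI)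
      fix A A' assume "A \<in> E" "A' \<in> E"
      then obtain F B F' B' where *: "A = {y\<in>space N. \<forall>h\<in>F. ev h y \<in> B h}" "finite F" "\<forall>h. B h \<in> sets borel"
        "A' = {y\<in>space N. \<forall>h\<in>F'. ev h y \<in> B' h}" "finite F'" "\<forall>h. B' h \<in> sets borel"
        unfolding E_def by blast
      define B'' where "B'' h = (if h \<in> F then B h else UNIV) \<inter> (if h \<in> F' then B' h else UNIV)" for h
      have "A \<inter> A' = {y\<in>space N. \<forall>h\<in>F \<union> F'. ev h y \<in> B'' h}"
        unfolding * B''_def by auto
      moreover have "\<forall>h. B'' h \<in> sets borel" using * by (auto simp: B''_def)
      moreover have "finite (F \<union> F')" using * by simp
      ultimately show "A \<inter> A' \<in> E"
        unfolding E_def mem_Collect_eq by (intro exI[of _ "F \<union> F'"] exI[of _ B''] conjI)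
    qed
    show "E \<subseteq> Pow (space N)" by (auto simp: E_def)
    show "sets P = sigma_sets (space N) E" "sets Q = sigma_sets (space N) E" using sets gen by auto
    show "range (\<lambda>_. space N) \<subseteq> E"
      by (auto simp: E_def intro!: exI[of _ "{}"] exI[of _ "\<lambda>_. UNIV"])
    fix A assume "A \<in> E"
    then show "emeasure P A = emeasure Q A"
      using eq by (auto simp: E_def P.emeasure_eq_measure Q.emeasure_eq_measure)
  qed auto
qed

text \<open>The Cameron--Martin theorem on the observation space. Both measures are determined by their values on
  finite dimensional cylinders, where \<open>cameron_martin_boxes\<close> applies.\<close>

lemma law_eq_density:
  assumes \<epsilon>: "0 < \<epsilon>" and x: "x \<in> X"
  shows "law \<epsilon> x = distr (density M (\<lambda>\<omega>. ennreal (likelihood ((1 / \<epsilon>) *\<^sub>R signal x) \<omega>))) N (Y \<epsilon> z)"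
proof -
  let ?D = "density M (\<lambda>\<omega>. ennreal (likelihood ((1 / \<epsilon>) *\<^sub>R signal x) \<omega>))"
  have finD: "finite_measure ?D"
    by (rule finite_measure_likelihood)
  show ?thesis
  proof (rule measure_eq_of_cylinders)
    show "finite_measure (law \<epsilon> x)" by (intro finite_measure_distr) simp
    show "finite_measure (distr ?D N (Y \<epsilon> z))" using finD by (intro finite_measure.finite_measure_distr) simp_all
    fix F :: "'a set" and B :: "'a \<Rightarrow> real set"
    assume F: "finite F" and B: "\<And>h. B h \<in> sets borel"
    note [measurable] = B
    define B' where "B' h = {r. \<epsilon> * r \<in> B h}" for h
    have B': "B' h \<in> sets borel" for h
    proof -
      have "(\<lambda>r. \<epsilon> * r) -` B h \<inter> space borel \<in> sets borel" by measurable
      then show ?thesis by (simp add: B'_def vimage_def)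
    qed
    have Y_space: "Y \<epsilon> x' \<omega> \<in> space N" if "\<omega> \<in> space M" for x' \<omega>
      using measurable_space[OF measurable_Y that] .
    let ?A = "{y\<in>space N. \<forall>h\<in>F. ev h y \<in> B h}"
    have A: "?A \<in> sets N" using F by measurable
    have "measure (distr ?D N (Y \<epsilon> z)) ?A = measure ?D (Y \<epsilon> z -` ?A \<inter> space M)"
      using A by (subst measure_distr) auto
    also have "Y \<epsilon> z -` ?A \<inter> space M = {\<omega>\<in>space M. \<forall>h\<in>F. W (S h) \<omega> \<in> B' h}"
      using z Y_space by (auto simp: ev_Y B'_def)
    also have "measure ?D \<dots> = measure M {\<omega>\<in>space M. \<forall>h\<in>F. inner ((1 / \<epsilon>) *\<^sub>R signal x) (S h) + W (S h) \<omega> \<in> B' h}"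
      using cameron_martin_boxes[OF F B', of "(1 / \<epsilon>) *\<^sub>R signal x" S] .
    also have "{\<omega>\<in>space M. \<forall>h\<in>F. inner ((1 / \<epsilon>) *\<^sub>R signal x) (S h) + W (S h) \<omega> \<in> B' h} = Y \<epsilon> x -` ?A \<inter> space M"
      using x \<epsilon> Y_space by (auto simp: ev_Y B'_def distrib_left)
    also have "measure M \<dots> = measure (law \<epsilon> x) ?A"
      using A by (subst measure_distr) auto
    finally show "measure (law \<epsilon> x) ?A = measure (distr ?D N (Y \<epsilon> z)) ?A" by simp
  qed auto
qed

lemma integral_likelihood: "(\<integral>\<omega>. likelihood x \<omega> \<partial>M) = 1"
proof -
  have "(\<integral>\<omega>. likelihood x \<omega> \<partial>M) = exp (- (norm x)\<^sup>2 / 2) * exp ((norm x)\<^sup>2 / 2)"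
    unfolding likelihood_eq by (simp add: integral_exp_W)
  then show ?thesis by (simp add: mult_exp_exp)
qed

lemma nn_integral_law:
  assumes K: "is_test N K" and \<epsilon>: "0 < \<epsilon>" and x: "x \<in> X"
  shows "(\<integral>\<^sup>+y. ennreal (K y) \<partial>law \<epsilon> x)
    = ennreal (\<integral>\<omega>. K (Y \<epsilon> z \<omega>) * likelihood ((1 / \<epsilon>) *\<^sub>R signal x) \<omega> \<partial>M)"
proof -
  let ?L = "likelihood ((1 / \<epsilon>) *\<^sub>R signal x)"
  have [measurable]: "K \<in> borel_measurable N" using K by (simp add: is_test_def)
  have K01: "0 \<le> K (Y \<epsilon> z \<omega>) \<and> K (Y \<epsilon> z \<omega>) \<le> 1" if "\<omega> \<in> space M" for \<omega>
    using K measurable_space[OF measurable_Y that] by (auto simp: is_test_def)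
  have int: "integrable M (\<lambda>\<omega>. K (Y \<epsilon> z \<omega>) * ?L \<omega>)"
    by (rule Bochner_Integration.integrable_bound[OF integrable_likelihood[of "(1 / \<epsilon>) *\<^sub>R signal x"]])
      (use K01 likelihood_pos in \<open>auto simp: abs_mult less_imp_le intro!: AE_I2 mult_left_le_one_le\<close>)
  have "(\<integral>\<^sup>+y. ennreal (K y) \<partial>law \<epsilon> x) = (\<integral>\<^sup>+\<omega>. ennreal (?L \<omega>) * ennreal (K (Y \<epsilon> z \<omega>)) \<partial>M)"
    unfolding law_eq_density[OF \<epsilon> x] by (simp add: nn_integral_distr nn_integral_density)
  also have "\<dots> = (\<integral>\<^sup>+\<omega>. ennreal (K (Y \<epsilon> z \<omega>) * ?L \<omega>) \<partial>M)"
    using K01 by (intro nn_integral_cong) (simp add: ennreal_mult' mult.commute less_imp_le[OF likelihood_pos])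
  also have "\<dots> = ennreal (\<integral>\<omega>. K (Y \<epsilon> z \<omega>) * ?L \<omega> \<partial>M)"
    using int K01 by (intro nn_integral_eq_integral) (auto intro!: AE_I2 mult_nonneg_nonneg less_imp_le[OF likelihood_pos])
  finally show ?thesis .
qed

text \<open>The power function of a test is uniformly close to a finite sum of exponentials of coordinates of the
  shift in directions \<open>signal j\<close>, \<open>j \<in> F\<close>. Applied to the span of these directions, the hypothesis
  gives points \<open>u\<close> and \<open>v\<close> of the two weak closures with equal coordinates, and weak approximation
  of \<open>u\<close> and \<open>v\<close> gives \<open>x \<in> X0\<close> and \<open>y \<in> X1\<close> with almost equal power.\<close>

theorem indistinguishable_of_not_separated:
  assumes X01: "X0 \<subseteq> X" "X1 \<subseteq> X" and b: "bounded (signal ` X0)" "bounded (signal ` X1)"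
    and nsep: "\<not> separated_by_projection (signal ` X0) (signal ` X1)"
  shows "indistinguishable N law X0 X1"
  unfolding indistinguishable_def
proof (intro allI impI)
  fix \<epsilon> :: real and K
  assume \<epsilon>: "0 < \<epsilon>" and K: "is_test N K"
  have [measurable]: "K \<in> borel_measurable N" using K by (simp add: is_test_def)
  define k where "k \<omega> = K (Y \<epsilon> z \<omega>)" for \<omega>
  have [measurable]: "k \<in> borel_measurable M" unfolding k_def by measurable
  have k01: "0 \<le> k \<omega> \<and> k \<omega> \<le> 1" if "\<omega> \<in> space M" for \<omega>
    unfolding k_def using K measurable_space[OF measurable_Y that] by (auto simp: is_test_def)
  define s where "s x = (1 / \<epsilon>) *\<^sub>R signal x" for x
  define \<phi> where "\<phi> x = (\<integral>\<omega>. k \<omega> * likelihood (s x) \<omega> \<partial>M)" for x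
  have kl: "integrable M (\<lambda>\<omega>. k \<omega> * likelihood (s x) \<omega>)" for x
    by (rule Bochner_Integration.integrable_bound[OF integrable_likelihood[of "s x"]])
      (use k01 likelihood_pos in \<open>auto simp: abs_mult less_imp_le intro!: AE_I2 mult_left_le_one_le\<close>)
  have power_I: "(\<integral>\<^sup>+y. ennreal (K y) \<partial>law \<epsilon> x) = ennreal (\<phi> x)" if "x \<in> X" for x
    using nn_integral_law[OF K \<epsilon> that] by (simp add: \<phi>_def k_def s_def)
  have power_II: "(\<integral>\<^sup>+y. ennreal (1 - K y) \<partial>law \<epsilon> x) = ennreal (1 - \<phi> x)" if "x \<in> X" for x
  proof -
    have "is_test N (\<lambda>y. 1 - K y)" using K by (auto simp: is_test_def)
    from nn_integral_law[OF this \<epsilon> that] show ?thesis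
      using kl[of x] integrable_likelihood[of "s x"] integral_likelihood[of "s x"]
      by (simp add: \<phi>_def k_def s_def left_diff_distrib)
  qed
  have \<phi>0: "0 \<le> \<phi> x" for x
    unfolding \<phi>_def using k01
    by (intro Bochner_Integration.integral_nonneg_AE AE_I2) (auto intro!: mult_nonneg_nonneg less_imp_le[OF likelihood_pos])
  have "bounded (signal ` (X0 \<union> X1))" using b by (simp add: image_Un)
  then obtain r where r: "\<And>x. x \<in> X0 \<union> X1 \<Longrightarrow> norm (signal x) \<le> r"
    by (auto simp: bounded_iff)
  show "1 \<le> type_I_error (law \<epsilon>) X0 K + type_II_error (law \<epsilon>) X1 K"
  proof (rule ennreal_le_epsilon)
    fix e :: real assume e: "0 < e"
    \<comment> \<open>Four errors: two from the approximation of the power function, two from the approximation of \<open>u\<close> and \<open>v\<close>.\<close>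
    define \<delta> where "\<delta> = e / 4"
    have \<delta>: "0 < \<delta>" using e by (simp add: \<delta>_def)
    obtain F c where F: "finite F" "F \<subseteq> X0 \<union> X1"
      and approx: "\<And>x. x \<in> X0 \<union> X1 \<Longrightarrow>
        \<bar>(\<integral>\<omega>. k \<omega> * likelihood (s x) \<omega> \<partial>M) - (\<Sum>j\<in>F. c j * (\<integral>\<omega>. likelihood (s j) \<omega> * likelihood (s x) \<omega> \<partial>M))\<bar> \<le> \<delta>"
    proof (rule L2_span_approximation[of k M "\<lambda>x. likelihood (s x)" "X0 \<union> X1" "exp ((r / \<epsilon>)\<^sup>2)" \<delta>])
      show "integrable M (\<lambda>\<omega>. (k \<omega>)\<^sup>2)"
        by (rule integrable_const_bound[of _ 1]) (use k01 in \<open>auto intro!: AE_I2 power_le_one\<close>)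
      show "integrable M (\<lambda>\<omega>. (likelihood (s x) \<omega>)\<^sup>2)" for x
        using likelihood_product(1)[of "s x" "s x"] by (simp add: power2_eq_square)
      fix x assume "x \<in> X0 \<union> X1"
      then have "norm (s x) \<le> r / \<epsilon>" using r[of x] \<epsilon> by (simp add: s_def divide_right_mono)
      then have "(norm (s x))\<^sup>2 \<le> (r / \<epsilon>)\<^sup>2" by (intro power_mono) auto
      then show "(\<integral>\<omega>. (likelihood (s x) \<omega>)\<^sup>2 \<partial>M) \<le> exp ((r / \<epsilon>)\<^sup>2)"
        using likelihood_product(2)[of "s x" "s x"] by (simp add: power2_eq_square dot_square_norm)
    qed (use \<delta> in auto)
    define \<psi> where "\<psi> x = (\<Sum>j\<in>F. c j * exp (inner (signal x) (signal j) / \<epsilon>\<^sup>2))" for x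
    have \<phi>\<psi>: "\<bar>\<phi> x - \<psi> x\<bar> \<le> \<delta>" if "x \<in> X0 \<union> X1" for x
    proof -
      have "inner (s j) (s x) = inner (signal x) (signal j) / \<epsilon>\<^sup>2" for j
        by (simp add: s_def power2_eq_square inner_commute[of "signal j"])
      then show ?thesis using approx[OF that] by (simp add: \<phi>_def \<psi>_def likelihood_product(2))
    qed
    have "span (signal ` F) \<subseteq> closure (span (signal ` X0 \<union> signal ` X1))"
      using F(2) by (intro order_trans[OF span_mono closure_subset]) auto
    moreover have "finite_dim_subspace (span (signal ` F))"
      unfolding finite_dim_subspace_def using F(1) by blast
    ultimately have "orth_proj (span (signal ` F)) ` weak_closure (signal ` X0)
        \<inter> orth_proj (span (signal ` F)) ` weak_closure (signal ` X1) \<noteq> {}"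
      using nsep unfolding separated_by_projection_def by blast
    then obtain u v where u: "u \<in> weak_closure (signal ` X0)" and v: "v \<in> weak_closure (signal ` X1)"
      and "orth_proj (span (signal ` F)) u = orth_proj (span (signal ` F)) v"
      by (auto simp: disjoint_iff)
    then have uv: "inner u (signal j) = inner v (signal j)" if "j \<in> F" for j
      using orth_proj_span_eq_iff[of "signal ` F" u v] F(1) that by simp
    obtain \<eta> where \<eta>: "0 < \<eta>" and cont: "\<And>p. \<forall>j\<in>F. \<bar>p j - inner u (signal j) / \<epsilon>\<^sup>2\<bar> < \<eta> \<Longrightarrow>
      \<bar>(\<Sum>j\<in>F. c j * exp (p j)) - (\<Sum>j\<in>F. c j * exp (inner u (signal j) / \<epsilon>\<^sup>2))\<bar> < \<delta>"
      using exp_sum_continuous[OF F(1) \<delta>, of "\<lambda>j. inner u (signal j) / \<epsilon>\<^sup>2" c] by blast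
    have near: "\<bar>\<psi> x - (\<Sum>j\<in>F. c j * exp (inner u (signal j) / \<epsilon>\<^sup>2))\<bar> < \<delta>"
      if "\<And>j. j \<in> F \<Longrightarrow> \<bar>inner (signal x) (signal j) - inner u (signal j)\<bar> < \<eta> * \<epsilon>\<^sup>2" for x
      unfolding \<psi>_def
    proof (intro cont ballI)
      fix j assume "j \<in> F"
      have "\<bar>inner (signal x) (signal j) / \<epsilon>\<^sup>2 - inner u (signal j) / \<epsilon>\<^sup>2\<bar>
          = \<bar>inner (signal x) (signal j) - inner u (signal j)\<bar> / \<epsilon>\<^sup>2"
        by (simp add: diff_divide_distrib[symmetric])
      then show "\<bar>inner (signal x) (signal j) / \<epsilon>\<^sup>2 - inner u (signal j) / \<epsilon>\<^sup>2\<bar> < \<eta>"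
        using that[OF \<open>j \<in> F\<close>] \<epsilon> by (simp add: pos_divide_less_eq)
    qed
    have tol: "0 < \<eta> * \<epsilon>\<^sup>2" using \<eta> \<epsilon> by simp
    obtain x where x: "x \<in> X0" "\<And>j. j \<in> F \<Longrightarrow> \<bar>inner (signal x) (signal j) - inner u (signal j)\<bar> < \<eta> * \<epsilon>\<^sup>2"
      using u[unfolded weak_closure_iff, rule_format, OF finite_imageI[OF F(1), of signal] tol] by auto
    obtain y where y: "y \<in> X1" "\<And>j. j \<in> F \<Longrightarrow> \<bar>inner (signal y) (signal j) - inner u (signal j)\<bar> < \<eta> * \<epsilon>\<^sup>2"
      using v[unfolded weak_closure_iff, rule_format, OF finite_imageI[OF F(1), of signal] tol] uv by auto
    have "\<bar>\<phi> x - \<psi> x\<bar> \<le> \<delta>" "\<bar>\<phi> y - \<psi> y\<bar> \<le> \<delta>" using \<phi>\<psi> x(1) y(1) by auto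
    moreover have "\<bar>\<psi> x - \<psi> y\<bar> < 2 * \<delta>" using near[OF x(2)] near[OF y(2)] by linarith
    ultimately have "\<phi> y - \<phi> x \<le> e" unfolding \<delta>_def by argo
    then have "ennreal 1 \<le> ennreal (\<phi> x + max 0 (1 - \<phi> y) + e)" by (intro ennreal_leI) auto
    also have "\<dots> = ennreal (\<phi> x) + ennreal (1 - \<phi> y) + ennreal e"
      using \<phi>0 e by (simp add: ennreal_plus)
    also have "\<dots> \<le> type_I_error (law \<epsilon>) X0 K + type_II_error (law \<epsilon>) X1 K + ennreal e"
    proof (intro add_mono order_refl)
      show "ennreal (\<phi> x) \<le> type_I_error (law \<epsilon>) X0 K"
        unfolding type_I_error_def using x(1) X01 power_I[of x] by (intro SUP_upper2[of x]) auto
      show "ennreal (1 - \<phi> y) \<le> type_II_error (law \<epsilon>) X1 K"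
        unfolding type_II_error_def using y(1) X01 power_II[of y] by (intro SUP_upper2[of y]) auto
    qed
    finally show "1 \<le> type_I_error (law \<epsilon>) X0 K + type_II_error (law \<epsilon>) X1 K + ennreal e" by simp
  qed
qed

lemma integrable_abs_W: "integrable M (\<lambda>\<omega>. \<bar>W x \<omega>\<bar>)"
proof (rule Bochner_Integration.integrable_bound)
  show "integrable M (\<lambda>\<omega>. exp (W x \<omega>) + exp (W ((- 1) *\<^sub>R x) \<omega>))"
    by (intro Bochner_Integration.integrable_add integrable_exp_W)
  have "\<bar>w\<bar> \<le> exp w + exp (- w)" for w :: real
    using exp_ge_add_one_self[of w] exp_ge_add_one_self[of "- w"] exp_gt_zero[of w] exp_gt_zero[of "- w"]
    by linarith
  then show "AE \<omega> in M. norm \<bar>W x \<omega>\<bar> \<le> norm (exp (W x \<omega>) + exp (W ((- 1) *\<^sub>R x) \<omega>))"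
    using W_scale[of "- 1" x] by (auto elim!: eventually_mono)
qed simp

lemma noise_bound:
  assumes F: "finite F" and \<epsilon>: "0 < \<epsilon>" and \<tau>: "0 < \<tau>"
  shows "measure M {\<omega>\<in>space M. \<exists>h\<in>F. \<tau> \<le> \<epsilon> * \<bar>W (S h) \<omega>\<bar>}
    \<le> (\<Sum>h\<in>F. \<integral>\<omega>. \<bar>W (S h) \<omega>\<bar> \<partial>M) / \<tau> * \<epsilon>"
proof -
  have "{\<omega>\<in>space M. \<exists>h\<in>F. \<tau> \<le> \<epsilon> * \<bar>W (S h) \<omega>\<bar>}
      = (\<Union>h\<in>F. {\<omega>\<in>space M. \<tau> \<le> \<epsilon> * \<bar>W (S h) \<omega>\<bar>})" by auto
  also have "measure M \<dots> \<le> (\<Sum>h\<in>F. measure M {\<omega>\<in>space M. \<tau> \<le> \<epsilon> * \<bar>W (S h) \<omega>\<bar>})"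
    using F by (intro finite_measure_subadditive_finite) auto
  also have "\<dots> \<le> (\<Sum>h\<in>F. (\<integral>\<omega>. \<epsilon> * \<bar>W (S h) \<omega>\<bar> \<partial>M) / \<tau>)"
    using \<epsilon> \<tau> integrable_abs_W
    by (intro sum_mono integral_Markov_inequality_measure[where A = "{}"]) auto
  also have "\<dots> = (\<Sum>h\<in>F. \<integral>\<omega>. \<bar>W (S h) \<omega>\<bar> \<partial>M) / \<tau> * \<epsilon>"
    by (simp add: sum_divide_distrib sum_distrib_left mult.commute)
  finally show ?thesis .
qed

text \<open>Rounding the finitely many coordinates down to multiples of \<open>\<tau>\<close> takes only finitely many values on
  a bounded set; one representative for each value gives the net.\<close>

lemma finite_net:
  assumes b: "bounded (signal ` X1)" and F: "finite F" and \<tau>: "0 < \<tau>"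
  obtains T where "finite T" "T \<subseteq> X1"
    "\<And>x. x \<in> X1 \<Longrightarrow> \<exists>t\<in>T. \<forall>h\<in>F. \<bar>inner (signal x) (S h) - inner (signal t) (S h)\<bar> < \<tau>"
proof -
  obtain r where r: "\<And>x. x \<in> X1 \<Longrightarrow> norm (signal x) \<le> r" using b by (auto simp: bounded_iff)
  define g where "g x = (\<lambda>h\<in>F. \<lfloor>inner (signal x) (S h) / \<tau>\<rfloor>)" for x
  have "g ` X1 \<subseteq> PiE F (\<lambda>h. {\<lfloor>- (r * norm (S h) / \<tau>)\<rfloor>..\<lfloor>r * norm (S h) / \<tau>\<rfloor>})"
  proof (rule image_subsetI)
    fix x assume "x \<in> X1"
    have "\<bar>inner (signal x) (S h)\<bar> \<le> r * norm (S h)" for h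
      using Cauchy_Schwarz_ineq2[of "signal x" "S h"] mult_right_mono[OF r[OF \<open>x \<in> X1\<close>], of "norm (S h)"]
      by simp
    then have "\<bar>inner (signal x) (S h) / \<tau>\<bar> \<le> r * norm (S h) / \<tau>" for h
      using \<tau> by (simp add: divide_right_mono)
    then have "- (r * norm (S h) / \<tau>) \<le> inner (signal x) (S h) / \<tau>"
      "inner (signal x) (S h) / \<tau> \<le> r * norm (S h) / \<tau>" for h
      by (simp_all only: abs_le_iff minus_le_iff)
    then have "\<lfloor>- (r * norm (S h) / \<tau>)\<rfloor> \<le> \<lfloor>inner (signal x) (S h) / \<tau>\<rfloor>"
      "\<lfloor>inner (signal x) (S h) / \<tau>\<rfloor> \<le> \<lfloor>r * norm (S h) / \<tau>\<rfloor>" for h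
      by (auto intro!: floor_mono)
    then show "g x \<in> PiE F (\<lambda>h. {\<lfloor>- (r * norm (S h) / \<tau>)\<rfloor>..\<lfloor>r * norm (S h) / \<tau>\<rfloor>})"
      by (simp add: g_def)
  qed
  then have "finite (g ` X1)" by (rule finite_subset) (use F in \<open>auto intro!: finite_PiE\<close>)
  then obtain T where T: "T \<subseteq> X1" "finite T" "g ` X1 = g ` T"
    using finite_subset_image[of "g ` X1" g X1] by auto
  show thesis
  proof (rule that[OF T(2,1)])
    fix x assume "x \<in> X1"
    then obtain t where t: "t \<in> T" "g x = g t" using T(3) by (metis imageE imageI)
    have "\<bar>inner (signal x) (S h) - inner (signal t) (S h)\<bar> < \<tau>" if "h \<in> F" for h
    proof -
      have "\<lfloor>inner (signal x) (S h) / \<tau>\<rfloor> = \<lfloor>inner (signal t) (S h) / \<tau>\<rfloor>"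
        using fun_cong[OF t(2), of h] that by (simp add: g_def)
      then have "\<bar>inner (signal x) (S h) / \<tau> - inner (signal t) (S h) / \<tau>\<bar> < 1" by linarith
      then show ?thesis using \<tau> by (simp add: diff_divide_distrib[symmetric])
    qed
    with t(1) show "\<exists>t\<in>T. \<forall>h\<in>F. \<bar>inner (signal x) (S h) - inner (signal t) (S h)\<bar> < \<tau>" by blast
  qed
qed

text \<open>The test rejects \<open>H\<^sub>0\<close> if all observed coordinates are within \<open>\<eta>/2\<close> of a point of an \<open>\<eta>/4\<close>-net
  of the alternative. The net is finite, so this is a measurable event. A wrong decision in either
  direction forces some noise coordinate to be at least \<open>\<eta>/4\<close>. Since the level \<open>\<alpha>\<close> has to be kept
  for every \<open>\<epsilon>\<close>, the test never rejects while \<open>\<epsilon>\<close> is too large for that bound.\<close>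

theorem distinguishable_of_gap:
  assumes X01: "X0 \<subseteq> X" "X1 \<subseteq> X" and b: "bounded (signal ` X1)"
    and F: "finite F" and \<eta>: "0 < \<eta>"
    and gap: "\<And>x y. x \<in> X0 \<Longrightarrow> y \<in> X1 \<Longrightarrow>
      \<exists>h\<in>F. \<eta> \<le> \<bar>inner (signal x) (S h) - inner (signal y) (S h)\<bar>"
  shows "distinguishable N law X0 X1"
proof -
  obtain T where T: "finite T" "T \<subseteq> X1"
    and net: "\<And>x. x \<in> X1 \<Longrightarrow> \<exists>t\<in>T. \<forall>h\<in>F. \<bar>inner (signal x) (S h) - inner (signal t) (S h)\<bar> < \<eta> / 4"
    using finite_net[OF b F, of "\<eta> / 4"] \<eta> by auto
  define A where "A = {y\<in>space N. \<exists>t\<in>T. \<forall>h\<in>F. \<bar>ev h y - inner (signal t) (S h)\<bar> < \<eta> / 2}"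
  have A[measurable]: "A \<in> sets N" unfolding A_def using T(1) F by measurable
  define \<kappa> where "\<kappa> = (\<Sum>h\<in>F. \<integral>\<omega>. \<bar>W (S h) \<omega>\<bar> \<partial>M) / (\<eta> / 4)"
  define bad where "bad \<epsilon> = {\<omega>\<in>space M. \<exists>h\<in>F. \<eta> / 4 \<le> \<epsilon> * \<bar>W (S h) \<omega>\<bar>}" for \<epsilon>
  have [measurable]: "bad \<epsilon> \<in> sets M" for \<epsilon> unfolding bad_def using F by measurable
  have bad_le: "emeasure M (bad \<epsilon>) \<le> ennreal (\<kappa> * \<epsilon>)" if "0 < \<epsilon>" for \<epsilon>
    using noise_bound[OF F that, of "\<eta> / 4"] \<eta> by (simp add: emeasure_eq_measure \<kappa>_def bad_def ennreal_leI)
  have Y_space: "Y \<epsilon> x \<omega> \<in> space N" if "\<omega> \<in> space M" for \<epsilon> x \<omega>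
    using measurable_space[OF measurable_Y that] .
  have err0: "(\<integral>\<^sup>+y. ennreal (indicator A y) \<partial>law \<epsilon> x) \<le> ennreal (\<kappa> * \<epsilon>)" if \<epsilon>: "0 < \<epsilon>" and x: "x \<in> X0" for \<epsilon> x
  proof -
    have "Y \<epsilon> x -` A \<inter> space M \<subseteq> bad \<epsilon>"
    proof
      fix \<omega> assume \<omega>: "\<omega> \<in> Y \<epsilon> x -` A \<inter> space M"
      then obtain t where t: "t \<in> T" "\<And>h. h \<in> F \<Longrightarrow> \<bar>ev h (Y \<epsilon> x \<omega>) - inner (signal t) (S h)\<bar> < \<eta> / 2"
        by (auto simp: A_def)
      obtain h where h: "h \<in> F" "\<eta> \<le> \<bar>inner (signal x) (S h) - inner (signal t) (S h)\<bar>"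
        using gap[OF x] t(1) T(2) by blast
      have "ev h (Y \<epsilon> x \<omega>) = inner (signal x) (S h) + \<epsilon> * W (S h) \<omega>"
        using x X01 \<omega> by (intro ev_Y) auto
      then have "\<eta> / 4 \<le> \<bar>\<epsilon> * W (S h) \<omega>\<bar>"
        using t(2)[OF h(1)] h(2) \<eta> by linarith
      then show "\<omega> \<in> bad \<epsilon>" using \<omega> h(1) \<epsilon> by (auto simp: bad_def abs_mult)
    qed
    then have "emeasure M (Y \<epsilon> x -` A \<inter> space M) \<le> emeasure M (bad \<epsilon>)" by (intro emeasure_mono) auto
    moreover have "(\<integral>\<^sup>+y. ennreal (indicator A y) \<partial>law \<epsilon> x) = emeasure M (Y \<epsilon> x -` A \<inter> space M)"
      by (simp add: ennreal_indicator emeasure_distr)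
    ultimately show ?thesis using bad_le[OF \<epsilon>] by simp
  qed
  have err1: "(\<integral>\<^sup>+y. ennreal (1 - indicator A y) \<partial>law \<epsilon> x) \<le> ennreal (\<kappa> * \<epsilon>)" if \<epsilon>: "0 < \<epsilon>" and x: "x \<in> X1" for \<epsilon> x
  proof -
    have "Y \<epsilon> x -` (space N - A) \<inter> space M \<subseteq> bad \<epsilon>"
    proof
      fix \<omega> assume \<omega>: "\<omega> \<in> Y \<epsilon> x -` (space N - A) \<inter> space M"
      obtain t where t: "t \<in> T" "\<And>h. h \<in> F \<Longrightarrow> \<bar>inner (signal x) (S h) - inner (signal t) (S h)\<bar> < \<eta> / 4"
        using net[OF x] by blast
      obtain h where h: "h \<in> F" "\<eta> / 2 \<le> \<bar>ev h (Y \<epsilon> x \<omega>) - inner (signal t) (S h)\<bar>"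
        using \<omega> t(1) by (force simp: A_def)
      have "ev h (Y \<epsilon> x \<omega>) = inner (signal x) (S h) + \<epsilon> * W (S h) \<omega>"
        using x X01 \<omega> by (intro ev_Y) auto
      then have "\<eta> / 4 \<le> \<bar>\<epsilon> * W (S h) \<omega>\<bar>"
        using t(2)[OF h(1)] h(2) \<eta> by linarith
      then show "\<omega> \<in> bad \<epsilon>" using \<omega> h(1) \<epsilon> by (auto simp: bad_def abs_mult)
    qed
    then have "emeasure M (Y \<epsilon> x -` (space N - A) \<inter> space M) \<le> emeasure M (bad \<epsilon>)"
      by (intro emeasure_mono) auto
    moreover have "(\<integral>\<^sup>+y. ennreal (1 - indicator A y) \<partial>law \<epsilon> x) = (\<integral>\<^sup>+y. indicator (space N - A) y \<partial>law \<epsilon> x)"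
      by (intro nn_integral_cong) (auto simp: indicator_def)
    moreover have "\<dots> = emeasure M (Y \<epsilon> x -` (space N - A) \<inter> space M)"
      by (simp add: emeasure_distr)
    ultimately show ?thesis using bad_le[OF \<epsilon>] by simp
  qed
  show ?thesis
    unfolding distinguishable_def
  proof (intro allI impI)
    fix \<alpha> :: real assume \<alpha>: "0 < \<alpha> \<and> \<alpha> < 1"
    define K where "K \<epsilon> = (if \<kappa> * \<epsilon> < \<alpha> then indicator A else (\<lambda>_. 0 :: real))" for \<epsilon>
    have "is_test N (K \<epsilon>)" for \<epsilon>
      by (auto simp: is_test_def K_def indicator_def)
    moreover have "type_I_error (law \<epsilon>) X0 (K \<epsilon>) < ennreal \<alpha>" if \<epsilon>: "0 < \<epsilon>" for \<epsilon>
    proof (cases "\<kappa> * \<epsilon> < \<alpha>")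
      case True
      have "type_I_error (law \<epsilon>) X0 (K \<epsilon>) \<le> ennreal (\<kappa> * \<epsilon>)"
        unfolding type_I_error_def using True err0[OF \<epsilon>] by (auto simp: K_def intro!: SUP_least)
      also have "\<dots> < ennreal \<alpha>" using True \<alpha> by (simp add: ennreal_less_iff ennreal_lessI)
      finally show ?thesis .
    next
      case False
      have "type_I_error (law \<epsilon>) X0 (K \<epsilon>) \<le> 0"
        unfolding type_I_error_def K_def using False by (intro SUP_least) simp
      also have "0 < ennreal \<alpha>" using \<alpha> by simp
      finally show ?thesis .
    qed
    moreover have "((\<lambda>\<epsilon>. type_II_error (law \<epsilon>) X1 (K \<epsilon>)) \<longlongrightarrow> 0) (at_right 0)"
    proof (rule tendsto_sandwich[where f = "\<lambda>_. 0" and h = "\<lambda>\<epsilon>. ennreal (\<kappa> * \<epsilon>)"])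
      have lim: "((\<lambda>\<epsilon>. \<kappa> * \<epsilon>) \<longlongrightarrow> \<kappa> * 0) (at_right 0)"
        by (intro tendsto_intros)
      then show "((\<lambda>\<epsilon>. ennreal (\<kappa> * \<epsilon>)) \<longlongrightarrow> 0) (at_right 0)"
        using tendsto_ennrealI[OF lim] by simp
      have "\<forall>\<^sub>F \<epsilon> in at_right 0. \<kappa> * \<epsilon> < \<alpha>"
        using lim \<alpha> by (intro order_tendstoD(2)) auto
      moreover have "\<forall>\<^sub>F \<epsilon> in at_right (0::real). 0 < \<epsilon>" by (simp add: eventually_at_right_less)
      ultimately show "\<forall>\<^sub>F \<epsilon> in at_right 0. type_II_error (law \<epsilon>) X1 (K \<epsilon>) \<le> ennreal (\<kappa> * \<epsilon>)"
      proof eventually_elim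
        case (elim \<epsilon>)
        then show ?case
          unfolding type_II_error_def using err1[of \<epsilon>] by (auto simp: K_def intro!: SUP_least)
      qed
    qed auto
    ultimately show "\<exists>K. (\<forall>\<epsilon>>0. is_test N (K \<epsilon>) \<and> type_I_error (law \<epsilon>) X0 (K \<epsilon>) < ennreal \<alpha>) \<and>
        ((\<lambda>\<epsilon>. type_II_error (law \<epsilon>) X1 (K \<epsilon>)) \<longlongrightarrow> 0) (at_right 0)"
      by (intro exI[of _ K]) auto
  qed
qed

end

section \<open>Observation spaces generated by their coordinates\<close>

text \<open>A summable family has only countably many nonzero terms, and \<open>(Re,e) = |S e|\<^sup>2\<close> vanishes for no basis
  vector when \<open>R\<close> is injective.\<close>

lemma countable_orthonormal_basis_of_trace_class:
  fixes R :: "'a::{real_inner,complete_space} \<Rightarrow> 'a"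
  assumes tr: "trace_class R" and R: "nonneg_operator R" and inj: "\<And>x. R x = 0 \<Longrightarrow> x = 0"
  obtains B :: "'a set" where "countable B" "closure (span B) = UNIV"
proof -
  obtain B where B: "orthonormal_basis B" "(\<lambda>e. inner (R e) e) summable_on B"
    using tr by (auto simp: trace_class_def)
  have "inner (R e) e \<noteq> 0" if "e \<in> B" for e
  proof
    assume zero: "inner (R e) e = 0"
    note sq = op_sqrt_properties[OF R]
    have "inner (op_sqrt R e) (op_sqrt R e) = inner (R e) e"
      using sq(1) unfolding nonneg_operator_def by (metis sq(2))
    then have "op_sqrt R e = 0" using zero by simp
    moreover have "op_sqrt R 0 = 0"
      using sq(1) by (simp add: nonneg_operator_def linear_0 bounded_linear.linear)
    ultimately have "R e = 0" using sq(2)[of e] by simp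
    then show False using inj B(1) that by (force simp: orthonormal_basis_def)
  qed
  then have "{e\<in>B. inner (R e) e \<noteq> 0} = B" by auto
  then have "countable B" using summable_countable_real[OF B(2)] by simp
  then show thesis using B(1) that by (auto simp: orthonormal_basis_def)
qed

text \<open>The finite combinations with rational coefficients are dense.\<close>

lemma countable_dense_of_countable_span:
  fixes B :: "'a::real_normed_vector set"
  assumes B: "countable B" "closure (span B) = UNIV"
  obtains D :: "'a set" where "countable D" "closure D = UNIV"
proof -
  define g where "g xs = (\<Sum>(q, b)\<leftarrow>xs. q *\<^sub>R b)" for xs :: "(real \<times> 'a) list"
  define D where "D = g ` lists (\<rat> \<times> B)"
  have "countable D"
    unfolding D_def using B(1) by (intro countable_image countable_lists countable_SIGMA countable_rat) auto
  moreover have "x \<in> closure D" if "x \<in> span B" for x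
    using that
  proof (induction rule: span_induct_alt)
    case base
    have "g [] \<in> D" unfolding D_def by (intro imageI) auto
    then show ?case using closure_subset[of D] by (auto simp: g_def)
  next
    case (step c b x)
    show ?case
      unfolding closure_approachable
    proof (intro allI impI)
      fix e :: real assume e: "0 < e"
      obtain d where d: "d \<in> D" "dist d x < e / 2"
        using step.IH e unfolding closure_approachable by (meson half_gt_zero)
      have nb: "0 < norm b + 1" by (simp add: add_nonneg_pos)
      define \<delta> where "\<delta> = e / (2 * (norm b + 1))"
      have \<delta>: "0 < \<delta>" unfolding \<delta>_def using e nb by simp
      obtain q where q: "q \<in> \<rat>" "c < q" "q < c + \<delta>" using Rats_dense_in_real[of c "c + \<delta>"] \<delta> by auto
      have "norm ((q - c) *\<^sub>R b) \<le> \<delta> * (norm b + 1)"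
        unfolding norm_scaleR using q by (intro mult_mono) auto
      also have "\<dots> = e / 2" unfolding \<delta>_def using nb by (simp add: field_simps)
      finally have "norm ((q - c) *\<^sub>R b) \<le> e / 2" .
      moreover have "dist (q *\<^sub>R b + d) (c *\<^sub>R b + x) \<le> norm ((q - c) *\<^sub>R b) + dist d x"
        using norm_triangle_ineq[of "(q - c) *\<^sub>R b" "d - x"] by (simp add: dist_norm algebra_simps)
      ultimately have "dist (q *\<^sub>R b + d) (c *\<^sub>R b + x) < e" using d(2) by linarith
      moreover obtain xs where xs: "xs \<in> lists (\<rat> \<times> B)" "d = g xs" using d(1) by (auto simp: D_def)
      have "g ((q, b) # xs) \<in> D" unfolding D_def using xs q(1) step.hyps by (intro imageI) auto
      then have "q *\<^sub>R b + d \<in> D" using xs(2) by (simp add: g_def)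
      ultimately show "\<exists>y\<in>D. dist y (c *\<^sub>R b + x) < e" by blast
    qed
  qed
  then have "closure (span B) \<subseteq> closure D" by (intro closure_minimal) auto
  then have "closure D = UNIV" using B(2) by auto
  ultimately show thesis by (rule that)
qed

text \<open>A closed ball is cut out by the inequalities \<open>(y - a, d) \<le> r|d|\<close> with \<open>d\<close> in the countable dense set, and
  an open set is a countable union of closed balls with centres in this set and rational radii.\<close>

lemma sets_borel_eq_inner_cylinders:
  fixes D :: "'a::real_inner set"
  assumes D: "countable D" "closure D = UNIV"
  shows "sets (borel :: 'a measure)
    = sigma_sets (space borel) {(\<lambda>y. inner y h) -` B \<inter> space borel | h B. B \<in> sets borel}"
proof
  let ?G = "{(\<lambda>y::'a. inner y h) -` B \<inter> space borel | h B. B \<in> sets borel}"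
  let ?C = "sigma (UNIV :: 'a set) ?G"
  have sets_C: "sets ?C = sigma_sets (space borel) ?G" by simp
  have [measurable]: "(\<lambda>y. inner y h) \<in> borel_measurable ?C" for h
  proof (rule measurableI)
    fix B :: "real set" assume "B \<in> sets borel"
    then have "(\<lambda>y. inner y h) -` B \<inter> space borel \<in> ?G" by blast
    then show "(\<lambda>y. inner y h) -` B \<inter> space ?C \<in> sets ?C" by (simp add: sigma_sets.Basic)
  qed simp
  have ball: "cball a r \<in> sets ?C" if r: "0 \<le> r" for a r
  proof -
    have "norm (y - a) \<le> r" if le: "\<And>d. d \<in> D \<Longrightarrow> inner y d - inner a d \<le> r * norm d" for y
    proof (rule ccontr)
      assume far: "\<not> norm (y - a) \<le> r"
      let ?U = "{w. r * norm w < inner (y - a) w}"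
      have "open ?U" by (intro open_Collect_less continuous_intros)
      moreover have "y - a \<in> ?U"
      proof -
        have "r < norm (y - a)" "0 < norm (y - a)" using far r by linarith+
        then show ?thesis by (simp add: dot_square_norm power2_eq_square mult_strict_right_mono)
      qed
      ultimately have "D \<inter> ?U \<noteq> {}" using D(2) open_Int_closure_eq_empty[of ?U D] by blast
      then show False using le by (auto simp: inner_diff_left not_le[symmetric])
    qed
    moreover have "inner y d - inner a d \<le> r * norm d" if "norm (y - a) \<le> r" for y d
      using norm_cauchy_schwarz[of "y - a" d] mult_right_mono[OF that, of "norm d"]
      by (simp add: inner_diff_left)
    ultimately have "cball a r = {y\<in>space ?C. \<forall>d\<in>D. inner y d - inner a d \<le> r * norm d}"
      by (auto simp: dist_norm norm_minus_commute)
    also have "\<dots> \<in> sets ?C" using D(1) by measurable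
    finally show ?thesis .
  qed
  have "U \<in> sets ?C" if U: "open U" for U :: "'a set"
  proof -
    define P where "P = {p \<in> D \<times> {q\<in>\<rat>. 0 \<le> q}. cball (fst p) (snd p) \<subseteq> U}"
    have nonneg_rats: "countable {q\<in>\<rat>. (0::real) \<le> q}" by (rule countable_subset[OF _ countable_rat]) auto
    have "countable P"
      unfolding P_def
      by (intro countable_subset[OF _ countable_SIGMA[OF D(1) nonneg_rats]]) auto
    then have "(\<Union>p\<in>P. cball (fst p) (snd p)) \<in> sets ?C"
      by (intro sets.countable_UN'' ball) (auto simp: P_def)
    moreover have "(\<Union>p\<in>P. cball (fst p) (snd p)) = U"
    proof
      show "U \<subseteq> (\<Union>p\<in>P. cball (fst p) (snd p))"
      proof
        fix x assume "x \<in> U"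
        then obtain e where e: "0 < e" "ball x e \<subseteq> U" using U openE by blast
        obtain q where q: "q \<in> \<rat>" "0 < q" "q < e / 2" using Rats_dense_in_real[of 0 "e / 2"] e by auto
        have "x \<in> closure D" using D(2) by simp
        then obtain d where d: "d \<in> D" "dist d x < q"
          unfolding closure_approachable using q(2) by blast
        have "cball d q \<subseteq> ball x e"
        proof
          fix y assume "y \<in> cball d q"
          then have "dist x y < e" using d(2) q(3) dist_triangle[of x y d] by (simp add: dist_commute)
          then show "y \<in> ball x e" by simp
        qed
        then have "(d, q) \<in> P" using d(1) q e(2) by (auto simp: P_def)
        then show "x \<in> (\<Union>p\<in>P. cball (fst p) (snd p))"
          using d(2) by (intro UN_I[of "(d, q)"]) auto
      qed
    qed (auto simp: P_def)
    ultimately show ?thesis by simp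
  qed
  then have "sigma_sets UNIV {U :: 'a set. open U} \<subseteq> sigma_sets (space borel) ?G"
    using sets.sigma_sets_subset[of "{U. open U}" ?C] unfolding sets_C by auto
  then show "sets borel \<subseteq> sigma_sets (space borel) ?G"
    by (simp add: borel_def)
  have "(\<lambda>y::'a. inner y h) \<in> borel_measurable borel" for h
    by (intro borel_measurable_continuous_onI continuous_intros)
  then have "?G \<subseteq> sets borel" using measurable_sets[of _ "borel :: 'a measure"] by blast
  then show "sigma_sets (space borel) ?G \<subseteq> sets borel"
    by (rule sets.sigma_sets_subset)
qed

lemma sets_PiM_eq_coordinate_cylinders:
  "sets (Pi\<^sub>M UNIV (\<lambda>_::'i. borel :: real measure))
    = sigma_sets (space (Pi\<^sub>M UNIV (\<lambda>_::'i. borel :: real measure)))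
        {(\<lambda>y. y h) -` B \<inter> space (Pi\<^sub>M UNIV (\<lambda>_::'i. borel :: real measure)) | h B. B \<in> sets borel}"
  unfolding sets_PiM_single
  by (auto simp: space_PiM PiE_def intro!: arg_cong2[where f = sigma_sets])

text \<open>The dichotomy for an abstract experiment. Density of the range of \<open>S\<close> is what makes the separating
  directions observable.\<close>

theorem (in gaussian_experiment) separation_criterion:
  assumes X01: "X0 \<subseteq> X" "X1 \<subseteq> X" and b: "bounded (signal ` X0)" "bounded (signal ` X1)"
    and dense: "closure (range S) = UNIV"
  shows "\<not> separated_by_projection (signal ` X0) (signal ` X1) \<Longrightarrow> indistinguishable N law X0 X1"
    and "separated_by_projection (signal ` X0) (signal ` X1) \<Longrightarrow> distinguishable N law X0 X1"
proof -
  assume "\<not> separated_by_projection (signal ` X0) (signal ` X1)"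
  then show "indistinguishable N law X0 X1"
    by (rule indistinguishable_of_not_separated[OF X01 b])
next
  assume sep: "separated_by_projection (signal ` X0) (signal ` X1)"
  obtain B \<delta> where B: "finite B" "0 < \<delta>"
    "\<And>x y. x \<in> signal ` X0 \<Longrightarrow> y \<in> signal ` X1 \<Longrightarrow> \<delta> \<le> (\<Sum>e\<in>B. \<bar>inner x e - inner y e\<bar>)"
    by (rule separated_by_projection_gap[OF sep b]) (rule that)
  obtain F \<eta> where F: "finite F" "F \<subseteq> range S" "0 < \<eta>"
    "\<And>x y. x \<in> signal ` X0 \<Longrightarrow> y \<in> signal ` X1 \<Longrightarrow> \<exists>g\<in>F. \<eta> \<le> \<bar>inner x g - inner y g\<bar>"
    by (rule gap_in_dense_range[OF b dense B(1,2)]; (rule B(3) that; assumption))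
  obtain H where H: "finite H" "F = S ` H"
    using finite_subset_image[OF F(1,2)] by blast
  show "distinguishable N law X0 X1"
  proof (rule distinguishable_of_gap[OF X01 b(2) H(1) F(3)])
    fix x y assume "x \<in> X0" "y \<in> X1"
    then show "\<exists>h\<in>H. \<eta> \<le> \<bar>inner (signal x) (S h) - inner (signal y) (S h)\<bar>"
      using F(4)[of "signal x" "signal y"] H(2) by blast
  qed
qed

theorem theorem2p12:
  fixes A R :: "'a::{real_inner, complete_space} \<Rightarrow> 'a"
    and \<Theta> \<Theta>0 \<Theta>1 \<Lambda>0 \<Lambda>1 :: "'a set"
    and M :: "'w measure" and \<xi> :: "'w \<Rightarrow> 'a"
    and M' :: "'v measure" and \<xi>' :: "'a \<Rightarrow> 'v \<Rightarrow> real"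
  assumes "linear A" and "\<forall>x. A x = 0 \<longrightarrow> x = 0"
    and "nonneg_operator R" and "\<forall>x. R x = 0 \<longrightarrow> x = 0"
    and "subspace \<Theta>" and "closed \<Theta>" and "\<Theta>0 \<subseteq> \<Theta>" and "\<Theta>1 \<subseteq> \<Theta>"
    and "A ` (\<Theta>0 \<union> \<Theta>1) \<subseteq> range (op_sqrt R)"
    and "\<Lambda>0 = op_inv_sqrt R ` A ` \<Theta>0" and "\<Lambda>1 = op_inv_sqrt R ` A ` \<Theta>1"
    and "bounded \<Lambda>0" and "bounded \<Lambda>1"
  shows
    "(trace_class R \<and> gaussian_vector M R \<xi> \<longrightarrow>
        (\<not> separated_by_projection \<Lambda>0 \<Lambda>1 \<longrightarrow>
           indistinguishable borel (vector_law A M \<xi>) \<Theta>0 \<Theta>1) \<and>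
        (separated_by_projection \<Lambda>0 \<Lambda>1 \<longrightarrow>
           distinguishable borel (vector_law A M \<xi>) \<Theta>0 \<Theta>1)) \<and>
     (gaussian_family M' R \<xi>' \<longrightarrow>
        (\<not> separated_by_projection \<Lambda>0 \<Lambda>1 \<longrightarrow>
           indistinguishable (Pi\<^sub>M UNIV (\<lambda>_. borel)) (family_law A M' \<xi>') \<Theta>0 \<Theta>1) \<and>
        (separated_by_projection \<Lambda>0 \<Lambda>1 \<longrightarrow>
           distinguishable (Pi\<^sub>M UNIV (\<lambda>_. borel)) (family_law A M' \<xi>') \<Theta>0 \<Theta>1))"
proof -
  define S where "S = op_sqrt R"
  note R = \<open>nonneg_operator R\<close>
  have S: "nonneg_operator S" and SS: "\<And>x. S (S x) = R x"
    unfolding S_def by (rule op_sqrt_properties[OF R])+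
  interpret S: bounded_linear S using S by (simp add: nonneg_operator_def)
  have ker: "x = 0" if "S x = 0" for x
  proof -
    have "R x = 0" using SS[of x] that by (simp add: S.zero)
    then show ?thesis using assms(4) by blast
  qed
  have inj: "inj S"
    using ker S.linear_axioms linear_injective_0 by blast
  have dense: "closure (range S) = UNIV"
    by (rule symmetric_injective_dense_range[OF S ker])
  define signal where "signal x = inv S (A x)" for x
  have A0: "A 0 = 0" by (rule linear_0[OF assms(1)])
  have signal: "S (signal x) = A x" if "x \<in> insert 0 (\<Theta>0 \<union> \<Theta>1)" for x
  proof -
    have "A x \<in> range S"
      using that assms(9) A0 S.zero unfolding S_def by (metis Un_iff imageI insertE rangeI subsetD)
    then show ?thesis unfolding signal_def by (rule f_inv_into_f)
  qed
  have signal0: "signal 0 = 0" using signal[of 0] A0 ker by simp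
  have \<Lambda>: "\<Lambda>0 = signal ` \<Theta>0" "\<Lambda>1 = signal ` \<Theta>1"
    using assms(10,11) by (auto simp: signal_def op_inv_sqrt_def S_def)
  have inner_A: "inner (A x) h = inner (signal x) (S h)" if "x \<in> insert 0 (\<Theta>0 \<union> \<Theta>1)" for x h
    using signal[OF that] S by (metis nonneg_operator_def)
  have vector_case: "(\<not> separated_by_projection \<Lambda>0 \<Lambda>1 \<longrightarrow> indistinguishable borel (vector_law A M \<xi>) \<Theta>0 \<Theta>1) \<and>
      (separated_by_projection \<Lambda>0 \<Lambda>1 \<longrightarrow> distinguishable borel (vector_law A M \<xi>) \<Theta>0 \<Theta>1)"
    if tr: "trace_class R" and G: "gaussian_vector M R \<xi>"
  proof -
    have \<xi>: "\<xi> \<in> borel_measurable M" and fam: "gaussian_family M R (\<lambda>h \<omega>. inner (\<xi> \<omega>) h)"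
      using G by (auto simp: gaussian_vector_def)
    obtain W where W: "isonormal M W" "\<And>h. W (S h) = (\<lambda>\<omega>. inner (\<xi> \<omega>) h)"
      by (rule isonormal_of_gaussian_family[OF fam S SS inj dense]) (rule that)
    obtain B :: "'a set" where "countable B" "closure (span B) = UNIV"
      using countable_orthonormal_basis_of_trace_class[OF tr R] assms(4) by blast
    then obtain D :: "'a set" where D: "countable D" "closure D = UNIV"
      by (rule countable_dense_of_countable_span)
    interpret E: gaussian_experiment M W borel "\<lambda>h y. inner y h" S "insert 0 (\<Theta>0 \<union> \<Theta>1)" signal 0
      "\<lambda>\<epsilon> x \<omega>. A x + \<epsilon> *\<^sub>R \<xi> \<omega>"
    proof (intro gaussian_experiment.intro gaussian_experiment_axioms.intro W(1))
      show "sets (borel :: 'a measure)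
          = sigma_sets (space borel) {(\<lambda>y. inner y h) -` B \<inter> space borel | h B. B \<in> sets borel}"
        by (rule sets_borel_eq_inner_cylinders[OF D])
      show "(\<lambda>\<omega>. A x + \<epsilon> *\<^sub>R \<xi> \<omega>) \<in> borel_measurable M" for \<epsilon> x
        by (rule measurable_compose[OF \<xi>]) (intro borel_measurable_continuous_onI continuous_intros)
      show "inner (A x + \<epsilon> *\<^sub>R \<xi> \<omega>) h = inner (signal x) (S h) + \<epsilon> * W (S h) \<omega>"
        if "x \<in> insert 0 (\<Theta>0 \<union> \<Theta>1)" for \<epsilon> x \<omega> h
        using inner_A[OF that] by (simp add: W(2) inner_add_left)
    qed (use signal0 in auto)
    have law: "vector_law A M \<xi> = E.law" by (simp add: vector_law_def fun_eq_iff)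
    show ?thesis
      unfolding law \<Lambda> using E.separation_criterion[of \<Theta>0 \<Theta>1] assms(12,13) dense by (auto simp: \<Lambda>)
  qed
  have family_case: "(\<not> separated_by_projection \<Lambda>0 \<Lambda>1 \<longrightarrow>
           indistinguishable (Pi\<^sub>M UNIV (\<lambda>_. borel)) (family_law A M' \<xi>') \<Theta>0 \<Theta>1) \<and>
        (separated_by_projection \<Lambda>0 \<Lambda>1 \<longrightarrow>
           distinguishable (Pi\<^sub>M UNIV (\<lambda>_. borel)) (family_law A M' \<xi>') \<Theta>0 \<Theta>1)"
    if G: "gaussian_family M' R \<xi>'"
  proof -
    obtain W where W: "isonormal M' W" "\<And>h. W (S h) = \<xi>' h"
      by (rule isonormal_of_gaussian_family[OF G S SS inj dense]) (rule that)
    interpret W: isonormal M' W by (rule W(1))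
    have \<xi>': "\<xi>' h \<in> borel_measurable M'" for h
      using W.measurable_W[of "S h"] by (simp add: W(2))
    interpret E: gaussian_experiment M' W "Pi\<^sub>M UNIV (\<lambda>_. borel)" "\<lambda>h y. y h" S
      "insert 0 (\<Theta>0 \<union> \<Theta>1)" signal 0 "\<lambda>\<epsilon> x \<omega> h. inner (A x) h + \<epsilon> * \<xi>' h \<omega>"
    proof (intro gaussian_experiment.intro gaussian_experiment_axioms.intro W(1) sets_PiM_eq_coordinate_cylinders)
      show "(\<lambda>\<omega> h. inner (A x) h + \<epsilon> * \<xi>' h \<omega>) \<in> measurable M' (Pi\<^sub>M UNIV (\<lambda>_. borel))" for \<epsilon> x
        using \<xi>' by (intro measurable_PiM_single') auto
      show "inner (A x) h + \<epsilon> * \<xi>' h \<omega> = inner (signal x) (S h) + \<epsilon> * W (S h) \<omega>"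
        if "x \<in> insert 0 (\<Theta>0 \<union> \<Theta>1)" for \<epsilon> x \<omega> h
        using inner_A[OF that] by (simp add: W(2))
    qed (use signal0 in auto)
    have law: "family_law A M' \<xi>' = E.law" by (simp add: family_law_def fun_eq_iff)
    show ?thesis
      unfolding law \<Lambda> using E.separation_criterion[of \<Theta>0 \<Theta>1] assms(12,13) dense by (auto simp: \<Lambda>)
  qed
  show ?thesis using vector_case family_case by blast
qed

end
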